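(* Let $\bar A=(A_0,A_1)$ be a compatible couple of (quasi-)Banach spaces with $A_0\cap A_1\neq\{0\}$. Let $0<q_1,r_1\le\infty$ and $a_1,b_1\in SV$ be such that $\|s^{-1/r_1}b_1(s)\|_{r_1,(1,\infty)}<\infty$ and $\left\|s^{-1/r_1}b_1(s)\|u^{-1/q_1}a_1(u)\|_{q_1,(0,s)}\right\|_{r_1,(0,1)}<\infty$, and put $$\chi_1(t)=\left\|s^{-1/r_1}b_1(s)\|u^{-1/q_1}a_1(u)\|_{q_1,(0,s)}\right\|_{r_1,(0,t)}+\|s^{-1/r_1}b_1(s)\|_{r_1,(t,\infty)}\|u^{-1/q_1}a_1(u)\|_{q_1,(0,t)}.$$ Let $0<r,r_0,q_0\le\infty$, $a,a_0,b_0\in SV$, and $\left\|s^{-1/r_0}b_0(s)\|u^{-1/q_0}a_0(u)\|_{q_0,(1,s)}\right\|_{r_0,(1,\infty)}<\infty$. Put $\chi_0(t)=\left\|s^{-1/r_0}b_0(s)\|u^{-1/q_0}a_0(u)\|_{q_0,(t,s)}\right\|_{r_0,(t,\infty)}$ and $\rho(t)=t\frac{\chi_0(t)}{\chi_1(t)}$. For given $0\le\theta\le1$ denote $a^{\#}=\chi_0^{1-\theta}\chi_1^{\theta}\,(a\circ\rho)$. (i) If $0<\theta<1$, then $\left(\bar A^{\mathcal L}_{0,r_0,b_0,q_0,a_0},\bar A^{\mathcal L}_{1,r_1,b_1,q_1,a_1}\right)_{\theta,r,a}=\bar A_{\theta,r,a^{\#}}$. (ii) If $\|s^{-1/r}a(s)\|_{r,(1,\infty)}<\infty$,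 then, with $\theta=0$ (i.e. $a^{\#}=\chi_0\,(a\circ\rho)$), $$\left(\bar A^{\mathcal L}_{0,r_0,b_0,q_0,a_0},\bar A^{\mathcal L}_{1,r_1,b_1,q_1,a_1}\right)_{0,r,a}=\bar A_{0,r,a^{\#}}\cap\bar A^{\mathcal L}_{0,r,B_0,q_0,a_0}\cap\bar A^{\mathcal L,\mathcal L}_{0,r,a\circ\rho,r_0,b_0,q_0,a_0},$$ where $B_0(t)=\|s^{-1/r_0}b_0(s)\|_{r_0,(t,\infty)}\,a(\rho(t))$. (iii) If $\|s^{-1/r}a(s)\|_{r,(0,1)}<\infty$, then, with $\theta=1$ (i.e. $a^{\#}=\chi_1\,(a\circ\rho)$), $\left(\bar A^{\mathcal L}_{0,r_0,b_0,q_0,a_0},\bar A^{\mathcal L}_{1,r_1,b_1,q_1,a_1}\right)_{1,r,a}=\bar A_{1,r,a^{\#}}\cap\bar A^{\mathcal L,\mathcal R}_{1,r,a\circ\rho,r_1,b_1,q_1,a_1}$.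
   Context: Conventions: $1/\infty=0$; $\|\cdot\|_{q,(a,b)}$ is the usual (quasi-)norm of $L_q$ on the interval $(a,b)$, $0<q\le\infty$. Two positive functions satisfy $f\approx g$ (are equivalent) if $C^{-1}g\le f\le Cg$ for some constant $C>0$ independent of all significant quantities. $b\in SV$ (slowly varying) means that $b$ is a positive Lebesgue measurable function on $(0,\infty)$ such that for each $\varepsilon>0$ the function $t^{\varepsilon}b(t)$ is equivalent to an increasing function and $t^{-\varepsilon}b(t)$ is equivalent to a decreasing function. For a compatible couple $(X_0,X_1)$ of (quasi-)normed spaces, $K(t,f;X_0,X_1)=\inf\{\|f_0\|_{X_0}+t\|f_1\|_{X_1}: f=f_0+f_1,\ f_i\in X_i\}$ for $f\in X_0+X_1$, $t>0$; $K(t,f):=K(t,f;A_0,A_1)$. For $0\le\theta\le1$, $0<q\le\infty$, $b\in SV$, $(X_0,X_1)_{\theta,q,b}$ is the space of all $f\in X_0+X_1$ with finite (quasi-)norm $\|u^{-\theta-1/q}b(u)K(u,f;X_0,X_1)\|_{q,(0,\infty)}$, and $\bar A_{\theta,q,b}:=(A_0,A_1)_{\theta,q,b}$. For $0<p,r,q\le\infty$ and $a,b,c\in SV$, the following are the spaces of all $f\in A_0+A_1$ with finite (quasi-)norm: - $\bar A^{\mathcal L}_{\theta,r,b,q,a}$: $\left\|t^{-1/r}b(t)\|u^{-\theta-1/q}a(u)K(u,f)\|_{q,(0,t)}\right\|_{r,(0,\infty)}$; - $\bar A^{\mathcal L,\mathcal L}_{\theta,p,c,r,b,q,a}$: $\left\|t^{-1/p}c(t)\left\|u^{-1/r}b(u)\|v^{-\theta-1/q}a(v)K(v,f)\|_{q,(0,u)}\right\|_{r,(0,t)}\right\|_{p,(0,\infty)}$;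 - $\bar A^{\mathcal L,\mathcal R}_{\theta,p,c,r,b,q,a}$: $\left\|t^{-1/p}c(t)\left\|u^{-1/r}b(u)\|v^{-\theta-1/q}a(v)K(v,f)\|_{q,(t,u)}\right\|_{r,(t,\infty)}\right\|_{p,(0,\infty)}$. Equality of (quasi-)normed spaces means that each is continuously embedded in the other; intersections carry the maximum (equivalently, the sum) of the (quasi-)norms. Standing assumption: none of the spaces under consideration is $\{0\}$. *)

theory Defs
  imports "HOL-Analysis.Analysis"
begin

section \<open>Quasi-Banach couples\<close>

text \<open>
  A (quasi-)normed space inside an ambient real vector space is given by its extended
  (quasi-)norm, with value \<open>\<infinity>\<close> exactly off the space. The three axioms of
  \<open>quasi_norm\<close>, read in \<open>[0,\<infinity>]\<close>, say that the finiteness set is a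
  linear subspace on which the function is a quasi-norm in the usual sense.
\<close>

definition qspace :: "('a \<Rightarrow> ennreal) \<Rightarrow> 'a set" where
  "qspace N = {f. N f < \<infinity>}"

definition quasi_norm :: "('a::real_vector \<Rightarrow> ennreal) \<Rightarrow> bool" where
  "quasi_norm N \<longleftrightarrow>
     (\<forall>f. N f = 0 \<longleftrightarrow> f = 0) \<and>
     (\<forall>c f. N (c *\<^sub>R f) = ennreal \<bar>c\<bar> * N f) \<and>
     (\<exists>C::real. C \<ge> 1 \<and> (\<forall>f g. N (f + g) \<le> ennreal C * (N f + N g)))"

definition quasi_banach :: "('a::real_vector \<Rightarrow> ennreal) \<Rightarrow> bool" where
  "quasi_banach N \<longleftrightarrow> quasi_norm N \<and>
     (\<forall>x::nat \<Rightarrow> 'a.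
        (\<forall>n. x n \<in> qspace N) \<and>
        (\<forall>e::real. e > 0 \<longrightarrow> (\<exists>M. \<forall>m\<ge>M. \<forall>n\<ge>M. N (x m - x n) < ennreal e)) \<longrightarrow>
        (\<exists>y\<in>qspace N. (\<lambda>n. N (x n - y)) \<longlonglongrightarrow> 0))"

definition hausdorff_vector_topology :: "'a::real_vector topology \<Rightarrow> bool" where
  "hausdorff_vector_topology T \<longleftrightarrow>
     topspace T = UNIV \<and> Hausdorff_space T \<and>
     continuous_map (prod_topology T T) T (\<lambda>(f, g). f + g) \<and>
     continuous_map (prod_topology (euclidean :: real topology) T) T (\<lambda>(c, f). c *\<^sub>R f)"

text \<open>By linearity, continuity of the inclusion is continuity at \<open>0\<close>.\<close>

definition embeds_into_topology :: "('a::real_vector \<Rightarrow> ennreal) \<Rightarrow> 'a topology \<Rightarrow> bool" where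
  "embeds_into_topology N T \<longleftrightarrow>
     (\<forall>U. openin T U \<and> 0 \<in> U \<longrightarrow> (\<exists>e::real. e > 0 \<and> {f. N f < ennreal e} \<subseteq> U))"

definition compatible_quasi_banach_couple ::
    "('a::real_vector \<Rightarrow> ennreal) \<Rightarrow> ('a \<Rightarrow> ennreal) \<Rightarrow> bool" where
  "compatible_quasi_banach_couple N0 N1 \<longleftrightarrow> quasi_banach N0 \<and> quasi_banach N1 \<and>
     (\<exists>T. hausdorff_vector_topology T \<and> embeds_into_topology N0 T \<and> embeds_into_topology N1 T)"

definition sum_space :: "('a::real_vector \<Rightarrow> ennreal) \<Rightarrow> ('a \<Rightarrow> ennreal) \<Rightarrow> 'a set" where
  "sum_space N0 N1 = {f0 + f1 | f0 f1. f0 \<in> qspace N0 \<and> f1 \<in> qspace N1}"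

definition inter_norm :: "('a \<Rightarrow> ennreal) \<Rightarrow> ('a \<Rightarrow> ennreal) \<Rightarrow> 'a \<Rightarrow> ennreal" where
  "inter_norm N M f = max (N f) (M f)"

definition restrict_norm :: "'a set \<Rightarrow> ('a \<Rightarrow> ennreal) \<Rightarrow> 'a \<Rightarrow> ennreal" where
  "restrict_norm S N f = (if f \<in> S then N f else \<infinity>)"

text \<open>For quasi-norms a linear inclusion is continuous iff it is bounded.\<close>

definition cont_embedded :: "('a \<Rightarrow> ennreal) \<Rightarrow> ('a \<Rightarrow> ennreal) \<Rightarrow> bool" where
  "cont_embedded N M \<longleftrightarrow> qspace N \<subseteq> qspace M \<and>
     (\<exists>C::real. C > 0 \<and> (\<forall>f\<in>qspace N. M f \<le> ennreal C * N f))"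

definition same_space :: "('a \<Rightarrow> ennreal) \<Rightarrow> ('a \<Rightarrow> ennreal) \<Rightarrow> bool" where
  "same_space N M \<longleftrightarrow> cont_embedded N M \<and> cont_embedded M N"


section \<open>Lebesgue quasi-norms and slowly varying functions\<close>

text \<open>\<open>recip q\<close> is \<open>1/q\<close>, with \<open>1/\<infinity> = 0\<close>.\<close>

definition recip :: "ennreal \<Rightarrow> real" where
  "recip q = enn2real (1 / q)"

text \<open>Only used with exponent \<open>p > 0\<close>.\<close>

definition ennpow :: "ennreal \<Rightarrow> real \<Rightarrow> ennreal" where
  "ennpow x p = (if x = \<infinity> then \<infinity> else ennreal (enn2real x powr p))"

text \<open>
  The essential supremum is written out so that it is monotone in \<open>g\<close> without any
  measurability assumption, as \<open>nn_integral\<close> is; the library's \<open>esssup\<close> is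
  \<open>\<infinity>\<close> on every non-measurable function. This matters because weights are composed with
  other functions in the theorem: for \<open>a\<close> slowly varying (only Lebesgue measurable) and
  \<open>\<rho>\<close> Borel, \<open>a \<circ> \<rho>\<close> need not be measurable, although it is
  equivalent to a measurable function. On measurable functions both versions agree.
\<close>

definition Lnorm :: "ennreal \<Rightarrow> real set \<Rightarrow> (real \<Rightarrow> ennreal) \<Rightarrow> ennreal" where
  "Lnorm q S g =
     (if q = \<infinity> then Inf {z. AE x in lebesgue_on S. g x \<le> z}
      else ennpow (\<integral>\<^sup>+x. ennpow (g x) (enn2real q) \<partial>lebesgue_on S) (recip q))"

text \<open>The weighted quasi-norm of \<open>u\<^sup>-\<^sup>\<theta>\<^sup>-\<^sup>1\<^sup>/\<^sup>q b(u) g(u)\<close> in \<open>L\<^sub>q(S)\<close>.\<close>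

definition wnorm :: "real \<Rightarrow> ennreal \<Rightarrow> (real \<Rightarrow> real) \<Rightarrow> real set \<Rightarrow> (real \<Rightarrow> ennreal) \<Rightarrow> ennreal" where
  "wnorm \<theta> q b S g = Lnorm q S (\<lambda>u. ennreal (u powr (- \<theta> - recip q) * b u) * g u)"

definition equiv_pos :: "(real \<Rightarrow> real) \<Rightarrow> (real \<Rightarrow> real) \<Rightarrow> bool" where
  "equiv_pos f g \<longleftrightarrow> (\<exists>C>0. \<forall>t>0. g t / C \<le> f t \<and> f t \<le> C * g t)"

definition SV :: "(real \<Rightarrow> real) set" where
  "SV = {b. (\<forall>t>0. b t > 0) \<and> b \<in> borel_measurable (lebesgue_on {0<..}) \<and>
     (\<forall>\<epsilon>>0.
        (\<exists>g. (\<forall>t>0. g t > 0) \<and> mono_on {0<..} g \<and> equiv_pos (\<lambda>t. t powr \<epsilon> * b t) g) \<and>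
        (\<exists>h. (\<forall>t>0. h t > 0) \<and> antimono_on {0<..} h \<and> equiv_pos (\<lambda>t. t powr (- \<epsilon>) * b t) h))}"


section \<open>The interpolation spaces\<close>

definition Kfun :: "('a::real_vector \<Rightarrow> ennreal) \<Rightarrow> ('a \<Rightarrow> ennreal) \<Rightarrow> real \<Rightarrow> 'a \<Rightarrow> ennreal" where
  "Kfun N0 N1 t f =
     Inf {N0 f0 + ennreal t * N1 f1 | f0 f1. f0 \<in> qspace N0 \<and> f1 \<in> qspace N1 \<and> f = f0 + f1}"

definition interp :: "('a::real_vector \<Rightarrow> ennreal) \<Rightarrow> ('a \<Rightarrow> ennreal) \<Rightarrow>
    real \<Rightarrow> ennreal \<Rightarrow> (real \<Rightarrow> real) \<Rightarrow> 'a \<Rightarrow> ennreal" where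
  "interp N0 N1 \<theta> q b = restrict_norm (sum_space N0 N1)
     (\<lambda>f. wnorm \<theta> q b {0<..} (\<lambda>u. Kfun N0 N1 u f))"

definition interp_L :: "('a::real_vector \<Rightarrow> ennreal) \<Rightarrow> ('a \<Rightarrow> ennreal) \<Rightarrow>
    real \<Rightarrow> ennreal \<Rightarrow> (real \<Rightarrow> real) \<Rightarrow> ennreal \<Rightarrow> (real \<Rightarrow> real) \<Rightarrow> 'a \<Rightarrow> ennreal" where
  "interp_L N0 N1 \<theta> r b q a = restrict_norm (sum_space N0 N1)
     (\<lambda>f. wnorm 0 r b {0<..} (\<lambda>t. wnorm \<theta> q a {0<..<t} (\<lambda>u. Kfun N0 N1 u f)))"

definition interp_LL :: "('a::real_vector \<Rightarrow> ennreal) \<Rightarrow> ('a \<Rightarrow> ennreal) \<Rightarrow>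
    real \<Rightarrow> ennreal \<Rightarrow> (real \<Rightarrow> real) \<Rightarrow> ennreal \<Rightarrow> (real \<Rightarrow> real) \<Rightarrow>
    ennreal \<Rightarrow> (real \<Rightarrow> real) \<Rightarrow> 'a \<Rightarrow> ennreal" where
  "interp_LL N0 N1 \<theta> p c r b q a = restrict_norm (sum_space N0 N1)
     (\<lambda>f. wnorm 0 p c {0<..} (\<lambda>t. wnorm 0 r b {0<..<t}
        (\<lambda>u. wnorm \<theta> q a {0<..<u} (\<lambda>v. Kfun N0 N1 v f))))"

definition interp_LR :: "('a::real_vector \<Rightarrow> ennreal) \<Rightarrow> ('a \<Rightarrow> ennreal) \<Rightarrow>
    real \<Rightarrow> ennreal \<Rightarrow> (real \<Rightarrow> real) \<Rightarrow> ennreal \<Rightarrow> (real \<Rightarrow> real) \<Rightarrow>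
    ennreal \<Rightarrow> (real \<Rightarrow> real) \<Rightarrow> 'a \<Rightarrow> ennreal" where
  "interp_LR N0 N1 \<theta> p c r b q a = restrict_norm (sum_space N0 N1)
     (\<lambda>f. wnorm 0 p c {0<..} (\<lambda>t. wnorm 0 r b {t<..}
        (\<lambda>u. wnorm \<theta> q a {t<..<u} (\<lambda>v. Kfun N0 N1 v f))))"

definition nontrivial :: "('a::real_vector \<Rightarrow> ennreal) \<Rightarrow> bool" where
  "nontrivial N \<longleftrightarrow> qspace N \<noteq> {0}"

end

theory Submission
  imports Defs
begin

text \<open>
  Write \<open>k(u)\<close> for the K-functional of \<open>f\<close> in the couple \<open>(A0, A1)\<close>, and \<open>X0\<close>, \<open>X1\<close> for the two spaces to
  be interpolated. The proof computes \<open>K(\<rho>(t), f; X0, X1)\<close> up to constants as an explicit expression in \<open>k\<close>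
  and then compares norms of functions of one variable.

  A decomposition \<open>f = f0 + f1\<close> that is optimal up to the factor 2 for \<open>k(t)\<close> has K-functionals at most of the size of
  \<open>min (k(u)) (k(t))\<close> and of \<open>min (k(u)) (u k(t)/t)\<close> (\<open>near_optimal_decomposition\<close>). Cut the double integrals
  in the norms of \<open>X0\<close> and \<open>X1\<close> at \<open>t\<close>. The truncated parts of the two functions contribute
  \<open>\<chi>\<^sub>0(t) k(t)\<close> and \<open>\<chi>\<^sub>1(t) k(t)/t\<close>: this is what \<open>\<chi>\<^sub>0\<close> and \<open>\<chi>\<^sub>1\<close> measure, and \<open>\<rho>\<close> is the
  factor that makes these contributions equal. The remaining contributions are the parts of the \<open>X0\<close>-norm of \<open>f\<close>
  whose inner variable is below \<open>t\<close>, and \<open>\<rho>(t)\<close> times the part of the \<open>X1\<close>-norm where both variables are above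
  \<open>t\<close>. This gives \<open>holmstedt_upper\<close>. Conversely, the resulting sum is quasi-subadditive in \<open>k\<close>; monotonicity of
  \<open>k(u)\<close> and of \<open>k(u)/u\<close> shows that an element of \<open>X0\<close> has \<open>k\<close> at most of size \<open>1/\<chi>\<^sub>0(u)\<close> and an element of
  \<open>X1\<close> has \<open>k\<close> at most of size \<open>u/\<chi>\<^sub>1(u)\<close>, and inserting these two functions shows that the sum is at most a
  multiple of the norm in \<open>X0\<close>, and of \<open>\<rho>(t)\<close> times the norm in \<open>X1\<close>. This is \<open>holmstedt_lower\<close>.

  The functions \<open>\<chi>\<^sub>0\<close> and \<open>\<chi>\<^sub>1\<close> are slowly varying because the norms that define them are compatible with
  dilations. So \<open>\<rho>(t)\<close> is \<open>t\<close> times a slowly varying function, and the substitution \<open>u = \<rho>(t)\<close> in the outer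
  norm is justified by comparing both sides with the same sum over a lacunary sequence (\<open>change_of_variable\<close>).

  It remains to look at the outer norms of the summands. The one with \<open>\<chi>\<^sub>0(t) k(t)\<close> is the norm with weight
  \<open>a\<^sup>#\<close>. A Hardy-type inequality bounds the terms from \<open>X0\<close> by it if \<open>\<theta> > 0\<close> (\<open>low_mid_hardy\<close>), and the
  term from \<open>X1\<close> if \<open>\<theta> < 1\<close> (\<open>high_hardy\<close>). At an end point the terms that are not absorbed are
  literally the norms of the additional spaces in the intersection.

  Constants must not depend on \<open>f\<close>, and \<open>a \<circ> \<rho>\<close> need not be measurable. Both points are handled by a
  quantitative condition (\<open>tame\<close>) that bounds the relative change of a function when its argument is dilated.
\<close>


section \<open>Lebesgue quasi-norms with respect to du/u\<close>

lemma ennpow_mono: "x \<le> y \<Longrightarrow> 0 \<le> p \<Longrightarrow> ennpow x p \<le> ennpow y p"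
  by (cases x; cases y) (auto simp: ennpow_def top_unique intro!: ennreal_leI powr_mono2)

lemma ennpow_mult: "0 < p \<Longrightarrow> ennpow (x * y) p = ennpow x p * ennpow y p"
  by (cases x; cases y)
     (auto simp: ennpow_def enn2real_mult powr_mult ennreal_mult ennreal_mult_top ennreal_top_mult
        ennreal_mult_eq_top_iff)

lemma ennpow_ennreal [simp]: "0 \<le> x \<Longrightarrow> ennpow (ennreal x) p = ennreal (x powr p)"
  by (simp add: ennpow_def)

lemma ennpow_numeral [simp]: "ennpow (numeral n) p = ennreal (numeral n powr p)"
  using ennpow_ennreal[of "numeral n" p] by simp

lemma ennpow_top [simp]: "ennpow top p = top"
  by (simp add: ennpow_def)

lemma ennpow_inverse: "0 < p \<Longrightarrow> ennpow (ennpow x p) (1 / p) = x"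
  by (cases x) (auto simp: powr_powr)

lemma ennpow_inverse': "0 < p \<Longrightarrow> ennpow (ennpow x (1 / p)) p = x"
  by (cases x) (auto simp: powr_powr)

lemma ennpow_root_le_iff: "0 < p \<Longrightarrow> ennpow x (1 / p) \<le> z \<longleftrightarrow> x \<le> ennpow z p"
  by (metis ennpow_inverse ennpow_inverse' ennpow_mono divide_nonneg_pos less_imp_le zero_le_one)

lemma ennpow_add_le: "0 < p \<Longrightarrow> ennpow (x + y) p \<le> ennreal (2 powr p) * (ennpow x p + ennpow y p)"
proof -
  assume p: "0 < p"
  have "x + y \<le> ennreal 2 * max x y"
    by (metis add_mono ennreal_numeral max.cobounded1 max.cobounded2 mult_2 zero_le_numeral)
  then have "ennpow (x + y) p \<le> ennpow (ennreal 2 * max x y) p"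
    using p by (intro ennpow_mono) auto
  also have "\<dots> = ennreal (2 powr p) * ennpow (max x y) p"
    using p by (simp add: ennpow_mult)
  also have "ennpow (max x y) p \<le> ennpow x p + ennpow y p"
    by (auto simp: max_def intro: add_increasing add_increasing2)
  finally show ?thesis by (simp add: mult_left_mono)
qed

lemma ennpow_measurable [measurable]: "(\<lambda>x. ennpow x p) \<in> borel_measurable borel"
  unfolding ennpow_def by measurable

lemma recip_eq: "0 < q \<Longrightarrow> q \<noteq> \<infinity> \<Longrightarrow> recip q = 1 / enn2real q"
  by (cases q) (auto simp: recip_def divide_ennreal[symmetric] ennreal_1[symmetric] simp del: ennreal_1)

lemma enn2real_pos: "0 < q \<Longrightarrow> q \<noteq> \<infinity> \<Longrightarrow> 0 < enn2real q"
  by (simp add: enn2real_positive_iff less_top)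

text \<open>
  The integral of \<open>f\<close> is a supremum over the simple functions below \<open>f\<close>, and these are rescaled one by one.
  This includes functions that are not measurable, such as weights of the form \<open>a \<circ> \<rho>\<close>.
\<close>

lemma nn_integral_cmult_le:
  assumes c: "0 \<le> c"
  shows "(\<integral>\<^sup>+x. ennreal c * f x \<partial>M) \<le> ennreal c * (\<integral>\<^sup>+x. f x \<partial>M)"
proof (cases "c = 0")
  case False
  then have c: "0 < c" using c by simp
  show ?thesis
    unfolding nn_integral_def[of M "\<lambda>x. ennreal c * f x"]
  proof (rule SUP_least)
    fix g assume g: "g \<in> {g. simple_function M g \<and> g \<le> (\<lambda>x. ennreal c * f x)}"
    define h where "h = (\<lambda>x. ennreal (1 / c) * g x)"
    have cc: "ennreal c * ennreal (1 / c) = 1" using c by (simp flip: ennreal_mult'')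
    have gh: "g = (\<lambda>x. ennreal c * h x)"
      by (simp add: h_def mult.assoc[symmetric] cc)
    have h: "simple_function M h" using g unfolding h_def by auto
    have "h x \<le> f x" for x
    proof -
      have "h x \<le> ennreal (1 / c) * (ennreal c * f x)"
        unfolding h_def using g by (auto intro!: mult_left_mono simp: le_fun_def)
      also have "\<dots> = f x" by (simp add: mult.assoc[symmetric] cc mult.commute[of "ennreal (1/c)"])
      finally show ?thesis .
    qed
    then have "integral\<^sup>S M h \<le> (\<integral>\<^sup>+x. f x \<partial>M)"
      unfolding nn_integral_def using h by (intro SUP_upper) (auto simp: le_fun_def)
    then show "integral\<^sup>S M g \<le> ennreal c * (\<integral>\<^sup>+x. f x \<partial>M)"
      unfolding gh using h by (simp add: mult_left_mono)
  qed
qed simp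

text \<open>
  The factor \<open>u\<^sup>-\<^sup>1\<^sup>/\<^sup>q\<close> turns Lebesgue measure into \<open>du/u\<close>, the measure that is invariant under
  dilations. Every norm of the theorem is of this kind once the remaining weight is moved into \<open>g\<close>.
\<close>

definition mnorm :: "ennreal \<Rightarrow> real set \<Rightarrow> (real \<Rightarrow> ennreal) \<Rightarrow> ennreal" where
  "mnorm q S g = Lnorm q S (\<lambda>u. ennreal (u powr (- recip q)) * g u)"

text \<open>
  The integral under the root of \<open>mnorm\<close>; see \<open>mpow_mnorm\<close>.
\<close>

definition mpow :: "real \<Rightarrow> real set \<Rightarrow> (real \<Rightarrow> ennreal) \<Rightarrow> ennreal" where
  "mpow p S g = (\<integral>\<^sup>+u\<in>S. ennreal (1 / u) * ennpow (g u) p \<partial>lebesgue)"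

abbreviation meas :: "(real \<Rightarrow> ennreal) \<Rightarrow> bool" where
  "meas g \<equiv> g \<in> borel_measurable (lebesgue_on {0<..})"

definition pos_set :: "real set \<Rightarrow> bool" where
  "pos_set S \<longleftrightarrow> S \<in> sets lebesgue \<and> S \<subseteq> {0<..}"

lemma pos_setI [simp, intro]:
  "pos_set {0<..}" "0 \<le> t \<Longrightarrow> pos_set {t<..}" "pos_set {0<..<t}" "0 \<le> t \<Longrightarrow> pos_set {t<..<s}" "0 < t \<Longrightarrow> pos_set {t..<s}"
  "0 < t \<Longrightarrow> pos_set {t..s}" "0 \<le> t \<Longrightarrow> pos_set {t<..s}"
  by (auto simp: pos_set_def)

lemma meas_restrict:
  assumes "pos_set S" "meas g"
  shows "(\<lambda>u. g u * indicator S u) \<in> borel_measurable lebesgue"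
proof -
  have "(\<lambda>u. g u * indicator {0<..} u) \<in> borel_measurable lebesgue"
    using assms(2) by (subst (asm) borel_measurable_restrict_space_iff_ennreal) auto
  moreover have "(indicator S :: real \<Rightarrow> ennreal) \<in> borel_measurable lebesgue"
    using assms(1) by (simp add: pos_set_def borel_measurable_indicator)
  ultimately have "(\<lambda>u. (g u * indicator {0<..} u) * indicator S u) \<in> borel_measurable lebesgue"
    by (rule borel_measurable_times_ennreal)
  also have "(\<lambda>u. (g u * indicator {0<..} u) * indicator S u) = (\<lambda>u. g u * indicator S u)"
    using assms(1) by (auto simp: pos_set_def fun_eq_iff split: split_indicator)
  finally show ?thesis .
qed

text \<open>
  Together with \<open>mnorm_inf_le_iff\<close> this replaces the roots in all later proofs: an upper bound for a norm
  is an upper bound for an integral, or an almost everywhere bound when the exponent is infinite.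
\<close>

lemma mnorm_le_iff:
  assumes "pos_set S" "0 < q" "q \<noteq> \<infinity>"
  shows "mnorm q S g \<le> z \<longleftrightarrow> mpow (enn2real q) S g \<le> ennpow z (enn2real q)"
proof -
  let ?p = "enn2real q"
  have p: "0 < ?p" using assms enn2real_pos by auto
  have "(\<integral>\<^sup>+u. ennpow (ennreal (u powr (- recip q)) * g u) ?p \<partial>lebesgue_on S) =
        (\<integral>\<^sup>+u. ennreal (1 / u) * ennpow (g u) ?p \<partial>lebesgue_on S)"
  proof (rule nn_integral_cong)
    fix u assume "u \<in> space (lebesgue_on S)"
    then have "u > 0" using assms by (auto simp: pos_set_def)
    then have "(u powr (- recip q)) powr ?p = 1 / u"
      using p assms powr_minus_divide[of u 1] by (simp add: powr_powr recip_eq del: powr_minus_divide)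
    then show "ennpow (ennreal (u powr (- recip q)) * g u) ?p = ennreal (1 / u) * ennpow (g u) ?p"
      using p by (simp add: ennpow_mult)
  qed
  also have "\<dots> = mpow ?p S g"
    unfolding mpow_def using assms by (subst nn_integral_restrict_space) (auto simp: pos_set_def)
  finally have "mnorm q S g = ennpow (mpow ?p S g) (1 / ?p)"
    using assms by (simp add: mnorm_def Lnorm_def recip_eq)
  then show ?thesis using p by (simp add: ennpow_root_le_iff)
qed

lemma mpow_mnorm:
  assumes "pos_set S" "0 < q" "q \<noteq> \<infinity>"
  shows "mpow (enn2real q) S g = ennpow (mnorm q S g) (enn2real q)"
proof (rule antisym)
  let ?p = "enn2real q"
  have p: "0 < ?p" using assms enn2real_pos by auto
  show "mpow ?p S g \<le> ennpow (mnorm q S g) ?p" using mnorm_le_iff[OF assms] by blast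
  have "mnorm q S g \<le> ennpow (mpow ?p S g) (1 / ?p)"
    by (subst mnorm_le_iff[OF assms]) (simp add: ennpow_inverse' p)
  then have "ennpow (mnorm q S g) ?p \<le> ennpow (ennpow (mpow ?p S g) (1 / ?p)) ?p"
    using p by (intro ennpow_mono) auto
  then show "ennpow (mnorm q S g) ?p \<le> mpow ?p S g" by (simp add: ennpow_inverse' p)
qed

lemma mnorm_inf_le_iff:
  assumes "pos_set S"
  shows "mnorm \<infinity> S g \<le> z \<longleftrightarrow> (AE u in lebesgue. u \<in> S \<longrightarrow> g u \<le> z)"
proof -
  let ?A = "{z. AE x in lebesgue_on S. g x \<le> z}"
  have eq: "mnorm \<infinity> S g = Inf ?A"
  proof -
    have "(AE x in lebesgue_on S. ennreal (x powr - recip \<infinity>) * g x \<le> z) \<longleftrightarrow>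
      (AE x in lebesgue_on S. g x \<le> z)" for z
    proof (rule AE_cong)
      fix x assume "x \<in> space (lebesgue_on S)"
      then have "0 < x" using assms by (auto simp: pos_set_def)
      then show "(ennreal (x powr - recip \<infinity>) * g x \<le> z) = (g x \<le> z)"
        by (simp add: recip_def)
    qed
    then show ?thesis unfolding mnorm_def Lnorm_def by simp
  qed
  have top: "top \<in> ?A" by auto
  obtain Z :: "nat \<Rightarrow> ennreal" where Z: "range Z \<subseteq> ?A" "Inf ?A = (INF n. Z n)"
    using ennreal_Inf_countable_INF[of ?A] top by (metis (no_types, lifting) empty_iff)
  have "AE x in lebesgue_on S. \<forall>n. g x \<le> Z n"
    using Z(1) by (subst AE_all_countable) auto
  then have inf: "AE x in lebesgue_on S. g x \<le> Inf ?A"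
    by eventually_elim (auto simp: Z(2) intro: INF_greatest)
  have "Inf ?A \<le> z \<longleftrightarrow> (AE x in lebesgue_on S. g x \<le> z)"
  proof
    assume "Inf ?A \<le> z"
    from inf show "AE x in lebesgue_on S. g x \<le> z"
      by eventually_elim (erule order_trans, rule \<open>Inf ?A \<le> z\<close>)
  qed (auto intro: Inf_lower)
  then show ?thesis unfolding eq using assms
    by (subst (asm) AE_restrict_space_iff) (auto simp: pos_set_def)
qed

lemma mnorm_inf_AE: "pos_set S \<Longrightarrow> AE u in lebesgue. u \<in> S \<longrightarrow> g u \<le> mnorm \<infinity> S g"
  using mnorm_inf_le_iff by blast

lemma mpow_mono:
  assumes "S \<subseteq> T" "\<And>u. u \<in> S \<Longrightarrow> f u \<le> g u" "0 < p"
  shows "mpow p S f \<le> mpow p T g"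
  unfolding mpow_def using assms
  by (intro nn_integral_mono) (auto split: split_indicator intro!: mult_left_mono ennpow_mono)

lemma mnorm_mono_set:
  assumes "pos_set S" "pos_set T" "0 < q" "S \<subseteq> T" "\<And>u. u \<in> S \<Longrightarrow> f u \<le> g u"
  shows "mnorm q S f \<le> mnorm q T g"
proof (cases "q = \<infinity>")
  case True
  show ?thesis unfolding True mnorm_inf_le_iff[OF assms(1)]
    using mnorm_inf_AE[OF assms(2), of g] by eventually_elim (use assms in \<open>auto intro: order_trans\<close>)
next
  case False
  have "0 < enn2real q" using False assms enn2real_pos by auto
  then show ?thesis unfolding mnorm_le_iff[OF assms(1,3) False] mpow_mnorm[OF assms(2,3) False, symmetric]
    using assms by (intro mpow_mono) auto
qed

lemma mnorm_mono:
  assumes "pos_set S" "0 < q" "\<And>u. u \<in> S \<Longrightarrow> f u \<le> g u"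
  shows "mnorm q S f \<le> mnorm q S g"
  using assms by (intro mnorm_mono_set) auto

lemma mnorm_cong:
  assumes "pos_set S" "0 < q" "\<And>u. u \<in> S \<Longrightarrow> f u = g u"
  shows "mnorm q S f = mnorm q S g"
  using assms by (intro antisym mnorm_mono) auto

lemma mnorm_cmult_le:
  assumes "pos_set S" "0 < q" "0 \<le> c"
  shows "mnorm q S (\<lambda>u. ennreal c * g u) \<le> ennreal c * mnorm q S g"
proof (cases "q = \<infinity>")
  case True
  show ?thesis unfolding True mnorm_inf_le_iff[OF assms(1)]
    using mnorm_inf_AE[OF assms(1), of g] by eventually_elim (auto intro: mult_left_mono)
next
  case False
  let ?p = "enn2real q"
  have p: "0 < ?p" using False assms enn2real_pos by auto
  have "mpow ?p S (\<lambda>u. ennreal c * g u) = 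
    (\<integral>\<^sup>+u. ennreal (c powr ?p) * (ennreal (1 / u) * ennpow (g u) ?p * indicator S u) \<partial>lebesgue)"
    unfolding mpow_def using p assms by (simp add: ennpow_mult ac_simps)
  also have "\<dots> \<le> ennreal (c powr ?p) * mpow ?p S g"
    unfolding mpow_def by (intro nn_integral_cmult_le) auto
  finally show ?thesis unfolding mnorm_le_iff[OF assms(1,2) False]
    using p assms by (simp add: ennpow_mult mpow_mnorm[OF assms(1,2) False])
qed

lemma mnorm_cmult:
  assumes "pos_set S" "0 < q" "0 < c"
  shows "mnorm q S (\<lambda>u. ennreal c * g u) = ennreal c * mnorm q S g"
proof (rule antisym)
  show "mnorm q S (\<lambda>u. ennreal c * g u) \<le> ennreal c * mnorm q S g"
    using assms by (intro mnorm_cmult_le) auto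
  have cc: "ennreal c * ennreal (1 / c) = 1" using assms by (simp flip: ennreal_mult'')
  have "mnorm q S g = mnorm q S (\<lambda>u. ennreal (1 / c) * (ennreal c * g u))"
    by (simp add: mult.assoc[symmetric] cc mult.commute[of "ennreal (1/c)"])
  also have "\<dots> \<le> ennreal (1 / c) * mnorm q S (\<lambda>u. ennreal c * g u)"
    using assms by (intro mnorm_cmult_le) auto
  finally have "ennreal c * mnorm q S g \<le> ennreal c * (ennreal (1 / c) * mnorm q S (\<lambda>u. ennreal c * g u))"
    by (intro mult_left_mono) auto
  then show "ennreal c * mnorm q S g \<le> mnorm q S (\<lambda>u. ennreal c * g u)"
    by (simp add: mult.assoc[symmetric] cc)
qed

lemma mpow_add:
  assumes "pos_set S" "meas f" "meas g" "0 < p"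
  shows "mpow p S (\<lambda>u. f u + g u) \<le> ennreal (2 powr p) * (mpow p S f + mpow p S g)"
proof -
  have m: "(\<lambda>u. ennreal (1 / u) * ennpow (h u) p * indicator S u) \<in> borel_measurable lebesgue"
    if "meas h" for h
  proof (rule meas_restrict[OF assms(1)])
    have "(\<lambda>u. ennreal (1 / u)) \<in> borel_measurable lebesgue" by (intro measurable_completion) measurable
    then have "meas (\<lambda>u. ennreal (1 / u))" by (rule measurable_restrict_space1)
    moreover have "meas (\<lambda>u. ennpow (h u) p)"
      using measurable_compose[OF that ennpow_measurable] .
    ultimately show "meas (\<lambda>u. ennreal (1 / u) * ennpow (h u) p)" by (rule borel_measurable_times_ennreal)
  qed
  have "mpow p S (\<lambda>u. f u + g u) \<le> (\<integral>\<^sup>+u. ennreal (2 powr p) * 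
     (ennreal (1 / u) * ennpow (f u) p * indicator S u + ennreal (1 / u) * ennpow (g u) p * indicator S u) \<partial>lebesgue)"
    unfolding mpow_def
  proof (rule nn_integral_mono)
    fix u
    have "ennreal (1 / u) * ennpow (f u + g u) p \<le>
        ennreal (1 / u) * (ennreal (2 powr p) * (ennpow (f u) p + ennpow (g u) p))"
      using assms by (intro mult_left_mono ennpow_add_le) auto
    then show "ennreal (1 / u) * ennpow (f u + g u) p * indicator S u
         \<le> ennreal (2 powr p) * (ennreal (1 / u) * ennpow (f u) p * indicator S u +
             ennreal (1 / u) * ennpow (g u) p * indicator S u)"
      by (auto simp: algebra_simps split: split_indicator)
  qed
  also have "\<dots> = ennreal (2 powr p) * (mpow p S f + mpow p S g)"
    unfolding mpow_def using m[OF assms(2)] m[OF assms(3)]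
    by (simp add: nn_integral_cmult nn_integral_add)
  finally show ?thesis .
qed

text \<open>
  One factor 2 pays for \<open>(x + y)\<^sup>p \<le> 2\<^sup>p (x\<^sup>p + y\<^sup>p)\<close>, the other one for adding two
  \<open>p\<close>-th powers under the root. The value is not optimal, but it serves all exponents at once.
\<close>

definition triangle_const :: "ennreal \<Rightarrow> real" where
  "triangle_const q = 2 * 2 powr recip q"

lemma triangle_const_ge_1: "1 \<le> triangle_const q"
proof -
  have "2 powr 0 \<le> 2 powr recip q" by (intro powr_mono) (auto simp: recip_def)
  then show ?thesis by (simp add: triangle_const_def)
qed

lemma mnorm_add:
  assumes S: "pos_set S" and q: "0 < q" and m: "meas f" "meas g"
  shows "mnorm q S (\<lambda>u. f u + g u) \<le> ennreal (triangle_const q) * (mnorm q S f + mnorm q S g)"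
proof (cases "q = \<infinity>")
  case True
  have "1 * (mnorm q S f + mnorm q S g) \<le> ennreal (triangle_const q) * (mnorm q S f + mnorm q S g)"
    using ennreal_leI[OF triangle_const_ge_1] by (intro mult_right_mono) auto
  moreover have "mnorm \<infinity> S (\<lambda>u. f u + g u) \<le> mnorm \<infinity> S f + mnorm \<infinity> S g"
    unfolding mnorm_inf_le_iff[OF S] using mnorm_inf_AE[OF S, of f] mnorm_inf_AE[OF S, of g]
    by eventually_elim (auto intro: add_mono)
  ultimately show ?thesis by (simp add: True)
next
  case False
  let ?p = "enn2real q" and ?z = "mnorm q S f + mnorm q S g"
  have p: "0 < ?p" using False q enn2real_pos by auto
  have "mpow ?p S f + mpow ?p S g \<le> ennpow ?z ?p + ennpow ?z ?p"
    unfolding mpow_mnorm[OF S q False] using p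
    by (intro add_mono ennpow_mono) (auto intro: add_increasing add_increasing2)
  also have "\<dots> = ennreal 2 * ennpow ?z ?p"
    by (simp add: mult_2)
  finally have "ennreal (2 powr ?p) * (mpow ?p S f + mpow ?p S g)
     \<le> ennreal (2 powr ?p) * (ennreal 2 * ennpow ?z ?p)"
    by (intro mult_left_mono) auto
  then have "mpow ?p S (\<lambda>u. f u + g u) \<le> ennreal (2 powr ?p) * (ennreal 2 * ennpow ?z ?p)"
    using mpow_add[OF S m p] by (rule order_trans[rotated])
  also have "\<dots> = ennpow (ennreal (triangle_const q) * ?z) ?p"
    using p q False
    by (simp add: triangle_const_def recip_eq ennpow_mult powr_mult powr_powr ennreal_mult mult.assoc)
  finally show ?thesis unfolding mnorm_le_iff[OF S q False] .
qed

lemma mnorm_indicator: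
  assumes "pos_set S" "pos_set T" "0 < q"
  shows "mnorm q S (\<lambda>u. f u * indicator T u) \<le> mnorm q T f" 
proof (cases "q = \<infinity>")
  case True
  show ?thesis unfolding True mnorm_inf_le_iff[OF assms(1)]
    using mnorm_inf_AE[OF assms(2), of f] by eventually_elim (auto split: split_indicator)
next
  case False
  let ?p = "enn2real q"
  have p: "0 < ?p" using False assms enn2real_pos by auto
  have z: "ennpow 0 ?p = 0" using p by (simp add: ennpow_def)
  have "mpow ?p S (\<lambda>u. f u * indicator T u) \<le> mpow ?p T f"
    unfolding mpow_def using z by (intro nn_integral_mono) (auto split: split_indicator)
  then show ?thesis
    by (simp add: mnorm_le_iff[OF assms(1,3) False] mpow_mnorm[OF assms(2,3) False])
qed

lemma mnorm_mono_off_point: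
  assumes "pos_set S" "0 < q" "\<And>u. u \<in> S \<Longrightarrow> u \<noteq> x \<Longrightarrow> f u \<le> g u"
  shows "mnorm q S f \<le> mnorm q S g"
proof -
  have x: "AE u in lebesgue. u \<noteq> x"
    by (rule AE_completion) (rule AE_lborel_singleton)
  show ?thesis
  proof (cases "q = \<infinity>")
    case True
    show ?thesis unfolding True mnorm_inf_le_iff[OF assms(1)]
      using mnorm_inf_AE[OF assms(1), of g] x
      by eventually_elim (use assms in \<open>auto intro: order_trans\<close>)
  next
    case False
    let ?p = "enn2real q"
    have p: "0 < ?p" using False assms enn2real_pos by auto
    have "AE u in lebesgue. ennreal (1 / u) * ennpow (f u) ?p * indicator S u
       \<le> ennreal (1 / u) * ennpow (g u) ?p * indicator S u"
      using x by eventually_elim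
        (use assms p in \<open>auto split: split_indicator intro!: mult_left_mono ennpow_mono\<close>)
    then have "mpow ?p S f \<le> mpow ?p S g"
      unfolding mpow_def by (rule nn_integral_mono_AE)
    then show ?thesis
      by (simp add: mnorm_le_iff[OF assms(1,2) False] mpow_mnorm[OF assms(1,2) False])
  qed
qed

section \<open>Measurability, splitting, size and dilation\<close>

lemma meas_mono:
  fixes F :: "real \<Rightarrow> ennreal"
  assumes "\<And>s t. 0 < s \<Longrightarrow> s \<le> t \<Longrightarrow> F s \<le> F t"
  shows "meas F"
proof (rule borel_measurableI_greater)
  fix y
  have "is_interval {x. 0 < x \<and> y < F x}"
    unfolding is_interval_1 using assms by (auto intro: less_le_trans)
  then have "{x. 0 < x \<and> y < F x} \<in> sets lebesgue"
    using real_interval_borel_measurable[of "{x. 0 < x \<and> y < F x}"] by (intro sets_completionI_sets) simp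
  then show "{x \<in> space (lebesgue_on {0<..}). y < F x} \<in> sets (lebesgue_on {0<..})"
    by (subst sets_restrict_space_iff) (auto simp: Int_def)
qed

lemma meas_antimono:
  fixes F :: "real \<Rightarrow> ennreal"
  assumes "\<And>s t. 0 < s \<Longrightarrow> s \<le> t \<Longrightarrow> F t \<le> F s"
  shows "meas F"
proof (rule borel_measurableI_greater)
  fix y
  have "is_interval {x. 0 < x \<and> y < F x}"
    unfolding is_interval_1 using assms by (fastforce intro: less_le_trans)
  then have "{x. 0 < x \<and> y < F x} \<in> sets lebesgue"
    using real_interval_borel_measurable[of "{x. 0 < x \<and> y < F x}"] by (intro sets_completionI_sets) simp
  then show "{x \<in> space (lebesgue_on {0<..}). y < F x} \<in> sets (lebesgue_on {0<..})"
    by (subst sets_restrict_space_iff) (auto simp: Int_def)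
qed

lemma meas_borel:
  assumes "F \<in> borel_measurable borel"
  shows "F \<in> borel_measurable (lebesgue_on {0<..})"
  by (rule measurable_restrict_space1, rule measurable_completion) (use assms in simp)

lemma lebesgue_measurable_mult: "(\<lambda>u. l * u) \<in> lebesgue \<rightarrow>\<^sub>M (lebesgue :: real measure)"
proof -
  have "(*\<^sub>R) l = (\<lambda>u::real. l * u)" by (auto simp: fun_eq_iff)
  then show ?thesis using lebesgue_measurable_scaling[of l, where 'a = real] by simp
qed

lemma meas_scale:
  assumes "meas g" "0 < l"
  shows "meas (\<lambda>u. g (l * u))"
proof -
  have "(\<lambda>u. l * u) \<in> lebesgue_on {0<..} \<rightarrow>\<^sub>M lebesgue_on {0<..}"
  proof (rule measurable_restrict_space3)
    show "(\<lambda>u. l * u) \<in> lebesgue \<rightarrow>\<^sub>M lebesgue"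
      by (rule lebesgue_measurable_mult)
  qed (use assms in auto)
  then show ?thesis using assms(1) by (rule measurable_compose)
qed

lemma ennpow_le_cancel: "0 < p \<Longrightarrow> ennpow x p \<le> ennpow y p \<Longrightarrow> x \<le> y"
  by (metis ennpow_inverse ennpow_root_le_iff)

text \<open>
  The point \<open>x\<close> allows a cut into two open pieces without separate treatment of the cutting point.
\<close>

lemma mnorm_split:
  assumes "0 < q" "pos_set S" "pos_set T" "pos_set U" "S \<subseteq> T \<union> U \<union> {x}" "meas f"
  shows "mnorm q S f \<le> ennreal (triangle_const q) * (mnorm q T f + mnorm q U f)"
proof -
  have m: "meas (\<lambda>u. f u * indicator V u)" if "pos_set V" for V
  proof -
    have "(indicator V :: real \<Rightarrow> ennreal) \<in> borel_measurable lebesgue"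
      using that by (simp add: pos_set_def borel_measurable_indicator)
    then have "meas (indicator V)" by (rule measurable_restrict_space1)
    with assms(6) show ?thesis by (rule borel_measurable_times_ennreal)
  qed
  have "mnorm q S f \<le> mnorm q S (\<lambda>u. f u * indicator T u + f u * indicator U u)"
    using assms by (intro mnorm_mono_off_point[of _ _ x]) (auto split: split_indicator)
  also have "\<dots> \<le> ennreal (triangle_const q) *
      (mnorm q S (\<lambda>u. f u * indicator T u) + mnorm q S (\<lambda>u. f u * indicator U u))"
    using assms m by (intro mnorm_add) auto
  also have "\<dots> \<le> ennreal (triangle_const q) * (mnorm q T f + mnorm q U f)"
    using assms by (intro mult_left_mono add_mono mnorm_indicator) auto
  finally show ?thesis .
qed

text \<open>
  The interval \<open>(t, 2t)\<close> has \<open>du/u\<close>-measure at least 1/2, whatever \<open>t\<close> is.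
\<close>

lemma mnorm_lower:
  fixes g :: "real \<Rightarrow> ennreal"
  assumes q: "0 < q" and *: "pos_set S" "0 < t" "{t<..<2*t} \<subseteq> S" "\<And>u. t < u \<Longrightarrow> u < 2 * t \<Longrightarrow> c \<le> g u"
  shows "c \<le> ennreal (2 powr recip q) * mnorm q S g"
proof (cases "q = \<infinity>")
  case True
  have "c \<le> mnorm \<infinity> S g"
  proof (rule ccontr)
    assume n: "\<not> c \<le> mnorm \<infinity> S g"
    have "AE u in lebesgue. u \<notin> {t<..<2*t}"
      using mnorm_inf_AE[OF *(1), of g]
    proof eventually_elim
      case (elim u)
      show ?case
      proof
        assume u: "u \<in> {t<..<2*t}"
        then have "g u \<le> mnorm \<infinity> S g" using elim *(3) by blast
        moreover have "c \<le> g u" using u *(4) by simp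
        ultimately show False using n by (meson order_trans)
      qed
    qed
    then have "emeasure lebesgue {t<..<2*t} = 0"
      by (subst (asm) AE_iff_measurable[of "{t<..<2*t}"]) auto
    then show False using *(2) by simp
  qed
  then show ?thesis by (simp add: True recip_def)
next
  case False
  let ?p = "enn2real q"
  have p: "0 < ?p" using False q enn2real_pos by auto
  have "ennpow c ?p * ennreal (1 / 2) = (ennpow c ?p * ennreal (1 / (2 * t))) * ennreal t"
    using * by (simp add: mult.assoc flip: ennreal_mult'')
  also have "\<dots> = (\<integral>\<^sup>+u\<in>{t<..<2*t}. (ennpow c ?p * ennreal (1 / (2 * t))) \<partial>lebesgue)"
    using * by (subst nn_integral_cmult_indicator) auto
  also have "\<dots> \<le> mpow ?p S g"
    unfolding mpow_def
  proof (rule nn_integral_mono)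
    fix u
    show "ennpow c ?p * ennreal (1 / (2 * t)) * indicator {t<..<2*t} u
          \<le> ennreal (1 / u) * ennpow (g u) ?p * indicator S u"
    proof (cases "u \<in> {t<..<2*t}")
      case True
      then have "u \<in> S" "c \<le> g u" "1 / (2 * t) \<le> 1 / u" using * by (auto simp: frac_le)
      then have "ennpow c ?p * ennreal (1 / (2 * t)) \<le> ennpow (g u) ?p * ennreal (1 / u)"
        using p by (intro mult_mono ennpow_mono ennreal_leI) auto
      then show ?thesis using True \<open>u \<in> S\<close> by (simp add: mult.commute)
    qed simp
  qed
  also have "\<dots> = ennpow (mnorm q S g) ?p" by (rule mpow_mnorm[OF *(1) q False])
  finally have "ennreal 2 * (ennpow c ?p * ennreal (1 / 2)) \<le> ennreal 2 * ennpow (mnorm q S g) ?p"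
    by (intro mult_left_mono) auto
  also have "\<dots> = ennpow (ennreal (2 powr recip q) * mnorm q S g) ?p"
    using p q False by (simp add: ennpow_mult powr_powr recip_eq)
  also have "ennreal 2 * (ennpow c ?p * ennreal (1 / 2)) = ennpow c ?p * (ennreal 2 * ennreal (1 / 2))"
    by (simp only: ac_simps)
  also have "ennreal 2 * ennreal (1 / 2) = 1" by (subst ennreal_mult[symmetric]) auto
  finally show ?thesis using p by (auto intro: ennpow_le_cancel)
qed

lemma mnorm_upper:
  assumes q: "0 < q" and M: "1 \<le> M" and *: "pos_set S" "0 < s" "S \<subseteq> {s..M * s}"
  shows "mnorm q S (\<lambda>_. c) \<le> ennreal (M powr recip q) * c"
proof (cases "q = \<infinity>")
  case True
  have "mnorm \<infinity> S (\<lambda>_. c) \<le> c" unfolding mnorm_inf_le_iff[OF *(1)] by simp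
  then show ?thesis using M by (simp add: True recip_def)
next
  case False
  let ?p = "enn2real q"
  have p: "0 < ?p" using False q enn2real_pos by auto
  have "mpow ?p S (\<lambda>_. c) \<le> (\<integral>\<^sup>+u\<in>{s..M * s}. (ennreal (1 / s) * ennpow c ?p) \<partial>lebesgue)"
    unfolding mpow_def
  proof (rule nn_integral_mono)
    fix u
    show "ennreal (1 / u) * ennpow c ?p * indicator S u \<le> ennreal (1 / s) * ennpow c ?p * indicator {s..M * s} u"
    proof (cases "u \<in> S")
      case True
      then have "1 / u \<le> 1 / s" "u \<in> {s..M * s}" using * by (auto simp: frac_le)
      then show ?thesis using True by (auto intro!: mult_right_mono ennreal_leI)
    qed simp
  qed
  also have "\<dots> = ennreal (1 / s) * ennpow c ?p * ennreal (M * s - s)"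
    using * M by (subst nn_integral_cmult_indicator) (auto simp: mult_le_cancel_right2)
  also have "\<dots> = ennreal (1 / s * (M * s - s)) * ennpow c ?p"
    using * by (subst ennreal_mult') (auto simp: ac_simps)
  also have "1 / s * (M * s - s) = M - 1" using * by (simp add: field_simps)
  also have "ennreal (M - 1) * ennpow c ?p \<le> ennreal M * ennpow c ?p"
    by (intro mult_right_mono ennreal_leI) auto
  also have "\<dots> = ennpow (ennreal (M powr recip q) * c) ?p"
    using p M q False by (simp add: ennpow_mult powr_powr recip_eq)
  finally show ?thesis by (simp add: mnorm_le_iff[OF *(1) q False])
qed

text \<open>
  Invariance of \<open>du/u\<close> under \<open>u \<mapsto> l u\<close>. For infinite exponent, apply the substitution rule
  to the indicator function of the set where the bound fails.
\<close>

lemma mnorm_scale: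
  assumes "pos_set S" "pos_set T" "0 < q" "0 < l" "\<And>u. 0 < u \<Longrightarrow> l * u \<in> S \<longleftrightarrow> u \<in> T" "meas g"
  shows "mnorm q S g = mnorm q T (\<lambda>u. g (l * u))"
proof (cases "q = \<infinity>")
  case True
  have "mnorm \<infinity> S g \<le> z \<longleftrightarrow> mnorm \<infinity> T (\<lambda>u. g (l * u)) \<le> z" for z
  proof -
    let ?h = "\<lambda>u. indicator {z<..} (g u * indicator S u) :: ennreal"
    have [measurable]: "?h \<in> borel_measurable lebesgue"
      using meas_restrict[OF assms(1,6)] by measurable
    have h2[measurable]: "(\<lambda>u. ?h (0 + l * u)) \<in> borel_measurable lebesgue"
      using measurable_compose[OF lebesgue_measurable_mult[of l] \<open>?h \<in> _\<close>] by simp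
    have i: "indicator S (l * u) = (indicator T u :: ennreal)" for u
      using assms(1,2,4,5) by (cases "0 < u") (auto simp: pos_set_def indicator_def zero_less_mult_iff)
    have "mnorm \<infinity> S g \<le> z \<longleftrightarrow> (AE u in lebesgue. ?h u = 0)"
      unfolding mnorm_inf_le_iff[OF assms(1)] by (intro AE_cong) (auto split: split_indicator)
    also have "\<dots> \<longleftrightarrow> (\<integral>\<^sup>+u. ?h u \<partial>lebesgue) = 0"
      by (subst nn_integral_0_iff_AE) auto
    also have "\<dots> \<longleftrightarrow> (\<integral>\<^sup>+u. ?h (0 + l * u) \<partial>lebesgue) = 0"
      using assms(4) by (subst nn_integral_real_affine_lebesgue[where c = l and t = 0]) auto
    also have "\<dots> \<longleftrightarrow> (AE u in lebesgue. ?h (0 + l * u) = 0)"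
      by (subst nn_integral_0_iff_AE) (use h2 in auto)
    also have "\<dots> \<longleftrightarrow> mnorm \<infinity> T (\<lambda>u. g (l * u)) \<le> z"
      unfolding mnorm_inf_le_iff[OF assms(2)] by (intro AE_cong) (auto simp: i split: split_indicator)
    finally show ?thesis .
  qed
  then show ?thesis unfolding True by (meson antisym order_refl)
next
  case False
  let ?p = "enn2real q"
  have p: "0 < ?p" using False assms enn2real_pos by auto
  have i: "indicator S (l * u) = (indicator T u :: ennreal)" for u
    using assms(1,2,4,5) by (cases "0 < u") (auto simp: pos_set_def indicator_def zero_less_mult_iff)
  have "meas (\<lambda>u. ennreal (1 / u) * ennpow (g u) ?p)"
    by (intro borel_measurable_times_ennreal meas_borel measurable_compose[OF assms(6) ennpow_measurable]) simp
  then have m: "(\<lambda>u. ennreal (1 / u) * ennpow (g u) ?p * indicator S u) \<in> borel_measurable lebesgue"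
    by (rule meas_restrict[OF assms(1)])
  have m2: "(\<lambda>u. ennreal (1 / (l * u)) * ennpow (g (l * u)) ?p * indicator S (l * u)) \<in> borel_measurable lebesgue"
    using measurable_compose[OF lebesgue_measurable_mult[of l] m] by simp
  have "mpow ?p S g = ennreal l * (\<integral>\<^sup>+u. ennreal (1 / (l * u)) * ennpow (g (l * u)) ?p * indicator S (l * u) \<partial>lebesgue)"
    unfolding mpow_def using assms(4) by (subst nn_integral_real_affine_lebesgue[OF m, of l 0]) auto
  also have "\<dots> = (\<integral>\<^sup>+u. ennreal l * (ennreal (1 / (l * u)) * ennpow (g (l * u)) ?p * indicator S (l * u)) \<partial>lebesgue)"
    by (rule nn_integral_cmult[OF m2, symmetric])
  also have "\<dots> = mpow ?p T (\<lambda>u. g (l * u))"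
    unfolding mpow_def
  proof (rule nn_integral_cong)
    fix u
    have "ennreal l * ennreal (1 / (l * u)) = ennreal (1 / u)"
      using assms(4) by (subst ennreal_mult'[symmetric]) auto
    then show "ennreal l * (ennreal (1 / (l * u)) * ennpow (g (l * u)) ?p * indicator S (l * u)) =
       ennreal (1 / u) * ennpow (g (l * u)) ?p * indicator T u"
      by (simp add: i mult.assoc[symmetric])
  qed
  finally have "ennpow (mnorm q S g) ?p = ennpow (mnorm q T (\<lambda>u. g (l * u))) ?p"
    by (simp add: mpow_mnorm[OF assms(1,3) False] mpow_mnorm[OF assms(2,3) False])
  then show ?thesis using ennpow_inverse[OF p] by metis
qed

lemma ennpow_SUP_le:
  assumes "0 < p" "\<And>j. ennpow (f j) p \<le> z"
  shows "ennpow (SUP j. f j) p \<le> z"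
proof -
  have "(SUP j. f j) \<le> ennpow z (1 / p)"
    using assms by (intro SUP_least) (metis ennpow_inverse ennpow_mono divide_nonneg_pos less_imp_le zero_le_one)
  then have "ennpow (SUP j. f j) p \<le> ennpow (ennpow z (1 / p)) p"
    using assms by (intro ennpow_mono) auto
  then show ?thesis using assms by (simp add: ennpow_inverse')
qed

text \<open>
  A supremum is at most the \<open>\<ell>\<^sub>q\<close>-sum, and the \<open>q\<close>-th powers of the factors
  \<open>2\<^sup>-\<^sup>d\<^sup>j\<close> form a geometric series. So geometric decay in the dyadic index makes
  estimates by suprema sufficient, whatever the exponent is.
\<close>

lemma mnorm_SUP:
  assumes "0 < q" "0 < d"
  obtains C where "0 < C" "\<And>S (g :: nat \<Rightarrow> real \<Rightarrow> ennreal). pos_set S \<Longrightarrow> (\<And>j. meas (g j)) \<Longrightarrow>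
    mnorm q S (\<lambda>u. SUP j. ennreal (2 powr (- d * real j)) * g j u) \<le> ennreal C * (SUP j. mnorm q S (g j))"
proof (cases "q = \<infinity>")
  case True
  show ?thesis
  proof (rule that[of 1])
    fix S and g :: "nat \<Rightarrow> real \<Rightarrow> ennreal" assume S: "pos_set S"
    have "AE u in lebesgue. \<forall>j. u \<in> S \<longrightarrow> g j u \<le> mnorm \<infinity> S (g j)"
      using mnorm_inf_AE[OF S] by (subst AE_all_countable) auto
    then have "mnorm \<infinity> S (\<lambda>u. SUP j. ennreal (2 powr (- d * real j)) * g j u) \<le> (SUP j. mnorm q S (g j))"
      unfolding True mnorm_inf_le_iff[OF S]
    proof eventually_elim
      case (elim u)
      show ?case
      proof (intro impI SUP_mono)
        fix j assume "u \<in> S"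
        have "2 powr (- d * real j) \<le> 2 powr 0" using assms by (intro powr_mono) auto
        then have "ennreal (2 powr (- d * real j)) * g j u \<le> 1 * g j u"
          by (intro mult_right_mono) auto
        also have "\<dots> \<le> mnorm \<infinity> S (g j)" using elim \<open>u \<in> S\<close> by simp
        finally show "\<exists>m\<in>UNIV. ennreal (2 powr (- d * real j)) * g j u \<le> mnorm \<infinity> S (g m)" by blast
      qed
    qed
    then show "mnorm q S (\<lambda>u. SUP j. ennreal (2 powr (- d * real j)) * g j u) \<le> ennreal 1 * (SUP j. mnorm q S (g j))"
      by (simp add: True)
  qed simp
next
  case False
  let ?p = "enn2real q"
  have p: "0 < ?p" using False assms enn2real_pos by auto
  define x where "x = 2 powr (- d * ?p)"
  have x: "0 < x" "x < 1" using p assms by (auto simp: x_def powr_less_one)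
  have xj: "(2 powr (- d * real j)) powr ?p = x ^ j" for j
    by (simp add: x_def powr_powr powr_realpow[symmetric] mult_ac)
  define K where "K = 1 / (1 - x)"
  have K: "0 < K" using x by (simp add: K_def)
  show ?thesis
  proof (rule that[of "K powr (1 / ?p)"])
    fix S and g :: "nat \<Rightarrow> real \<Rightarrow> ennreal" assume S: "pos_set S" and g: "\<And>j. meas (g j)"
    let ?Z = "SUP j. mnorm q S (g j)"
    let ?G = "\<lambda>j u. ennreal (1 / u) * ennpow (g j u) ?p * indicator S u"
    have mG: "?G j \<in> borel_measurable lebesgue" for j
      by (intro meas_restrict[OF S] borel_measurable_times_ennreal meas_borel measurable_compose[OF g ennpow_measurable]) simp
    have "mpow ?p S (\<lambda>u. SUP j. ennreal (2 powr (- d * real j)) * g j u) \<le> 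
       (\<integral>\<^sup>+u. (\<Sum>j. ennreal (x ^ j) * ?G j u) \<partial>lebesgue)"
      unfolding mpow_def
    proof (rule nn_integral_mono)
      fix u
      have "ennpow (SUP j. ennreal (2 powr (- d * real j)) * g j u) ?p \<le> (\<Sum>j. ennreal (x ^ j) * ennpow (g j u) ?p)"
      proof (rule ennpow_SUP_le[OF p])
        fix j
        have "ennpow (ennreal (2 powr (- d * real j)) * g j u) ?p = ennreal (x ^ j) * ennpow (g j u) ?p"
          using p by (simp add: ennpow_mult flip: xj)
        also have "\<dots> \<le> (\<Sum>j. ennreal (x ^ j) * ennpow (g j u) ?p)"
          using sum_le_suminf[of "\<lambda>j. ennreal (x ^ j) * ennpow (g j u) ?p" "{j}"] by simp
        finally show "ennpow (ennreal (2 powr (- d * real j)) * g j u) ?p \<le> (\<Sum>j. ennreal (x ^ j) * ennpow (g j u) ?p)" .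
      qed
      then have "ennreal (1 / u) * ennpow (SUP j. ennreal (2 powr (- d * real j)) * g j u) ?p * indicator S u
         \<le> ennreal (1 / u) * (\<Sum>j. ennreal (x ^ j) * ennpow (g j u) ?p) * indicator S u"
        by (intro mult_right_mono mult_left_mono) auto
      also have "\<dots> = (ennreal (1 / u) * indicator S u) * (\<Sum>j. ennreal (x ^ j) * ennpow (g j u) ?p)"
        by (simp only: mult_ac)
      also have "\<dots> = (\<Sum>j. (ennreal (1 / u) * indicator S u) * (ennreal (x ^ j) * ennpow (g j u) ?p))"
        by (rule ennreal_suminf_cmult[symmetric])
      also have "\<dots> = (\<Sum>j. ennreal (x ^ j) * ?G j u)"
        by (simp only: mult_ac)
      finally show "ennreal (1 / u) * ennpow (SUP j. ennreal (2 powr (- d * real j)) * g j u) ?p * indicator S u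
         \<le> (\<Sum>j. ennreal (x ^ j) * ?G j u)" .
    qed
    also have "\<dots> = (\<Sum>j. ennreal (x ^ j) * mpow ?p S (g j))"
      unfolding mpow_def using mG by (simp add: nn_integral_suminf nn_integral_cmult)
    also have "\<dots> \<le> (\<Sum>j. ennreal (x ^ j) * ennpow ?Z ?p)"
      unfolding mpow_mnorm[OF S assms(1) False] using p
      by (intro suminf_le mult_left_mono ennpow_mono SUP_upper) auto
    also have "\<dots> = (\<Sum>j. ennreal (x ^ j)) * ennpow ?Z ?p" by simp
    also have "(\<Sum>j. ennreal (x ^ j)) = ennreal K"
      using x by (subst suminf_ennreal2) (auto simp: K_def suminf_geometric summable_geometric)
    also have "ennreal K * ennpow ?Z ?p = ennpow (ennreal (K powr (1 / ?p)) * ?Z) ?p"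
      using p K by (simp add: ennpow_mult powr_powr)
    finally show "mnorm q S (\<lambda>u. SUP j. ennreal (2 powr (- d * real j)) * g j u) \<le> ennreal (K powr (1 / ?p)) * ?Z"
      by (simp add: mnorm_le_iff[OF S assms(1) False])
  qed (use K in simp)
qed

section \<open>Tame and slowly varying functions\<close>

text \<open>
  The multiplicative distance of two positive numbers: its logarithm is \<open>\<bar>ln s - ln t\<bar>\<close>.
\<close>

definition spread :: "real \<Rightarrow> real \<Rightarrow> real" where
  "spread s t = max (s / t) (t / s)"

lemma spread_ge_1: "0 < s \<Longrightarrow> 0 < t \<Longrightarrow> 1 \<le> spread s t"
  by (auto simp: spread_def le_max_iff_disj)

lemma spread_commute: "spread s t = spread t s"
  by (simp add: spread_def max.commute)

lemma spread_le: "0 < s \<Longrightarrow> s \<le> t \<Longrightarrow> spread s t = t / s"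
  using mult_mono[of s t s t] by (auto simp: spread_def max_def field_simps)

lemma spread_scale1: "0 < u \<Longrightarrow> spread (l * u) u = spread l 1"
  by (simp add: spread_def)

lemma spread_divide1: "0 < s \<Longrightarrow> 0 < t \<Longrightarrow> spread (s / t) 1 = spread s t"
  by (simp add: spread_def)

text \<open>
  Polynomial control of relative changes. It holds, with constants that do not depend on \<open>f\<close>, for every
  function of \<open>t\<close> to which discretization is applied below.
\<close>

definition tame :: "real \<Rightarrow> real \<Rightarrow> (real \<Rightarrow> ennreal) \<Rightarrow> bool" where
  "tame D A F \<longleftrightarrow> (\<forall>s>0. \<forall>t>0. F s \<le> ennreal (D * spread s t powr A) * F t)"

lemma tameD: "tame D A F \<Longrightarrow> 0 < s \<Longrightarrow> 0 < t \<Longrightarrow> F s \<le> ennreal (D * spread s t powr A) * F t"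
  by (simp add: tame_def)

lemma tame_weaken:
  assumes "tame D A F" "0 \<le> D" "D \<le> D'" "A \<le> A'"
  shows "tame D' A' F"
  unfolding tame_def
proof (intro allI impI)
  fix s t :: real assume st: "0 < s" "0 < t"
  have "F s \<le> ennreal (D * spread s t powr A) * F t" using assms st by (intro tameD)
  also have "\<dots> \<le> ennreal (D' * spread s t powr A') * F t"
    using assms spread_ge_1[OF st] by (intro mult_right_mono ennreal_leI mult_mono powr_mono) auto
  finally show "F s \<le> ennreal (D' * spread s t powr A') * F t" .
qed

lemma tame_mult:
  assumes "tame D A F" "tame D' A' G" "0 \<le> D" "0 \<le> D'"
  shows "tame (D * D') (A + A') (\<lambda>t. F t * G t)"
  unfolding tame_def
proof (intro allI impI)
  fix s t :: real assume st: "0 < s" "0 < t"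
  have "F s * G s \<le> (ennreal (D * spread s t powr A) * F t) * (ennreal (D' * spread s t powr A') * G t)"
    using assms st by (intro mult_mono tameD) auto
  also have "\<dots> = ennreal (D * D' * spread s t powr (A + A')) * (F t * G t)"
    using assms by (simp add: powr_add ennreal_mult mult_ac)
  finally show "F s * G s \<le> ennreal (D * D' * spread s t powr (A + A')) * (F t * G t)" .
qed

lemma powr_spread: "0 < s \<Longrightarrow> 0 < t \<Longrightarrow> s powr x \<le> spread s t powr \<bar>x\<bar> * t powr x"
proof -
  assume st: "0 < s" "0 < t"
  have "(s / t) powr x \<le> spread s t powr \<bar>x\<bar>"
  proof (cases "0 \<le> x")
    case True
    then show ?thesis using st by (auto simp: spread_def intro!: powr_mono2)
  next
    case False
    have "(s / t) powr x = (t / s) powr (- x)"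
      using st by (simp add: powr_minus powr_divide inverse_eq_divide)
    also have "\<dots> \<le> spread s t powr (- x)" using st False by (intro powr_mono2) (auto simp: spread_def)
    finally show ?thesis using False by simp
  qed
  then have "(s / t) powr x * t powr x \<le> spread s t powr \<bar>x\<bar> * t powr x" by (intro mult_right_mono) auto
  then show ?thesis using st by (simp add: powr_divide)
qed

lemma tame_powr: "tame 1 \<bar>x\<bar> (\<lambda>t. ennreal (t powr x))"
  unfolding tame_def using powr_spread by (auto simp flip: ennreal_mult'' intro!: ennreal_leI)

text \<open>
  Slow variation without measurability: tame with every positive exponent. Unlike equivalence to
  monotone functions, this form is visibly stable under products, powers and inverses.
\<close>

definition slow :: "(real \<Rightarrow> real) \<Rightarrow> bool" where
  "slow b \<longleftrightarrow> (\<forall>t>0. 0 < b t) \<and> (\<forall>e>0. \<exists>D\<ge>1. \<forall>s>0. \<forall>t>0. b s \<le> D * spread s t powr e * b t)"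

lemma slowI:
  assumes "\<And>t. 0 < t \<Longrightarrow> 0 < b t"
    "\<And>e. 0 < e \<Longrightarrow> \<exists>D. 1 \<le> D \<and> (\<forall>s t. 0 < s \<longrightarrow> 0 < t \<longrightarrow> b s \<le> D * spread s t powr e * b t)"
  shows "slow b"
  unfolding slow_def
proof (intro conjI allI impI)
  fix e :: real assume "0 < e"
  from assms(2)[OF this] obtain D where
    "1 \<le> D" "\<forall>s t. 0 < s \<longrightarrow> 0 < t \<longrightarrow> b s \<le> D * spread s t powr e * b t" by (elim exE conjE)
  then show "\<exists>D\<ge>1. \<forall>s>0. \<forall>t>0. b s \<le> D * spread s t powr e * b t"
    by (intro exI[of _ D]) simp
qed (rule assms)

lemma slow_pos: "slow b \<Longrightarrow> 0 < t \<Longrightarrow> 0 < b t"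
  by (simp add: slow_def)

lemma slowE:
  assumes "slow b" "0 < e"
  obtains D where "1 \<le> D" "\<And>s t. 0 < s \<Longrightarrow> 0 < t \<Longrightarrow> b s \<le> D * spread s t powr e * b t"
proof -
  from assms obtain D where D: "1 \<le> D" "\<forall>s>0. \<forall>t>0. b s \<le> D * spread s t powr e * b t"
    unfolding slow_def by (elim conjE allE[of _ e]) auto
  show ?thesis by (rule that[OF D(1)]) (use D(2) in simp)
qed

lemma slow_tame:
  assumes "slow b" "0 < e"
  obtains D where "1 \<le> D" "tame D e (\<lambda>t. ennreal (b t))"
proof -
  obtain D where D: "1 \<le> D" "\<And>s t. 0 < s \<Longrightarrow> 0 < t \<Longrightarrow> b s \<le> D * spread s t powr e * b t"
    using slowE[OF assms] by blast
  have "tame D e (\<lambda>t. ennreal (b t))"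
    unfolding tame_def
  proof (intro allI impI)
    fix s t :: real assume st: "0 < s" "0 < t"
    have "ennreal (b s) \<le> ennreal (D * spread s t powr e * b t)"
      using D(2)[OF st] by (rule ennreal_leI)
    also have "\<dots> = ennreal (D * spread s t powr e) * ennreal (b t)"
      using D(1) by (intro ennreal_mult') auto
    finally show "ennreal (b s) \<le> ennreal (D * spread s t powr e) * ennreal (b t)" .
  qed
  with D(1) show ?thesis by (rule that)
qed

lemma slow_const: "0 < c \<Longrightarrow> slow (\<lambda>_. c)"
proof (rule slowI)
  fix e :: real assume e: "0 < e" and c: "0 < c"
  have "c \<le> 1 * spread s t powr e * c" if "0 < s" "0 < t" for s t
    using spread_ge_1[OF that] e c by (simp add: ge_one_powr_ge_zero)
  then show "\<exists>D. 1 \<le> D \<and> (\<forall>s t. 0 < s \<longrightarrow> 0 < t \<longrightarrow> c \<le> D * spread s t powr e * c)" by blast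
qed

lemma slow_mult:
  assumes "slow a" "slow b"
  shows "slow (\<lambda>t. a t * b t)"
proof (rule slowI)
  fix e :: real assume e: "0 < e"
  obtain D where D: "1 \<le> D" "\<And>s t. 0 < s \<Longrightarrow> 0 < t \<Longrightarrow> a s \<le> D * spread s t powr (e / 2) * a t"
    using slowE[OF assms(1) half_gt_zero[OF e]] by blast
  obtain D' where D': "1 \<le> D'" "\<And>s t. 0 < s \<Longrightarrow> 0 < t \<Longrightarrow> b s \<le> D' * spread s t powr (e / 2) * b t"
    using slowE[OF assms(2) half_gt_zero[OF e]] by blast
  have "a s * b s \<le> (D * D') * spread s t powr e * (a t * b t)" if "0 < s" "0 < t" for s t
  proof -
    have "a s * b s \<le> (D * spread s t powr (e / 2) * a t) * (D' * spread s t powr (e / 2) * b t)"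
      using that D D' slow_pos[OF assms(1)] slow_pos[OF assms(2)]
      by (intro mult_mono) (auto intro!: mult_nonneg_nonneg simp: less_imp_le)
    also have "\<dots> = (D * D') * (spread s t powr (e / 2) * spread s t powr (e / 2)) * (a t * b t)"
      by (simp add: mult_ac)
    finally show ?thesis by (simp flip: powr_add)
  qed
  moreover have "1 \<le> D * D'" using D(1) D'(1) by (simp add: mult_ge1_I)
  ultimately show "\<exists>D. 1 \<le> D \<and> (\<forall>s t. 0 < s \<longrightarrow> 0 < t \<longrightarrow> a s * b s \<le> D * spread s t powr e * (a t * b t))" by blast
qed (use assms slow_pos in auto)

lemma slow_inverse:
  assumes "slow b"
  shows "slow (\<lambda>t. 1 / b t)"
proof (rule slowI)
  fix e :: real assume e: "0 < e"
  obtain D where D: "1 \<le> D" "\<And>s t. 0 < s \<Longrightarrow> 0 < t \<Longrightarrow> b s \<le> D * spread s t powr e * b t"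
    using slowE[OF assms e] by blast
  have "1 / b s \<le> D * spread s t powr e * (1 / b t)" if "0 < s" "0 < t" for s t
    using D(2)[of t s] that slow_pos[OF assms] by (simp add: spread_commute field_simps)
  then show "\<exists>D. 1 \<le> D \<and> (\<forall>s t. 0 < s \<longrightarrow> 0 < t \<longrightarrow> 1 / b s \<le> D * spread s t powr e * (1 / b t))" using D(1) by blast
qed (use assms slow_pos in auto)

lemma slow_powr:
  assumes "slow b"
  shows "slow (\<lambda>t. b t powr x)"
proof -
  have pos: "slow (\<lambda>t. b t powr x)" if x: "0 < x" for x
  proof (rule slowI)
    fix e :: real assume e: "0 < e"
    then have "0 < e / x" using x by simp
    then obtain D where D: "1 \<le> D" "\<And>s t. 0 < s \<Longrightarrow> 0 < t \<Longrightarrow> b s \<le> D * spread s t powr (e / x) * b t"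
      using slowE[OF assms] by blast
    have "b s powr x \<le> D powr x * spread s t powr e * b t powr x" if "0 < s" "0 < t" for s t
    proof -
      have "b s powr x \<le> (D * spread s t powr (e / x) * b t) powr x"
        using D(2)[OF that] x slow_pos[OF assms that(1)] by (intro powr_mono2) auto
      also have "\<dots> = D powr x * spread s t powr e * b t powr x"
        using D(1) x slow_pos[OF assms that(2)] by (simp add: powr_mult powr_powr)
      finally show ?thesis .
    qed
    moreover have "1 \<le> D powr x" using D(1) x by (simp add: ge_one_powr_ge_zero)
    ultimately show "\<exists>D. 1 \<le> D \<and> (\<forall>s t. 0 < s \<longrightarrow> 0 < t \<longrightarrow> b s powr x \<le> D * spread s t powr e * b t powr x)" by blast
  qed (use slow_pos[OF assms] in \<open>force\<close>)
  have eq: "slow f \<Longrightarrow> (\<And>t. 0 < t \<Longrightarrow> f t = g t) \<Longrightarrow> slow g" for f g :: "real \<Rightarrow> real"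
    unfolding slow_def by simp
  consider "0 < x" | "x = 0" | "x < 0" by linarith
  then show ?thesis
  proof cases
    case 2
    show ?thesis by (rule eq[OF slow_const[of 1]]) (use 2 slow_pos[OF assms] in force)+
  next
    case 3
    show ?thesis
      by (rule eq[OF slow_inverse[OF pos[of "- x"]]]) (use 3 in \<open>auto simp: powr_minus_divide\<close>)
  qed (rule pos)
qed

text \<open>
  Compare \<open>t\<^sup>e b(t)\<close> with an increasing function when the argument grows, and \<open>t\<^sup>-\<^sup>e b(t)\<close> with a decreasing
  one when it shrinks.
\<close>

lemma SV_slow:
  assumes "b \<in> SV"
  shows "slow b"
proof (rule slowI)
  fix e :: real assume e: "0 < e"
  have pos: "0 < b t" if "0 < t" for t using assms that by (simp add: SV_def)
  have "(\<exists>g. (\<forall>t>0. g t > 0) \<and> mono_on {0<..} g \<and> equiv_pos (\<lambda>t. t powr e * b t) g)"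
    "(\<exists>h. (\<forall>t>0. h t > 0) \<and> antimono_on {0<..} h \<and> equiv_pos (\<lambda>t. t powr (- e) * b t) h)"
    using assms e by (simp_all add: SV_def)
  then obtain g h where g: "mono_on {0<..} g" "equiv_pos (\<lambda>t. t powr e * b t) g"
    and h: "antimono_on {0<..} h" "equiv_pos (\<lambda>t. t powr (- e) * b t) h"
    by (elim exE conjE)
  obtain C where C: "0 < C" "\<And>t. 0 < t \<Longrightarrow> g t / C \<le> t powr e * b t \<and> t powr e * b t \<le> C * g t"
    using g(2) unfolding equiv_pos_def by blast
  obtain C' where C': "0 < C'" "\<And>t. 0 < t \<Longrightarrow> h t / C' \<le> t powr (- e) * b t \<and> t powr (- e) * b t \<le> C' * h t"
    using h(2) unfolding equiv_pos_def by blast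
  define D where "D = max 1 (max (C * C) (C' * C'))"
  have up: "b s \<le> D * spread s t powr e * b t" if st: "0 < s" "s \<le> t" for s t
  proof -
    have t: "0 < t" using st by simp
    have "s powr e * b s \<le> C * g s" using C(2)[OF st(1)] by simp
    also have "g s \<le> g t" using g(1) st by (auto simp: mono_on_def)
    also have "g t \<le> C * (t powr e * b t)" using C(2)[OF t] C(1) by (simp add: field_simps)
    finally have "s powr e * b s \<le> C * C * (t powr e * b t)" using C(1) by simp
    then have "b s \<le> C * C * ((t powr e / s powr e) * b t)" using st by (simp add: field_simps)
    also have "\<dots> = C * C * (spread s t powr e * b t)" using st by (simp add: spread_le powr_divide)
    also have "\<dots> \<le> D * (spread s t powr e * b t)" unfolding D_def
      using pos[OF t] by (intro mult_right_mono) auto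
    finally show ?thesis by (simp add: mult.assoc)
  qed
  have down: "b t \<le> D * spread t s powr e * b s" if st: "0 < s" "s \<le> t" for s t
  proof -
    have t: "0 < t" using st by simp
    have "t powr (- e) * b t \<le> C' * h t" using C'(2)[OF t] by simp
    also have "h t \<le> h s" using h(1) st by (auto simp: monotone_on_def)
    also have "h s \<le> C' * (s powr (- e) * b s)" using C'(2)[OF st(1)] C'(1) by (simp add: field_simps)
    finally have "t powr (- e) * b t \<le> C' * C' * (s powr (- e) * b s)" using C'(1) by simp
    then have "b t \<le> C' * C' * ((t powr e / s powr e) * b s)"
      using st by (simp add: field_simps powr_minus)
    also have "\<dots> = C' * C' * (spread t s powr e * b s)" using st by (simp add: spread_commute[of t] spread_le powr_divide)
    also have "\<dots> \<le> D * (spread t s powr e * b s)" unfolding D_def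
      using pos[OF st(1)] by (intro mult_right_mono) auto
    finally show ?thesis by (simp add: mult.assoc)
  qed
  have "b s \<le> D * spread s t powr e * b t" if "0 < s" "0 < t" for s t
    using up[of s t] down[of t s] that by linarith
  moreover have "1 \<le> D" by (simp add: D_def)
  ultimately show "\<exists>D. 1 \<le> D \<and> (\<forall>s t. 0 < s \<longrightarrow> 0 < t \<longrightarrow> b s \<le> D * spread s t powr e * b t)" by blast
qed (use assms in \<open>simp add: SV_def\<close>)

section \<open>Powers times slowly varying functions\<close>

lemma dyadic:
  assumes "1 \<le> (x::real)"
  obtains j :: nat where "2 powr real j \<le> x" "x \<le> 2 * 2 powr real j"
proof -
  define j where "j = nat \<lfloor>log 2 x\<rfloor>"
  have l: "0 \<le> log 2 x" using assms by simp
  then have j: "real j \<le> log 2 x" "log 2 x \<le> real j + 1"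
    by (auto simp: j_def)
  have x: "x = 2 powr (log 2 x)" using assms by simp
  have "2 powr real j \<le> 2 powr (log 2 x)" using j by (intro powr_mono) auto
  moreover have "2 powr (log 2 x) \<le> 2 powr (real j + 1)" using j by (intro powr_mono) auto
  ultimately show ?thesis using that[of j] x by (simp add: powr_add)
qed

lemma spread_dyadic:
  assumes "0 < u" "0 < t"
  obtains j :: nat where "2 powr real j \<le> spread u t" "spread u t \<le> 2 * 2 powr real j"
    "u \<in> {2 powr (- real j) * t / 2..2 powr (- real j) * t} \<union> {2 powr real j * t..2 * (2 powr real j * t)}"
proof -
  obtain j :: nat where j: "2 powr real j \<le> spread u t" "spread u t \<le> 2 * 2 powr real j"
    by (rule dyadic[OF spread_ge_1[OF assms]])
  have "u \<in> {2 powr (- real j) * t / 2..2 powr (- real j) * t} \<union> {2 powr real j * t..2 * (2 powr real j * t)}"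
  proof (cases "u \<le> t")
    case True
    then show ?thesis using j assms by (auto simp: spread_le powr_minus field_simps)
  next
    case False
    then show ?thesis using j assms by (auto simp: spread_commute[of u] spread_le field_simps)
  qed
  with j show ?thesis by (rule that)
qed

text \<open>
  On the dyadic shells around \<open>t\<close> the integrand decays geometrically, and each shell has bounded
  \<open>du/u\<close>-measure. All estimates of powers times slowly varying functions reduce to this norm.
\<close>

lemma mnorm_spread:
  assumes q: "0 < q" and d: "0 < d"
  obtains C where "0 < C" "\<And>t. 0 < t \<Longrightarrow> mnorm q {0<..} (\<lambda>u. ennreal (spread u t powr (- d))) \<le> ennreal C"
proof -
  obtain C where C: "0 < C" "\<And>S (g :: nat \<Rightarrow> real \<Rightarrow> ennreal). pos_set S \<Longrightarrow> (\<And>j. meas (g j)) \<Longrightarrow>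
    mnorm q S (\<lambda>u. SUP j. ennreal (2 powr (- d * real j)) * g j u) \<le> ennreal C * (SUP j. mnorm q S (g j))"
    using mnorm_SUP[OF assms] by blast
  let ?T = "triangle_const q * (2 powr recip q + 2 powr recip q)"
  have T: "0 < ?T" using triangle_const_ge_1[of q] by (intro mult_pos_pos add_pos_pos) auto
  show ?thesis
  proof (rule that[of "C * ?T"])
    fix t :: real assume t: "0 < t"
    define I where "I j = {2 powr (- real j) * t / 2..2 powr (- real j) * t}" for j :: nat
    define J where "J j = {2 powr real j * t..2 * (2 powr real j * t)}" for j :: nat
    have dom: "pos_set (I j)" "pos_set (J j)" "pos_set (I j \<union> J j)" for j
    proof -
      show "pos_set (I j)" "pos_set (J j)" using t by (simp_all add: I_def J_def)
      then show "pos_set (I j \<union> J j)" by (auto simp: pos_set_def)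
    qed
    have meas: "meas (indicator (I j \<union> J j))" for j
      by (intro meas_borel) (simp add: I_def J_def)
    have "mnorm q {0<..} (\<lambda>u. ennreal (spread u t powr (- d))) \<le>
        mnorm q {0<..} (\<lambda>u. SUP j. ennreal (2 powr (- d * real j)) * indicator (I j \<union> J j) u)"
    proof (rule mnorm_mono[OF pos_setI(1) q])
      fix u :: real assume "u \<in> {0<..}"
      then obtain j where j: "2 powr real j \<le> spread u t" "u \<in> I j \<union> J j"
        unfolding I_def J_def using spread_dyadic[of u t] t by (metis greaterThan_iff)
      have "spread u t powr (- d) \<le> (2 powr real j) powr (- d)"
        using j(1) d by (intro powr_mono2') auto
      then have "ennreal (spread u t powr (- d)) \<le> ennreal (2 powr (- d * real j)) * indicator (I j \<union> J j) u"
        using j(2) by (simp add: powr_powr mult.commute ennreal_leI)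
      also have "\<dots> \<le> (SUP j. ennreal (2 powr (- d * real j)) * indicator (I j \<union> J j) u)"
        by (rule SUP_upper) simp
      finally show "ennreal (spread u t powr (- d)) \<le> (SUP j. ennreal (2 powr (- d * real j)) * indicator (I j \<union> J j) u)" .
    qed
    also have "\<dots> \<le> ennreal C * (SUP j. mnorm q {0<..} (indicator (I j \<union> J j)))"
      by (rule C(2)[OF pos_setI(1) meas])
    also have "\<dots> \<le> ennreal C * ennreal ?T"
    proof (intro mult_left_mono SUP_least)
      fix j
      have "mnorm q {0<..} (indicator (I j \<union> J j)) \<le> mnorm q (I j \<union> J j) (\<lambda>_. 1)"
        using mnorm_indicator[OF pos_setI(1) dom(3) q, of "\<lambda>_. 1" j] by simp
      also have "\<dots> \<le> ennreal (triangle_const q) * (mnorm q (I j) (\<lambda>_. 1) + mnorm q (J j) (\<lambda>_. 1))"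
        using q dom by (intro mnorm_split) auto
      also have "\<dots> \<le> ennreal (triangle_const q) * (ennreal (2 powr recip q) * 1 + ennreal (2 powr recip q) * 1)"
        using q dom t
        by (intro mult_left_mono add_mono mnorm_upper[of _ _ _ "2 powr (- real j) * t / 2"] mnorm_upper[of _ _ _ "2 powr real j * t"])
          (auto simp: I_def J_def)
      also have "\<dots> = ennreal ?T"
        by (simp only: mult_1_right ennreal_plus[OF powr_ge_zero powr_ge_zero]
            ennreal_mult'[OF order_trans[OF zero_le_one triangle_const_ge_1]])
      finally show "mnorm q {0<..} (indicator (I j \<union> J j)) \<le> ennreal ?T" .
    qed simp
    also have "\<dots> = ennreal (C * ?T)" using C(1) by (simp add: ennreal_mult')
    finally show "mnorm q {0<..} (\<lambda>u. ennreal (spread u t powr (- d))) \<le> ennreal (C * ?T)" .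
  qed (use C T in simp)
qed

text \<open>
  On the side of \<open>t\<close> described by the sign condition, \<open>u\<^sup>x\<close> equals
  \<open>t\<^sup>x\<close> times \<open>spread u t\<close> to the power \<open>- \<bar>x\<bar>\<close>; half of this decay absorbs the variation of \<open>b\<close>, and the
  other half has a bounded norm by \<open>mnorm_spread\<close>.
\<close>

lemma mnorm_slow:
  assumes q: "0 < q" and x: "x \<noteq> 0" and b: "slow b"
  obtains C where "0 < C" "\<And>S t. pos_set S \<Longrightarrow> 0 < t \<Longrightarrow> (\<And>u. u \<in> S \<Longrightarrow> 0 \<le> x * (t - u)) \<Longrightarrow>
    mnorm q S (\<lambda>u. ennreal (u powr x * b u)) \<le> ennreal (C * (t powr x * b t))"
proof -
  \<comment> \<open>The exponent is shared equally between the variation of \<open>b\<close> and summability.\<close>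
  define d where "d = \<bar>x\<bar> / 2"
  have d: "0 < d" using x by (simp add: d_def)
  obtain C where C: "0 < C" "\<And>t. 0 < t \<Longrightarrow> mnorm q {0<..} (\<lambda>u. ennreal (spread u t powr (- d))) \<le> ennreal C"
    using mnorm_spread[OF q d] by blast
  obtain D where D: "1 \<le> D" "\<And>s t. 0 < s \<Longrightarrow> 0 < t \<Longrightarrow> b s \<le> D * spread s t powr d * b t"
    using slowE[OF b d] by blast
  show ?thesis
  proof (rule that[of "D * C"])
    fix S t assume S: "pos_set S" and t: "(0::real) < t" and side: "\<And>u. u \<in> S \<Longrightarrow> 0 \<le> x * (t - u)"
    let ?c = "D * (t powr x * b t)"
    have c: "0 \<le> ?c" using D(1) slow_pos[OF b t] by simp
    have "mnorm q S (\<lambda>u. ennreal (u powr x * b u)) \<le> mnorm q {0<..} (\<lambda>u. ennreal ?c * ennreal (spread u t powr (- d)))"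
    proof (rule mnorm_mono_set[OF S pos_setI(1) q])
      fix u assume uS: "u \<in> S"
      then have u: "0 < u" using S by (auto simp: pos_set_def)
      have o: "0 < spread u t" using spread_ge_1[OF u t] by simp
      have "u powr x = t powr x * spread u t powr (- \<bar>x\<bar>)"
      proof (cases "0 < x")
        case True
        then have "u \<le> t" using side[OF uS] by (simp add: zero_le_mult_iff)
        then show ?thesis using True u t by (simp add: spread_le powr_divide powr_minus field_simps)
      next
        case False
        then have "t \<le> u" using side[OF uS] x by (auto simp: zero_le_mult_iff)
        then show ?thesis using False u t by (simp add: spread_commute[of u] spread_le powr_divide field_simps)
      qed
      then have "u powr x * b u \<le> (t powr x * spread u t powr (- \<bar>x\<bar>)) * (D * spread u t powr d * b t)"
        using D(2)[OF u t] by (intro mult_mono) (auto simp: less_imp_le[OF slow_pos[OF b u]])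
      also have "\<dots> = ?c * (spread u t powr (- \<bar>x\<bar>) * spread u t powr d)" by (simp only: mult_ac)
      also have "spread u t powr (- \<bar>x\<bar>) * spread u t powr d = spread u t powr (- d)"
        by (subst powr_add[symmetric]) (simp add: d_def)
      finally show "ennreal (u powr x * b u) \<le> ennreal ?c * ennreal (spread u t powr (- d))"
        using c by (simp flip: ennreal_mult' add: ennreal_leI)
    qed (use S in \<open>simp add: pos_set_def\<close>)
    also have "\<dots> \<le> ennreal ?c * ennreal C"
      using c q by (intro order_trans[OF mnorm_cmult_le] mult_left_mono C(2) t) auto
    also have "\<dots> = ennreal (D * C * (t powr x * b t))"
      by (subst ennreal_mult'[OF c, symmetric]) (simp add: mult_ac)
    finally show "mnorm q S (\<lambda>u. ennreal (u powr x * b u)) \<le> ennreal (D * C * (t powr x * b t))" .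
  qed (use C D in simp)
qed

section \<open>Weighted norms\<close>

definition weight :: "(real \<Rightarrow> real) \<Rightarrow> bool" where
  "weight b \<longleftrightarrow> slow b \<and> b \<in> borel_measurable (lebesgue_on {0<..})"

lemma SV_weight: "b \<in> SV \<Longrightarrow> weight b"
  by (simp add: weight_def SV_slow) (simp add: SV_def)

lemma weight_slow: "weight b \<Longrightarrow> slow b" by (simp add: weight_def)

lemma wnorm_eq: "wnorm \<theta> q b S g = mnorm q S (\<lambda>u. ennreal (u powr (- \<theta>) * b u) * g u)"
proof -
  have "ennreal (u powr (- \<theta> - recip q) * b u) * g u =
    ennreal (u powr (- recip q)) * (ennreal (u powr (- \<theta>) * b u) * g u)" for u
  proof -
    have "u powr (- \<theta> - recip q) * b u = u powr (- recip q) * (u powr (- \<theta>) * b u)"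
      using powr_add[of u "- \<theta>" "- recip q"] by (simp add: mult_ac)
    then show ?thesis by (simp only: ennreal_mult'[OF powr_ge_zero] mult.assoc)
  qed
  then show ?thesis by (simp add: wnorm_def mnorm_def)
qed

lemma meas_weight:
  assumes "weight b" "meas g"
  shows "meas (\<lambda>u. ennreal (u powr (- \<theta>) * b u) * g u)"
proof (rule borel_measurable_times_ennreal[OF _ assms(2)])
  have "(\<lambda>u::real. u powr (- \<theta>)) \<in> borel_measurable (lebesgue_on {0<..})"
    by (intro measurable_restrict_space1 measurable_completion) simp
  then have "(\<lambda>u. u powr (- \<theta>) * b u) \<in> borel_measurable (lebesgue_on {0<..})"
    using assms(1) unfolding weight_def by (intro borel_measurable_times) auto
  then show "meas (\<lambda>u. ennreal (u powr (- \<theta>) * b u))"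
    by (rule measurable_compose) simp
qed

lemma wnorm_mono_set:
  assumes "pos_set S" "pos_set T" "0 < q" "S \<subseteq> T" "\<And>u. u \<in> S \<Longrightarrow> f u \<le> g u"
  shows "wnorm \<theta> q b S f \<le> wnorm \<theta> q b T g"
  unfolding wnorm_eq using assms by (intro mnorm_mono_set mult_left_mono) auto

lemma wnorm_mono:
  assumes "pos_set S" "0 < q" "\<And>u. u \<in> S \<Longrightarrow> f u \<le> g u"
  shows "wnorm \<theta> q b S f \<le> wnorm \<theta> q b S g"
  using assms by (intro wnorm_mono_set) auto

lemma wnorm_cmult_le:
  assumes "pos_set S" "0 < q" "0 \<le> c"
  shows "wnorm \<theta> q b S (\<lambda>u. ennreal c * g u) \<le> ennreal c * wnorm \<theta> q b S g"
  unfolding wnorm_eq using mnorm_cmult_le[OF assms] by (simp add: mult.left_commute)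

lemma wnorm_cmult:
  assumes "pos_set S" "0 < q" "0 < c"
  shows "wnorm \<theta> q b S (\<lambda>u. ennreal c * g u) = ennreal c * wnorm \<theta> q b S g"
  unfolding wnorm_eq using mnorm_cmult[OF assms] by (simp add: mult.left_commute)

lemma wnorm_add:
  assumes "0 < q" "weight b" "pos_set S" "meas f" "meas g"
  shows "wnorm \<theta> q b S (\<lambda>u. f u + g u) \<le> ennreal (triangle_const q) * (wnorm \<theta> q b S f + wnorm \<theta> q b S g)"
  unfolding wnorm_eq distrib_left[of "ennreal (u powr a * w)" for u a w]
  using assms by (intro mnorm_add meas_weight)

lemma wnorm_split:
  assumes "0 < q" "weight b" "pos_set S" "pos_set T" "pos_set U" "S \<subseteq> T \<union> U \<union> {x}" "meas f"
  shows "wnorm \<theta> q b S f \<le> ennreal (triangle_const q) * (wnorm \<theta> q b T f + wnorm \<theta> q b U f)"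
  unfolding wnorm_eq using assms by (intro mnorm_split meas_weight)

text \<open>
  Tame weights are comparable to a constant on \<open>(t, 2t)\<close>, so this follows from the unweighted bound.
\<close>

lemma wnorm_lower:
  assumes "0 < q" "slow b"
  obtains C where "0 < C" "\<And>S t c g. pos_set S \<Longrightarrow> 0 < t \<Longrightarrow> {t<..<2*t} \<subseteq> S \<Longrightarrow>
    (\<And>u. t < u \<Longrightarrow> u < 2 * t \<Longrightarrow> c \<le> g u) \<Longrightarrow> ennreal (t powr (- \<theta>) * b t) * c \<le> ennreal C * wnorm \<theta> q b S g"
proof -
  define C where "C = 2 powr recip q"
  have C: "0 < C" by (simp add: C_def)
  obtain D where D: "1 \<le> D" "\<And>s t. 0 < s \<Longrightarrow> 0 < t \<Longrightarrow> b s \<le> D * spread s t powr 1 * b t"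
    using slowE[OF assms(2), of 1] zero_less_one by blast
  let ?K = "2 powr \<bar>\<theta>\<bar> * (D * 2)"
  have K: "0 < ?K" using D by simp
  show ?thesis
  proof (rule that[of "?K * C"])
    fix S t c and g :: "real \<Rightarrow> ennreal"
    assume S: "pos_set S" "0 < t" "{t<..<2*t} \<subseteq> S" and g: "\<And>u. t < u \<Longrightarrow> u < 2 * t \<Longrightarrow> c \<le> g u"
    have "ennreal (t powr (- \<theta>) * b t) * c \<le> ennreal C * mnorm q S (\<lambda>u. ennreal ?K * (ennreal (u powr (- \<theta>) * b u) * g u))"
      unfolding C_def
    proof (rule mnorm_lower[OF assms(1) S])
      fix u assume u: "t < u" "u < 2 * t"
      have o: "1 \<le> spread t u" "spread t u \<le> 2" using u S(2) by (auto simp: spread_le field_simps)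
      have "t powr (- \<theta>) \<le> spread t u powr \<bar>\<theta>\<bar> * u powr (- \<theta>)"
        using powr_spread[of t u "- \<theta>"] u S(2) by simp
      also have "\<dots> \<le> 2 powr \<bar>\<theta>\<bar> * u powr (- \<theta>)"
        using o by (intro mult_right_mono powr_mono2) auto
      finally have 1: "t powr (- \<theta>) \<le> 2 powr \<bar>\<theta>\<bar> * u powr (- \<theta>)" .
      have "b t \<le> D * spread t u powr 1 * b u" using D(2) u S(2) by simp
      also have "\<dots> \<le> D * 2 * b u"
        using o D(1) slow_pos[OF assms(2), of u] u S(2) by (intro mult_right_mono mult_left_mono) auto
      finally have 2: "b t \<le> D * 2 * b u" .
      have "t powr (- \<theta>) * b t \<le> (2 powr \<bar>\<theta>\<bar> * u powr (- \<theta>)) * (D * 2 * b u)"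
        using slow_pos[OF assms(2) S(2)] by (intro mult_mono 1 2) auto
      also have "\<dots> = ?K * (u powr (- \<theta>) * b u)" by simp
      finally have "t powr (- \<theta>) * b t \<le> ?K * (u powr (- \<theta>) * b u)" .
      from mult_mono[OF ennreal_leI[OF this] g[OF u]]
      have "ennreal (t powr (- \<theta>) * b t) * c \<le> ennreal (?K * (u powr (- \<theta>) * b u)) * g u"
        by simp
      also have "\<dots> = ennreal ?K * (ennreal (u powr (- \<theta>) * b u) * g u)"
        using K by (subst ennreal_mult') (auto simp: mult.assoc)
      finally show "ennreal (t powr (- \<theta>) * b t) * c \<le> ennreal ?K * (ennreal (u powr (- \<theta>) * b u) * g u)" .
    qed
    also have "\<dots> \<le> ennreal C * (ennreal ?K * wnorm \<theta> q b S g)"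
      unfolding wnorm_eq using K by (intro mult_left_mono mnorm_cmult_le S assms) auto
    also have "\<dots> = ennreal (?K * C) * wnorm \<theta> q b S g"
      using C K by (subst ennreal_mult) (auto simp: mult_ac)
    finally show "ennreal (t powr (- \<theta>) * b t) * c \<le> ennreal (?K * C) * wnorm \<theta> q b S g" .
  qed (use C K in simp)
qed

lemma wnorm_one_pos:
  assumes "0 < q" "slow b" "pos_set S" "0 < t" "{t<..<2*t} \<subseteq> S"
  shows "0 < wnorm \<theta> q b S (\<lambda>_. 1)"
proof -
  obtain C where C: "0 < C" "\<And>S t c g. pos_set S \<Longrightarrow> 0 < t \<Longrightarrow> {t<..<2*t} \<subseteq> S \<Longrightarrow>
    (\<And>u. t < u \<Longrightarrow> u < 2 * t \<Longrightarrow> c \<le> g u) \<Longrightarrow> ennreal (t powr (- \<theta>) * b t) * c \<le> ennreal C * wnorm \<theta> q b S g"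
    using wnorm_lower[OF assms(1,2)] by blast
  have "0 < ennreal (t powr (- \<theta>) * b t) * 1" using slow_pos[OF assms(2,4)] assms(4) by simp
  also have "\<dots> \<le> ennreal C * wnorm \<theta> q b S (\<lambda>_. 1)" by (rule C(2)[OF assms(3,4,5)]) simp
  finally show ?thesis by (auto simp: zero_less_iff_neq_zero)
qed

lemma wnorm_const:
  assumes "0 < q" "slow b" "pos_set S" "0 < t" "{t<..<2*t} \<subseteq> S"
  shows "wnorm \<theta> q b S (\<lambda>_. x) = x * wnorm \<theta> q b S (\<lambda>_. 1)"
proof (cases x)
  case (real y)
  show ?thesis
  proof (cases "y = 0")
    case True
    have "wnorm \<theta> q b S (\<lambda>_. ennreal 0 * 1) \<le> ennreal 0 * wnorm \<theta> q b S (\<lambda>_. 1)"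
      by (rule wnorm_cmult_le) (use assms in auto)
    then show ?thesis using real True by simp
  next
    case False
    then show ?thesis using wnorm_cmult[OF assms(3,1), of y \<theta> b "\<lambda>_. 1"] real by simp
  qed
next
  case top
  obtain C where C: "0 < C" "\<And>S t c g. pos_set S \<Longrightarrow> 0 < t \<Longrightarrow> {t<..<2*t} \<subseteq> S \<Longrightarrow>
    (\<And>u. t < u \<Longrightarrow> u < 2 * t \<Longrightarrow> c \<le> g u) \<Longrightarrow> ennreal (t powr (- \<theta>) * b t) * c \<le> ennreal C * wnorm \<theta> q b S g"
    using wnorm_lower[OF assms(1,2)] by blast
  have "ennreal (t powr (- \<theta>) * b t) * top \<le> ennreal C * wnorm \<theta> q b S (\<lambda>_. top)"
    by (rule C(2)[OF assms(3,4,5)]) simp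
  moreover have "ennreal (t powr (- \<theta>) * b t) * top = top"
    using slow_pos[OF assms(2,4)] assms(4) by (simp add: ennreal_mult_top)
  ultimately have "wnorm \<theta> q b S (\<lambda>_. top) = top"
    by (simp add: top_unique ennreal_mult_eq_top_iff)
  moreover have "top * wnorm \<theta> q b S (\<lambda>_. 1) = top"
    using wnorm_one_pos[OF assms, of \<theta>] by (simp add: ennreal_top_mult)
  ultimately show ?thesis using top by simp
qed

text \<open>
  Dilating a norm by \<open>l\<close> replaces \<open>b(u)\<close> by \<open>b(l u)\<close>, which costs only a small power of the dilation
  factor. Hence every function of \<open>t\<close> that is built from such norms over sets proportional to \<open>t\<close> is again
  slowly varying; this is how \<open>\<chi>\<^sub>0\<close> and \<open>\<chi>\<^sub>1\<close> are treated.
\<close>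

lemma wnorm_scale_le:
  assumes "0 < q" "weight b" "0 < e"
  obtains D where "1 \<le> D" "\<And>S T l g. pos_set S \<Longrightarrow> pos_set T \<Longrightarrow> 0 < l \<Longrightarrow>
    (\<And>u. 0 < u \<Longrightarrow> l * u \<in> S \<longleftrightarrow> u \<in> T) \<Longrightarrow> meas g \<Longrightarrow>
    wnorm 0 q b S g \<le> ennreal (D * spread l 1 powr e) * wnorm 0 q b T (\<lambda>u. g (l * u))"
proof -
  obtain D where D: "1 \<le> D" "\<And>s t. 0 < s \<Longrightarrow> 0 < t \<Longrightarrow> b s \<le> D * spread s t powr e * b t"
    using slowE[OF weight_slow[OF assms(2)] assms(3)] by blast
  show ?thesis
  proof (rule that[OF D(1)])
    fix S T l g
    assume S: "pos_set S" and T: "pos_set T" and l: "(0::real) < l" and ST: "\<And>u. 0 < u \<Longrightarrow> l * u \<in> S \<longleftrightarrow> u \<in> T" and g: "meas g"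
    let ?c = "D * spread l 1 powr e"
    have c: "0 \<le> ?c" using D(1) by simp
    have "wnorm 0 q b S g = mnorm q T (\<lambda>u. ennreal ((l * u) powr (- 0) * b (l * u)) * g (l * u))"
      unfolding wnorm_eq by (rule mnorm_scale[OF S T assms(1) l ST meas_weight[OF assms(2) g]])
    also have "\<dots> \<le> mnorm q T (\<lambda>u. ennreal ?c * (ennreal (u powr (- 0) * b u) * g (l * u)))"
    proof (rule mnorm_mono[OF T assms(1)])
      fix u assume "u \<in> T"
      then have u: "0 < u" using T by (auto simp: pos_set_def)
      have "ennreal ((l * u) powr (- 0) * b (l * u)) \<le> ennreal (?c * (u powr (- 0) * b u))"
        using D(2)[of "l * u" u] l u by (intro ennreal_leI) (simp add: spread_scale1)
      also have "\<dots> = ennreal ?c * ennreal (u powr (- 0) * b u)" using c by (rule ennreal_mult')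
      finally show "ennreal ((l * u) powr (- 0) * b (l * u)) * g (l * u) \<le>
         ennreal ?c * (ennreal (u powr (- 0) * b u) * g (l * u))"
        unfolding mult.assoc[symmetric] by (rule mult_right_mono) simp
    qed
    also have "\<dots> \<le> ennreal ?c * wnorm 0 q b T (\<lambda>u. g (l * u))"
      unfolding wnorm_eq by (rule mnorm_cmult_le[OF T assms(1) c])
    finally show "wnorm 0 q b S g \<le> ennreal ?c * wnorm 0 q b T (\<lambda>u. g (l * u))" .
  qed
qed

lemma meas_head: "0 < q \<Longrightarrow> meas (\<lambda>s. wnorm \<theta> q a {0<..<s} k)"
  by (rule meas_mono) (auto intro!: wnorm_mono_set)

lemma meas_between: "0 < q \<Longrightarrow> 0 \<le> t \<Longrightarrow> meas (\<lambda>s. wnorm \<theta> q a {t<..<s} k)"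
  by (rule meas_mono) (auto intro!: wnorm_mono_set)

lemma tail_tame:
  assumes "0 < r" "weight b" "0 < e"
  obtains D where "1 \<le> D" "tame D e (\<lambda>t. wnorm 0 r b {t<..} (\<lambda>_. 1))"
proof -
  obtain D where D: "1 \<le> D" "\<And>S T l g. pos_set S \<Longrightarrow> pos_set T \<Longrightarrow> 0 < l \<Longrightarrow>
    (\<And>u. 0 < u \<Longrightarrow> l * u \<in> S \<longleftrightarrow> u \<in> T) \<Longrightarrow> meas g \<Longrightarrow>
    wnorm 0 r b S g \<le> ennreal (D * spread l 1 powr e) * wnorm 0 r b T (\<lambda>u. g (l * u))"
    using wnorm_scale_le[OF assms] by blast
  have "tame D e (\<lambda>t. wnorm 0 r b {t<..} (\<lambda>_. 1))"
    unfolding tame_def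
  proof (intro allI impI)
    fix s t :: real assume st: "0 < s" "0 < t"
    show "wnorm 0 r b {s<..} (\<lambda>_. 1) \<le> ennreal (D * spread s t powr e) * wnorm 0 r b {t<..} (\<lambda>_. 1)"
      using D(2)[of "{s<..}" "{t<..}" "s / t" "\<lambda>_. 1"] st by (simp add: spread_divide1 field_simps)
  qed
  with D(1) show ?thesis by (rule that)
qed

lemma head_tame:
  assumes "0 < r" "weight b" "0 < e"
  obtains D where "1 \<le> D" "tame D e (\<lambda>t. wnorm 0 r b {0<..<t} (\<lambda>_. 1))"
proof -
  obtain D where D: "1 \<le> D" "\<And>S T l g. pos_set S \<Longrightarrow> pos_set T \<Longrightarrow> 0 < l \<Longrightarrow>
    (\<And>u. 0 < u \<Longrightarrow> l * u \<in> S \<longleftrightarrow> u \<in> T) \<Longrightarrow> meas g \<Longrightarrow>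
    wnorm 0 r b S g \<le> ennreal (D * spread l 1 powr e) * wnorm 0 r b T (\<lambda>u. g (l * u))"
    using wnorm_scale_le[OF assms] by blast
  have "tame D e (\<lambda>t. wnorm 0 r b {0<..<t} (\<lambda>_. 1))"
    unfolding tame_def
  proof (intro allI impI)
    fix s t :: real assume st: "0 < s" "0 < t"
    show "wnorm 0 r b {0<..<s} (\<lambda>_. 1) \<le> ennreal (D * spread s t powr e) * wnorm 0 r b {0<..<t} (\<lambda>_. 1)"
      using D(2)[of "{0<..<s}" "{0<..<t}" "s / t" "\<lambda>_. 1"] st by (simp add: spread_divide1 field_simps)
  qed
  with D(1) show ?thesis by (rule that)
qed

text \<open>
  With \<open>S t = (t, \<infinity>)\<close>, \<open>L t = t\<close> this is \<open>\<chi>\<^sub>0\<close>; with \<open>S t = (0, t)\<close>, \<open>L t = 0\<close> it is the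
  first summand of \<open>\<chi>\<^sub>1\<close>.
\<close>

lemma nested_tame_aux:
  assumes "0 < r" "weight b" "0 < q" "weight a" "0 < e"
    and S: "\<And>t. 0 < t \<Longrightarrow> pos_set (S t)" "\<And>t u l. 0 < t \<Longrightarrow> 0 < u \<Longrightarrow> 0 < l \<Longrightarrow> l * u \<in> S (l * t) \<longleftrightarrow> u \<in> S t"
    and L: "\<And>t. 0 < t \<Longrightarrow> 0 \<le> L t" "\<And>t l. 0 < t \<Longrightarrow> 0 < l \<Longrightarrow> L (l * t) = l * L t"
  obtains D where "1 \<le> D" "tame D e (\<lambda>t. wnorm 0 r b (S t) (\<lambda>s. wnorm 0 q a {L t<..<s} (\<lambda>_. 1)))"
proof -
  have e2: "0 < e / 2" using assms by simp
  obtain D where D: "1 \<le> D" "\<And>S T l g. pos_set S \<Longrightarrow> pos_set T \<Longrightarrow> 0 < l \<Longrightarrow>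
    (\<And>u. 0 < u \<Longrightarrow> l * u \<in> S \<longleftrightarrow> u \<in> T) \<Longrightarrow> meas g \<Longrightarrow>
    wnorm 0 r b S g \<le> ennreal (D * spread l 1 powr (e / 2)) * wnorm 0 r b T (\<lambda>u. g (l * u))"
    using wnorm_scale_le[OF assms(1,2) e2] by blast
  obtain E where E: "1 \<le> E" "\<And>S T l g. pos_set S \<Longrightarrow> pos_set T \<Longrightarrow> 0 < l \<Longrightarrow>
    (\<And>u. 0 < u \<Longrightarrow> l * u \<in> S \<longleftrightarrow> u \<in> T) \<Longrightarrow> meas g \<Longrightarrow>
    wnorm 0 q a S g \<le> ennreal (E * spread l 1 powr (e / 2)) * wnorm 0 q a T (\<lambda>u. g (l * u))"
    using wnorm_scale_le[OF assms(3,4) e2] by blast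
  have "tame (D * E) e (\<lambda>t. wnorm 0 r b (S t) (\<lambda>s. wnorm 0 q a {L t<..<s} (\<lambda>_. 1)))"
    unfolding tame_def
  proof (intro allI impI)
    fix s t :: real assume st: "0 < s" "0 < t"
    define l where "l = s / t"
    have l: "0 < l" "l * t = s" "spread l 1 = spread s t" using st by (auto simp: l_def spread_divide1)
    let ?o = "spread s t powr (e / 2)"
    have "wnorm 0 r b (S s) (\<lambda>v. wnorm 0 q a {L s<..<v} (\<lambda>_. 1)) \<le>
      ennreal (D * ?o) * wnorm 0 r b (S t) (\<lambda>v. wnorm 0 q a {L s<..<l * v} (\<lambda>_. 1))"
      unfolding l(3)[symmetric]
    proof (rule D(2)[OF S(1) S(1) l(1)])
      show "l * u \<in> S s \<longleftrightarrow> u \<in> S t" if "0 < u" for u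
        using S(2)[OF st(2) that l(1)] l(2) by simp
    qed (use st L(1) assms in \<open>auto intro: meas_between\<close>)
    also have "\<dots> \<le> ennreal (D * ?o) * wnorm 0 r b (S t) (\<lambda>v. ennreal (E * ?o) * wnorm 0 q a {L t<..<v} (\<lambda>_. 1))"
    proof (intro mult_left_mono wnorm_mono S st assms)
      fix v assume "v \<in> S t"
      have L': "L s = l * L t" using L(2)[OF st(2) l(1)] l(2) by simp
      show "wnorm 0 q a {L s<..<l * v} (\<lambda>_. 1) \<le> ennreal (E * ?o) * wnorm 0 q a {L t<..<v} (\<lambda>_. 1)"
        unfolding l(3)[symmetric]
        by (rule E(2)) (use L(1)[OF st(1)] L(1)[OF st(2)] l(1) in \<open>auto simp: L'\<close>)
    qed auto
    also have "\<dots> \<le> ennreal (D * ?o) * (ennreal (E * ?o) * wnorm 0 r b (S t) (\<lambda>v. wnorm 0 q a {L t<..<v} (\<lambda>_. 1)))"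
      using E(1) by (intro mult_left_mono wnorm_cmult_le S st assms) auto
    also have "\<dots> = ennreal ((D * ?o) * (E * ?o)) * wnorm 0 r b (S t) (\<lambda>v. wnorm 0 q a {L t<..<v} (\<lambda>_. 1))"
      using D(1) by (subst ennreal_mult') (auto simp: mult.assoc)
    also have "(D * ?o) * (E * ?o) = D * E * (?o * ?o)" by (simp only: mult_ac)
    also have "?o * ?o = spread s t powr e" by (simp flip: powr_add)
    finally show "wnorm 0 r b (S s) (\<lambda>v. wnorm 0 q a {L s<..<v} (\<lambda>_. 1)) \<le>
      ennreal (D * E * spread s t powr e) * wnorm 0 r b (S t) (\<lambda>v. wnorm 0 q a {L t<..<v} (\<lambda>_. 1))" .
  qed
  moreover have "1 \<le> D * E" using D(1) E(1) by (simp add: mult_ge1_I)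
  ultimately show ?thesis by (intro that)
qed

lemma tame_add:
  assumes "tame D e F" "tame D' e G" "0 \<le> D" "0 \<le> D'"
  shows "tame (max D D') e (\<lambda>t. F t + G t)"
  unfolding tame_def
proof (intro allI impI)
  fix s t :: real assume st: "0 < s" "0 < t"
  have *: "tame (max D D') e F" "tame (max D D') e G" using assms tame_weaken by auto
  have "F s + G s \<le> ennreal (max D D' * spread s t powr e) * F t + ennreal (max D D' * spread s t powr e) * G t"
    using * st by (intro add_mono tameD)
  then show "F s + G s \<le> ennreal (max D D' * spread s t powr e) * (F t + G t)" by (simp add: distrib_left)
qed

text \<open>
  Tameness spreads finiteness and positivity from the point 1 to the whole half-line, so the hypotheses of
  the theorem, which concern a single point, are enough.
\<close>

lemma slow_enn2real:
  assumes "\<And>e. 0 < e \<Longrightarrow> \<exists>D. 1 \<le> D \<and> tame D e E" "E 1 < top" "0 < E 1"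
  shows "\<And>t. 0 < t \<Longrightarrow> E t < top" "\<And>t. 0 < t \<Longrightarrow> 0 < E t" "slow (\<lambda>t. enn2real (E t))"
proof -
  obtain D where D: "1 \<le> D" "tame D 1 E" using assms(1)[of 1] by auto
  show fin: "E t < top" if "0 < t" for t
    using tameD[OF D(2) that zero_less_one] assms(2) by (simp add: ennreal_mult_less_top le_less_trans)
  show pos: "0 < E t" if "0 < t" for t
    using tameD[OF D(2) zero_less_one that] assms(3) by (auto simp: zero_less_iff_neq_zero)
  show "slow (\<lambda>t. enn2real (E t))"
  proof (rule slowI)
    fix e :: real assume "0 < e"
    then obtain D where D: "1 \<le> D" "tame D e E" using assms(1)[of e] by auto
    have "enn2real (E s) \<le> D * spread s t powr e * enn2real (E t)" if "0 < s" "0 < t" for s t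
    proof -
      have "enn2real (E s) \<le> enn2real (ennreal (D * spread s t powr e) * E t)"
        using tameD[OF D(2) that] fin[OF that(2)] by (intro enn2real_mono) (auto simp: ennreal_mult_less_top)
      then show ?thesis using D(1) by (simp add: enn2real_mult)
    qed
    then show "\<exists>D. 1 \<le> D \<and> (\<forall>s t. 0 < s \<longrightarrow> 0 < t \<longrightarrow> enn2real (E s) \<le> D * spread s t powr e * enn2real (E t))"
      using D(1) by blast
  qed (use fin pos in \<open>auto simp: enn2real_positive_iff\<close>)
qed

lemma wnorm_Id: "pos_set S \<Longrightarrow> 0 < q \<Longrightarrow> wnorm 1 q a S (\<lambda>u. ennreal u) = wnorm 0 q a S (\<lambda>_. 1)"
  unfolding wnorm_eq
proof (rule mnorm_cong)
  fix u assume "pos_set S" "u \<in> S"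
  then have u: "0 < u" by (auto simp: pos_set_def)
  have "ennreal (u powr - 1 * a u) * ennreal u = ennreal (u powr - 1 * a u * u)"
    using u by (intro ennreal_mult''[symmetric]) simp
  also have "u powr - 1 * a u * u = u powr - 0 * a u"
    using u by (simp add: powr_minus field_simps)
  finally show "ennreal (u powr - 1 * a u) * ennreal u = ennreal (u powr - 0 * a u) * 1" by simp
qed

section \<open>Nested norms cut at a point\<close>

text \<open>
  The norm of a space of type L as a functional of \<open>k(u) = K(u,f)\<close>, together with the three
  pieces into which a cut at \<open>t\<close> divides the region \<open>u < s\<close> of its double integral: \<open>low\<close> has both variables
  below \<open>t\<close>, \<open>mid\<close> has them on different sides of \<open>t\<close>, and \<open>high\<close> has both above \<open>t\<close>.
\<close>

locale nested =
  fixes \<theta> :: real and r :: ennreal and b :: "real \<Rightarrow> real" and q :: ennreal and a :: "real \<Rightarrow> real"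
  assumes r: "0 < r" and q: "0 < q" and b: "weight b" and a: "weight a"
begin

definition full :: "(real \<Rightarrow> ennreal) \<Rightarrow> ennreal" where
  "full k = wnorm 0 r b {0<..} (\<lambda>s. wnorm \<theta> q a {0<..<s} k)"

definition low :: "real \<Rightarrow> (real \<Rightarrow> ennreal) \<Rightarrow> ennreal" where
  "low t k = wnorm 0 r b {0<..<t} (\<lambda>s. wnorm \<theta> q a {0<..<s} k)"

definition tail :: "real \<Rightarrow> ennreal" where
  "tail t = wnorm 0 r b {t<..} (\<lambda>_. 1)"

definition mid :: "real \<Rightarrow> (real \<Rightarrow> ennreal) \<Rightarrow> ennreal" where
  "mid t k = tail t * wnorm \<theta> q a {0<..<t} k"

definition high :: "real \<Rightarrow> (real \<Rightarrow> ennreal) \<Rightarrow> ennreal" where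
  "high t k = wnorm 0 r b {t<..} (\<lambda>s. wnorm \<theta> q a {t<..<s} k)"

lemma low_mono: "(\<And>u. 0 < u \<Longrightarrow> u < t \<Longrightarrow> k u \<le> k' u) \<Longrightarrow> low t k \<le> low t k'"
  unfolding low_def using r q by (intro wnorm_mono) auto

lemma mid_mono: "(\<And>u. 0 < u \<Longrightarrow> u < t \<Longrightarrow> k u \<le> k' u) \<Longrightarrow> mid t k \<le> mid t k'"
  unfolding mid_def using q by (intro mult_left_mono wnorm_mono) auto

lemma high_mono: "0 < t \<Longrightarrow> (\<And>u. t < u \<Longrightarrow> k u \<le> k' u) \<Longrightarrow> high t k \<le> high t k'"
  unfolding high_def using r q by (intro wnorm_mono) auto

lemma low_cmult_le: "0 \<le> c \<Longrightarrow> low t (\<lambda>u. ennreal c * k u) \<le> ennreal c * low t k"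
  unfolding low_def using r q
  by (intro order_trans[OF wnorm_mono wnorm_cmult_le] wnorm_cmult_le) auto

lemma mid_cmult_le: "0 \<le> c \<Longrightarrow> mid t (\<lambda>u. ennreal c * k u) \<le> ennreal c * mid t k"
  unfolding mid_def using q mult_left_mono[OF wnorm_cmult_le[of "{0<..<t}" q c \<theta> a k], of "tail t"]
  by (simp add: mult.left_commute)

lemma high_cmult_le: "0 \<le> c \<Longrightarrow> 0 < t \<Longrightarrow> high t (\<lambda>u. ennreal c * k u) \<le> ennreal c * high t k"
  unfolding high_def using r q
  by (intro order_trans[OF wnorm_mono wnorm_cmult_le] wnorm_cmult_le) auto

lemma low_le_full: "low t k \<le> full k"
  unfolding low_def full_def using r q by (intro wnorm_mono_set) auto

lemma const_on_tail: "0 < t \<Longrightarrow> wnorm 0 r b {t<..} (\<lambda>_. x) = tail t * x"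
  unfolding tail_def mult.commute[of _ x] using r b weight_slow
  by (intro wnorm_const[of _ _ _ t]) auto

lemma mid_le_full: "0 < t \<Longrightarrow> mid t k \<le> full k"
  unfolding mid_def full_def const_on_tail[symmetric]
  using r q by (intro wnorm_mono_set) auto

lemma high_le_full: "0 < t \<Longrightarrow> high t k \<le> full k"
  unfolding high_def full_def using r q by (intro wnorm_mono_set) auto

text \<open>
  Cut the outer norm at \<open>t\<close>; for outer variable above \<open>t\<close>, cut also the inner norm there. The lower part of
  the latter does not depend on the outer variable, which makes \<open>mid\<close> a product.
\<close>

lemma full_split:
  obtains C where "0 < C" "\<And>t k. 0 < t \<Longrightarrow> meas k \<Longrightarrow> full k \<le> ennreal C * (low t k + mid t k + high t k)"
proof -
  let ?C1 = "triangle_const r" and ?C2 = "triangle_const q"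
  define C where "C = ?C1 * max 1 (?C2 * ?C1)"
  show ?thesis
  proof (rule that[of C])
    fix t k assume t: "(0::real) < t" and k: "meas k"
    let ?x = "wnorm \<theta> q a {0<..<t} k"
    have "wnorm 0 r b {t<..} (\<lambda>s. wnorm \<theta> q a {0<..<s} k) \<le>
        wnorm 0 r b {t<..} (\<lambda>s. ennreal ?C2 * (?x + wnorm \<theta> q a {t<..<s} k))"
      using t k r by (intro wnorm_mono wnorm_split[where x = t] q a) auto
    also have "\<dots> \<le> ennreal ?C2 * wnorm 0 r b {t<..} (\<lambda>s. ?x + wnorm \<theta> q a {t<..<s} k)"
      using t r triangle_const_ge_1[of q] by (intro wnorm_cmult_le) auto
    also have "\<dots> \<le> ennreal ?C2 * (ennreal ?C1 * (wnorm 0 r b {t<..} (\<lambda>s. ?x) + high t k))"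
      unfolding high_def using t q r b by (intro mult_left_mono wnorm_add meas_between) auto
    also have "\<dots> = ennreal (?C2 * ?C1) * (mid t k + high t k)"
      using triangle_const_ge_1[of q] by (simp add: const_on_tail[OF t] mid_def ennreal_mult' mult.assoc)
    also have "\<dots> \<le> ennreal (max 1 (?C2 * ?C1)) * (mid t k + high t k)"
      by (intro mult_right_mono ennreal_leI) auto
    finally have 2: "wnorm 0 r b {t<..} (\<lambda>s. wnorm \<theta> q a {0<..<s} k) \<le> ennreal (max 1 (?C2 * ?C1)) * (mid t k + high t k)" .
    have "1 * low t k \<le> ennreal (max 1 (?C2 * ?C1)) * low t k"
      by (intro mult_right_mono) (auto simp flip: ennreal_1 intro!: ennreal_leI simp del: ennreal_1)
    then have 1: "low t k \<le> ennreal (max 1 (?C2 * ?C1)) * low t k" by simp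
    have "full k \<le> ennreal ?C1 * (low t k + wnorm 0 r b {t<..} (\<lambda>s. wnorm \<theta> q a {0<..<s} k))"
      unfolding full_def low_def using t q r b by (intro wnorm_split[where x = t] meas_head) auto
    also have "\<dots> \<le> ennreal ?C1 * (ennreal (max 1 (?C2 * ?C1)) * low t k + ennreal (max 1 (?C2 * ?C1)) * (mid t k + high t k))"
      by (intro mult_left_mono add_mono 1 2) auto
    also have "\<dots> = ennreal C * (low t k + mid t k + high t k)"
      unfolding C_def using triangle_const_ge_1[of r] by (simp add: ennreal_mult' distrib_left mult.assoc add.assoc)
    finally show "full k \<le> ennreal C * (low t k + mid t k + high t k)" .
  qed (use triangle_const_ge_1[of r] in \<open>simp add: C_def less_max_iff_disj\<close>)
qed

lemma parts_add:
  obtains C where "0 < C"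
    "\<And>t k k'. 0 < t \<Longrightarrow> meas k \<Longrightarrow> meas k' \<Longrightarrow> low t (\<lambda>u. k u + k' u) \<le> ennreal C * (low t k + low t k')"
    "\<And>t k k'. 0 < t \<Longrightarrow> meas k \<Longrightarrow> meas k' \<Longrightarrow> mid t (\<lambda>u. k u + k' u) \<le> ennreal C * (mid t k + mid t k')"
    "\<And>t k k'. 0 < t \<Longrightarrow> meas k \<Longrightarrow> meas k' \<Longrightarrow> high t (\<lambda>u. k u + k' u) \<le> ennreal C * (high t k + high t k')"
proof -
  define C1 C2 where "C1 = triangle_const r" and "C2 = triangle_const q"
  have C1: "0 < C1" and C2: "0 < C2"
    using triangle_const_ge_1[of r] triangle_const_ge_1[of q] by (simp_all add: C1_def C2_def)
  define C where "C = max 1 C1 * C2"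
  have C: "C1 * C2 \<le> C" "C2 \<le> C" using C1 C2 by (auto simp: C_def intro: mult_right_mono mult_le_cancel_right1[THEN iffD2])
  have nest: "wnorm 0 r b S (\<lambda>s. wnorm \<theta> q a (T s) (\<lambda>u. k u + k' u)) \<le>
       ennreal C * (wnorm 0 r b S (\<lambda>s. wnorm \<theta> q a (T s) k) + wnorm 0 r b S (\<lambda>s. wnorm \<theta> q a (T s) k'))"
    if "pos_set S" "\<And>s. s \<in> S \<Longrightarrow> pos_set (T s)" "meas k" "meas k'" "meas (\<lambda>s. wnorm \<theta> q a (T s) k)" "meas (\<lambda>s. wnorm \<theta> q a (T s) k')"
    for S T k k'
  proof -
    have "wnorm 0 r b S (\<lambda>s. wnorm \<theta> q a (T s) (\<lambda>u. k u + k' u)) \<le>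
       wnorm 0 r b S (\<lambda>s. ennreal C2 * (wnorm \<theta> q a (T s) k + wnorm \<theta> q a (T s) k'))"
      unfolding C2_def using that r q a by (intro wnorm_mono wnorm_add) auto
    also have "\<dots> \<le> ennreal C2 * wnorm 0 r b S (\<lambda>s. wnorm \<theta> q a (T s) k + wnorm \<theta> q a (T s) k')"
      using that r C2 by (intro wnorm_cmult_le) auto
    also have "\<dots> \<le> ennreal C2 * (ennreal C1 * (wnorm 0 r b S (\<lambda>s. wnorm \<theta> q a (T s) k) + wnorm 0 r b S (\<lambda>s. wnorm \<theta> q a (T s) k')))"
      unfolding C1_def using that r b by (intro mult_left_mono wnorm_add) auto
    also have "\<dots> = ennreal (C1 * C2) * (wnorm 0 r b S (\<lambda>s. wnorm \<theta> q a (T s) k) + wnorm 0 r b S (\<lambda>s. wnorm \<theta> q a (T s) k'))"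
      using C2 by (simp add: ennreal_mult'' mult_ac)
    also have "\<dots> \<le> ennreal C * (wnorm 0 r b S (\<lambda>s. wnorm \<theta> q a (T s) k) + wnorm 0 r b S (\<lambda>s. wnorm \<theta> q a (T s) k'))"
      using C by (intro mult_right_mono ennreal_leI) auto
    finally show ?thesis .
  qed
  show ?thesis
  proof (rule that[of C])
    fix t k k' assume t: "(0::real) < t" and k: "meas k" "meas k'"
    show "low t (\<lambda>u. k u + k' u) \<le> ennreal C * (low t k + low t k')"
      unfolding low_def using k q by (intro nest meas_head) auto
    show "high t (\<lambda>u. k u + k' u) \<le> ennreal C * (high t k + high t k')"
      unfolding high_def using k q t by (intro nest meas_between) auto
    have "mid t (\<lambda>u. k u + k' u) \<le> tail t * (ennreal C2 * (wnorm \<theta> q a {0<..<t} k + wnorm \<theta> q a {0<..<t} k'))"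
      unfolding mid_def C2_def using k q a by (intro mult_left_mono wnorm_add) auto
    also have "\<dots> = ennreal C2 * (mid t k + mid t k')"
      by (simp add: mid_def distrib_left mult_ac)
    also have "\<dots> \<le> ennreal C * (mid t k + mid t k')"
      using C by (intro mult_right_mono ennreal_leI) auto
    finally show "mid t (\<lambda>u. k u + k' u) \<le> ennreal C * (mid t k + mid t k')" .
  qed (use C1 C2 in \<open>simp add: C_def less_max_iff_disj\<close>)
qed

lemma low_increasing: "s \<le> t \<Longrightarrow> low s k \<le> low t k"
  unfolding low_def using r q by (intro wnorm_mono_set) auto

lemma tail_decreasing: "0 < s \<Longrightarrow> s \<le> t \<Longrightarrow> tail t \<le> tail s"
  unfolding tail_def using r by (intro wnorm_mono_set) auto

lemma high_decreasing: "0 < s \<Longrightarrow> s \<le> t \<Longrightarrow> high t k \<le> high s k"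
  unfolding high_def using r q by (intro wnorm_mono_set) auto

lemma meas_parts: "meas (\<lambda>t. low t k)" "meas (\<lambda>t. mid t k)" "meas (\<lambda>t. high t k)"
proof -
  show "meas (\<lambda>t. low t k)" by (rule meas_mono) (rule low_increasing)
  show "meas (\<lambda>t. high t k)" by (rule meas_antimono) (rule high_decreasing)
  have "meas tail" by (rule meas_antimono) (rule tail_decreasing)
  then show "meas (\<lambda>t. mid t k)" unfolding mid_def
    by (rule borel_measurable_times_ennreal) (rule meas_head[OF q])
qed

lemma weight_le_tail:
  obtains C where "0 < C" "\<And>t. 0 < t \<Longrightarrow> ennreal (b t) \<le> ennreal C * tail t"
proof -
  obtain C where C: "0 < C" "\<And>S t c g. pos_set S \<Longrightarrow> 0 < t \<Longrightarrow> {t<..<2*t} \<subseteq> S \<Longrightarrow>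
    (\<And>u. t < u \<Longrightarrow> u < 2 * t \<Longrightarrow> c \<le> g u) \<Longrightarrow> ennreal (t powr (- 0) * b t) * c \<le> ennreal C * wnorm 0 r b S g"
    using wnorm_lower[OF r weight_slow[OF b], of 0] by blast
  show ?thesis
  proof (rule that[OF C(1)])
    fix t :: real assume t: "0 < t"
    have "ennreal (t powr (- 0) * b t) * 1 \<le> ennreal C * wnorm 0 r b {t<..} (\<lambda>_. 1)"
      using t by (intro C(2)) auto
    then show "ennreal (b t) \<le> ennreal C * tail t" using t by (simp add: tail_def)
  qed
qed

lemma inner_power:
  assumes "slow l" "x \<noteq> \<theta>"
  obtains C where "0 < C" "\<And>S t. pos_set S \<Longrightarrow> 0 < t \<Longrightarrow> (\<And>u. u \<in> S \<Longrightarrow> 0 \<le> (x - \<theta>) * (t - u)) \<Longrightarrow>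
    wnorm \<theta> q a S (\<lambda>u. ennreal (u powr x * l u)) \<le> ennreal (C * (t powr (x - \<theta>) * (a t * l t)))"
proof -
  have x: "x - \<theta> \<noteq> 0" using assms by simp
  obtain C where C: "0 < C" "\<And>S t. pos_set S \<Longrightarrow> 0 < t \<Longrightarrow> (\<And>u. u \<in> S \<Longrightarrow> 0 \<le> (x - \<theta>) * (t - u)) \<Longrightarrow>
    mnorm q S (\<lambda>u. ennreal (u powr (x - \<theta>) * (a u * l u))) \<le> ennreal (C * (t powr (x - \<theta>) * (a t * l t)))"
    using mnorm_slow[OF q x slow_mult[OF weight_slow[OF a] assms(1)]] by blast
  have eq: "wnorm \<theta> q a S (\<lambda>u. ennreal (u powr x * l u)) = mnorm q S (\<lambda>u. ennreal (u powr (x - \<theta>) * (a u * l u)))"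
    if "pos_set S" for S
    unfolding wnorm_eq
  proof (rule mnorm_cong[OF that q])
    fix u assume "u \<in> S"
    then have u: "0 < u" using that by (auto simp: pos_set_def)
    have "ennreal (u powr - \<theta> * a u) * ennreal (u powr x * l u) = ennreal ((u powr - \<theta> * a u) * (u powr x * l u))"
      using slow_pos[OF weight_slow[OF a] u] by (intro ennreal_mult'[symmetric]) simp
    also have "(u powr - \<theta> * a u) * (u powr x * l u) = u powr (x - \<theta>) * (a u * l u)"
      using powr_add[of u x "- \<theta>"] by simp
    finally show "ennreal (u powr - \<theta> * a u) * ennreal (u powr x * l u) = ennreal (u powr (x - \<theta>) * (a u * l u))" .
  qed
  show ?thesis by (rule that[OF C(1)]) (simp add: eq C(2))
qed

text \<open>
  The inner norm of a growing power is attained near its upper end point, up to a constant. In \<open>low\<close> the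
  outer norm then behaves in the same way and produces \<open>b(t)\<close>, which is at most a multiple of \<open>tail t\<close>.
\<close>

lemma low_mid_power:
  assumes "slow l" "\<theta> < x"
  obtains C where "0 < C" "\<And>t. 0 < t \<Longrightarrow>
    low t (\<lambda>u. ennreal (u powr x * l u)) + mid t (\<lambda>u. ennreal (u powr x * l u)) \<le>
      ennreal (C * (t powr (x - \<theta>) * (a t * l t))) * tail t"
proof -
  have x: "x - \<theta> \<noteq> 0" "x \<noteq> \<theta>" using assms by simp_all
  obtain C1 where C1: "0 < C1" "\<And>S t. pos_set S \<Longrightarrow> 0 < t \<Longrightarrow> (\<And>u. u \<in> S \<Longrightarrow> 0 \<le> (x - \<theta>) * (t - u)) \<Longrightarrow>
    wnorm \<theta> q a S (\<lambda>u. ennreal (u powr x * l u)) \<le> ennreal (C1 * (t powr (x - \<theta>) * (a t * l t)))"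
    using inner_power[OF assms(1) x(2)] by blast
  have in1: "wnorm \<theta> q a {0<..<t} (\<lambda>u. ennreal (u powr x * l u)) \<le> ennreal (C1 * (t powr (x - \<theta>) * (a t * l t)))"
    if "0 < t" for t
    using assms(2) that by (intro C1(2)) auto
  have sl: "slow (\<lambda>t. b t * (a t * l t))" by (rule slow_mult[OF weight_slow[OF b] slow_mult[OF weight_slow[OF a] assms(1)]])
  obtain C2 where C2: "0 < C2" "\<And>S t. pos_set S \<Longrightarrow> 0 < t \<Longrightarrow> (\<And>u. u \<in> S \<Longrightarrow> 0 \<le> (x - \<theta>) * (t - u)) \<Longrightarrow>
    mnorm r S (\<lambda>u. ennreal (u powr (x - \<theta>) * (b u * (a u * l u)))) \<le> ennreal (C2 * (t powr (x - \<theta>) * (b t * (a t * l t))))"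
    using mnorm_slow[OF r x(1) sl] by blast
  obtain C3 where C3: "0 < C3" "\<And>t. 0 < t \<Longrightarrow> ennreal (b t) \<le> ennreal C3 * tail t"
    using weight_le_tail by blast
  show ?thesis
  proof (rule that[of "C1 * C2 * C3 + C1"])
    fix t :: real assume t: "0 < t"
    let ?k = "\<lambda>u. ennreal (u powr x * l u)" and ?v = "t powr (x - \<theta>) * (a t * l t)"
    have v: "0 \<le> ?v" using slow_pos[OF weight_slow[OF a] t] slow_pos[OF assms(1) t] by simp
    have "low t ?k \<le> wnorm 0 r b {0<..<t} (\<lambda>s. ennreal C1 * ennreal (s powr (x - \<theta>) * (a s * l s)))"
      unfolding low_def using r in1 C1(1) by (intro wnorm_mono) (auto simp flip: ennreal_mult')
    also have "\<dots> \<le> ennreal C1 * wnorm 0 r b {0<..<t} (\<lambda>s. ennreal (s powr (x - \<theta>) * (a s * l s)))"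
      using r C1 by (intro wnorm_cmult_le) auto
    also have "wnorm 0 r b {0<..<t} (\<lambda>s. ennreal (s powr (x - \<theta>) * (a s * l s))) =
        mnorm r {0<..<t} (\<lambda>u. ennreal (u powr (x - \<theta>) * (b u * (a u * l u))))"
      unfolding wnorm_eq
    proof (rule mnorm_cong)
      fix u assume "u \<in> {0<..<t}"
      then have u: "0 < u" by auto
      have "ennreal (u powr - 0 * b u) * ennreal (u powr (x - \<theta>) * (a u * l u)) = ennreal ((u powr - 0 * b u) * (u powr (x - \<theta>) * (a u * l u)))"
        using slow_pos[OF weight_slow[OF b] u] by (intro ennreal_mult'[symmetric]) simp
      then show "ennreal (u powr - 0 * b u) * ennreal (u powr (x - \<theta>) * (a u * l u)) = ennreal (u powr (x - \<theta>) * (b u * (a u * l u)))"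
        using u by (simp add: mult_ac)
    qed (use r in auto)
    also have "ennreal C1 * \<dots> \<le> ennreal C1 * ennreal (C2 * (t powr (x - \<theta>) * (b t * (a t * l t))))"
      using assms(2) t by (intro mult_left_mono C2(2)) auto
    also have "\<dots> = ennreal (C1 * C2 * ?v) * ennreal (b t)"
      using C1(1) C2(1) v slow_pos[OF weight_slow[OF b] t]
      by (simp add: mult_ac flip: ennreal_mult' ennreal_mult'')
    also have "\<dots> \<le> ennreal (C1 * C2 * ?v) * (ennreal C3 * tail t)"
      by (intro mult_left_mono C3 t) auto
    also have "\<dots> = ennreal (C1 * C2 * C3 * ?v) * tail t"
      using C1(1) C2(1) C3(1) v by (simp add: mult_ac flip: ennreal_mult' ennreal_mult'')
        (simp add: ennreal_mult' ennreal_mult'' mult_ac)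
    finally have low: "low t ?k \<le> ennreal (C1 * C2 * C3 * ?v) * tail t" .
    have mid: "mid t ?k \<le> ennreal (C1 * ?v) * tail t"
      unfolding mid_def mult.commute[of "tail t"] by (intro mult_right_mono in1 t) auto
    have "low t ?k + mid t ?k \<le> (ennreal (C1 * C2 * C3 * ?v) + ennreal (C1 * ?v)) * tail t"
      unfolding distrib_right by (intro add_mono low mid)
    also have "ennreal (C1 * C2 * C3 * ?v) + ennreal (C1 * ?v) = ennreal ((C1 * C2 * C3 + C1) * ?v)"
      using C1(1) C2(1) C3(1) v by (subst ennreal_plus[symmetric]) (auto simp: distrib_right)
    finally show "low t ?k + mid t ?k \<le> ennreal ((C1 * C2 * C3 + C1) * ?v) * tail t" .
  qed (use C1 C2 C3 in \<open>simp add: add_pos_pos\<close>)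
qed

lemma high_power:
  assumes "slow l" "x < \<theta>"
  obtains C where "0 < C" "\<And>t. 0 < t \<Longrightarrow>
    high t (\<lambda>u. ennreal (u powr x * l u)) \<le> ennreal (C * (t powr (x - \<theta>) * (a t * l t))) * tail t"
proof -
  have x: "x \<noteq> \<theta>" using assms by simp
  obtain C1 where C1: "0 < C1" "\<And>S t. pos_set S \<Longrightarrow> 0 < t \<Longrightarrow> (\<And>u. u \<in> S \<Longrightarrow> 0 \<le> (x - \<theta>) * (t - u)) \<Longrightarrow>
    wnorm \<theta> q a S (\<lambda>u. ennreal (u powr x * l u)) \<le> ennreal (C1 * (t powr (x - \<theta>) * (a t * l t)))"
    using inner_power[OF assms(1) x] by blast
  show ?thesis
  proof (rule that[OF C1(1)])
    fix t :: real assume t: "0 < t"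
    let ?k = "\<lambda>u. ennreal (u powr x * l u)" and ?z = "ennreal (C1 * (t powr (x - \<theta>) * (a t * l t)))"
    have "high t ?k \<le> wnorm 0 r b {t<..} (\<lambda>s. ?z)"
      unfolding high_def
    proof (rule wnorm_mono)
      fix s
      show "wnorm \<theta> q a {t<..<s} ?k \<le> ?z"
        using t assms(2) by (intro C1(2)) (auto intro: mult_nonpos_nonpos)
    qed (use t r in auto)
    then show "high t ?k \<le> ?z * tail t" by (simp add: const_on_tail[OF t] mult.commute)
  qed
qed

end

lemma weight_le_head:
  assumes "0 < q" "slow a"
  obtains C where "0 < C" "\<And>t. 0 < t \<Longrightarrow> ennreal (a t) \<le> ennreal C * wnorm 0 q a {0<..<t} (\<lambda>_. 1)"
proof -
  obtain C where C: "0 < C" "\<And>S t c g. pos_set S \<Longrightarrow> 0 < t \<Longrightarrow> {t<..<2*t} \<subseteq> S \<Longrightarrow>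
    (\<And>u. t < u \<Longrightarrow> u < 2 * t \<Longrightarrow> c \<le> g u) \<Longrightarrow> ennreal (t powr (- 0) * a t) * c \<le> ennreal C * wnorm 0 q a S g"
    using wnorm_lower[OF assms, of 0] by blast
  obtain D where D: "1 \<le> D" "tame D 1 (\<lambda>t. ennreal (a t))"
    using slow_tame[OF assms(2), of 1] zero_less_one by blast
  show ?thesis
  proof (rule that[of "D * 2 * C"])
    fix t :: real assume t: "0 < t"
    have "ennreal (a t) \<le> ennreal (D * spread t (t / 2) powr 1) * ennreal (a (t / 2))"
      using t by (intro tameD[OF D(2)]) auto
    also have "\<dots> = ennreal (D * 2) * ennreal (a (t / 2))"
      using t by (simp add: spread_commute[of t] spread_le)
    also have "\<dots> \<le> ennreal (D * 2) * (ennreal C * wnorm 0 q a {0<..<t} (\<lambda>_. 1))"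
    proof (rule mult_left_mono)
      have "ennreal ((t / 2) powr (- 0) * a (t / 2)) * 1 \<le> ennreal C * wnorm 0 q a {0<..<t} (\<lambda>_. 1)"
        using t by (intro C(2)) auto
      then show "ennreal (a (t / 2)) \<le> ennreal C * wnorm 0 q a {0<..<t} (\<lambda>_. 1)" using t by simp
    qed simp
    also have "\<dots> = ennreal (D * 2 * C) * wnorm 0 q a {0<..<t} (\<lambda>_. 1)"
      using C(1) by (simp add: ennreal_mult'' mult.assoc)
    finally show "ennreal (a t) \<le> ennreal (D * 2 * C) * wnorm 0 q a {0<..<t} (\<lambda>_. 1)" .
  qed (use C D in simp)
qed

text \<open>
  For outer variable above \<open>2t\<close> the inner interval contains \<open>(t, 2t)\<close>, where the inner norm is at
  least a multiple of \<open>a(t)\<close>; and \<open>tail\<close> at \<open>2t\<close> is comparable to \<open>tail\<close> at \<open>t\<close>.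
\<close>

lemma weight_tail_le_nested:
  assumes "0 < r" "weight b" "0 < q" "slow a"
  obtains C where "0 < C" "\<And>t. 0 < t \<Longrightarrow> ennreal (a t) * wnorm 0 r b {t<..} (\<lambda>_. 1) \<le>
     ennreal C * wnorm 0 r b {t<..} (\<lambda>s. wnorm 0 q a {t<..<s} (\<lambda>_. 1))"
proof -
  obtain C where C: "0 < C" "\<And>S t c g. pos_set S \<Longrightarrow> 0 < t \<Longrightarrow> {t<..<2*t} \<subseteq> S \<Longrightarrow>
    (\<And>u. t < u \<Longrightarrow> u < 2 * t \<Longrightarrow> c \<le> g u) \<Longrightarrow> ennreal (t powr (- 0) * a t) * c \<le> ennreal C * wnorm 0 q a S g"
    using wnorm_lower[OF assms(3,4), of 0] by blast
  obtain D where D: "1 \<le> D" "tame D 1 (\<lambda>t. wnorm 0 r b {t<..} (\<lambda>_. 1))"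
    using tail_tame[OF assms(1,2), of 1] zero_less_one by blast
  show ?thesis
  proof (rule that[of "D * 2 * C"])
    fix t :: real assume t: "0 < t"
    let ?w = "wnorm 0 q a {t<..<2*t} (\<lambda>_. 1)"
    have at: "ennreal (a t) \<le> ennreal C * ?w"
      using C(2)[of "{t<..<2*t}" t 1 "\<lambda>_. 1"] t by simp
    have "wnorm 0 r b {t<..} (\<lambda>_. 1) \<le> ennreal (D * spread t (2 * t) powr 1) * wnorm 0 r b {2*t<..} (\<lambda>_. 1)"
      using t by (intro tameD[OF D(2)]) auto
    then have "wnorm 0 r b {t<..} (\<lambda>_. 1) \<le> ennreal (D * 2) * wnorm 0 r b {2*t<..} (\<lambda>_. 1)"
      using t by (simp add: spread_le)
    from mult_mono[OF at this]
    have "ennreal (a t) * wnorm 0 r b {t<..} (\<lambda>_. 1) \<le>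
        (ennreal C * ?w) * (ennreal (D * 2) * wnorm 0 r b {2*t<..} (\<lambda>_. 1))" by simp
    also have "\<dots> = ennreal (D * 2 * C) * (?w * wnorm 0 r b {2*t<..} (\<lambda>_. 1))"
    proof -
      have e: "ennreal (D * 2 * C) = ennreal (D * 2) * ennreal C" using C(1) by (intro ennreal_mult'') simp
      have "(ennreal C * ?w) * (ennreal (D * 2) * wnorm 0 r b {2*t<..} (\<lambda>_. 1)) =
          (ennreal (D * 2) * ennreal C) * (?w * wnorm 0 r b {2*t<..} (\<lambda>_. 1))"
        by (simp only: mult_ac)
      then show ?thesis unfolding e .
    qed
    also have "?w * wnorm 0 r b {2*t<..} (\<lambda>_. 1) = wnorm 0 r b {2*t<..} (\<lambda>_. ?w)"
      using t assms weight_slow by (intro wnorm_const[symmetric, of _ _ _ "2 * t"]) auto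
    also have "\<dots> \<le> wnorm 0 r b {t<..} (\<lambda>s. wnorm 0 q a {t<..<s} (\<lambda>_. 1))"
      using t assms by (intro wnorm_mono_set) auto
    finally show "ennreal (a t) * wnorm 0 r b {t<..} (\<lambda>_. 1) \<le>
       ennreal (D * 2 * C) * wnorm 0 r b {t<..} (\<lambda>s. wnorm 0 q a {t<..<s} (\<lambda>_. 1))"
      by (simp add: mult_left_mono)
  qed (use C D in simp)
qed

section \<open>The K-functional\<close>

lemma le_cmult_Inf:
  assumes "0 < c" "\<And>x. x \<in> A \<Longrightarrow> y \<le> ennreal c * x"
  shows "y \<le> ennreal c * Inf A"
proof -
  have cc: "ennreal (1 / c) * ennreal c = 1" using assms by (simp flip: ennreal_mult'')
  have "ennreal (1 / c) * y \<le> Inf A"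
  proof (rule Inf_greatest)
    fix x assume "x \<in> A"
    then have "ennreal (1 / c) * y \<le> ennreal (1 / c) * (ennreal c * x)"
      using assms by (intro mult_left_mono) auto
    then show "ennreal (1 / c) * y \<le> x" by (simp add: mult.assoc[symmetric] cc)
  qed
  then have "ennreal c * (ennreal (1 / c) * y) \<le> ennreal c * Inf A" by (intro mult_left_mono) auto
  then show ?thesis by (simp add: mult.assoc[symmetric] cc mult.commute[of "ennreal c"])
qed

lemma le_Inf_add_Inf:
  fixes z :: ennreal
  assumes "\<And>x y. x \<in> A \<Longrightarrow> y \<in> B \<Longrightarrow> z \<le> x + y"
  shows "z \<le> Inf A + Inf B"
proof (cases "Inf A + Inf B = top")
  case False
  then have "Inf A \<noteq> top" "Inf B \<noteq> top" using ennreal_add_eq_top[of "Inf A" "Inf B"] by blast+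
  then have fin: "Inf A < top" "Inf B < top" using top.not_eq_extremum by blast+
  show ?thesis
  proof (rule ennreal_le_epsilon)
    fix e :: real assume e: "0 < e"
    have lt: "w < w + ennreal (e / 2)" if "w < top" for w
      using ennreal_add_left_cancel_less[of w 0 "ennreal (e / 2)"] that e by auto
    obtain x y where xy: "x \<in> A" "x < Inf A + ennreal (e / 2)" "y \<in> B" "y < Inf B + ennreal (e / 2)"
      using lt[OF fin(1)] lt[OF fin(2)] unfolding Inf_less_iff by blast
    have "z \<le> x + y" using assms xy by blast
    also have "\<dots> \<le> (Inf A + ennreal (e / 2)) + (Inf B + ennreal (e / 2))"
      using xy by (intro add_mono) auto
    also have "\<dots> = Inf A + Inf B + (ennreal (e / 2) + ennreal (e / 2))" by (simp only: ac_simps)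
    also have "ennreal (e / 2) + ennreal (e / 2) = ennreal e"
      using e by (subst ennreal_plus[symmetric]) auto
    finally show "z \<le> Inf A + Inf B + ennreal e" .
  qed
next
  case True
  show ?thesis unfolding True by (rule top_greatest)
qed

lemma Kfun_le: "f0 \<in> qspace N0 \<Longrightarrow> f1 \<in> qspace N1 \<Longrightarrow> f = f0 + f1 \<Longrightarrow> Kfun N0 N1 t f \<le> N0 f0 + ennreal t * N1 f1"
  unfolding Kfun_def by (intro Inf_lower) blast

lemma Kfun_mono: "s \<le> t \<Longrightarrow> Kfun N0 N1 s f \<le> Kfun N0 N1 t f"
  unfolding Kfun_def
  by (rule Inf_mono) (force intro: add_left_mono mult_right_mono ennreal_leI)

text \<open>
  For a fixed decomposition, \<open>N0 f0 + t N1 f1 \<le> (t/s) (N0 f0 + s N1 f1)\<close>. So, although \<open>N0\<close> and \<open>N1\<close> are only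
  quasi-norms, \<open>K\<close> is increasing and \<open>K(t)/t\<close> is decreasing with no constants lost.
\<close>

lemma Kfun_scale:
  assumes "0 < s" "s \<le> t"
  shows "Kfun N0 N1 t f \<le> ennreal (t / s) * Kfun N0 N1 s f"
  unfolding Kfun_def[of _ _ s]
proof (rule le_cmult_Inf)
  fix x assume "x \<in> {N0 f0 + ennreal s * N1 f1 |f0 f1. f0 \<in> qspace N0 \<and> f1 \<in> qspace N1 \<and> f = f0 + f1}"
  then obtain f0 f1 where f: "x = N0 f0 + ennreal s * N1 f1" "f0 \<in> qspace N0" "f1 \<in> qspace N1" "f = f0 + f1" by blast
  have ts: "ennreal t = ennreal (t / s) * ennreal s" using assms by (simp flip: ennreal_mult')
  have "1 * N0 f0 \<le> ennreal (t / s) * N0 f0"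
    using assms by (intro mult_right_mono) (auto simp flip: ennreal_1 intro!: ennreal_leI simp del: ennreal_1)
  then have "N0 f0 + ennreal t * N1 f1 \<le> ennreal (t / s) * x"
    unfolding f(1) ts by (simp add: distrib_left mult.assoc add_right_mono)
  with Kfun_le[OF f(2,3,4)] show "Kfun N0 N1 t f \<le> ennreal (t / s) * x" by (rule order_trans)
qed (use assms in simp)

lemma Kfun_tame: "tame 1 1 (\<lambda>t. Kfun N0 N1 t f)"
  unfolding tame_def
proof (intro allI impI)
  fix s t :: real assume st: "0 < s" "0 < t"
  show "Kfun N0 N1 s f \<le> ennreal (1 * spread s t powr 1) * Kfun N0 N1 t f"
  proof (cases "s \<le> t")
    case True
    have "Kfun N0 N1 s f \<le> 1 * Kfun N0 N1 t f" using Kfun_mono[OF True] by simp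
    also have "\<dots> \<le> ennreal (1 * spread s t powr 1) * Kfun N0 N1 t f"
      using spread_ge_1[OF st] by (intro mult_right_mono) (auto simp flip: ennreal_1 intro!: ennreal_leI simp del: ennreal_1)
    finally show ?thesis .
  next
    case False
    then show ?thesis using Kfun_scale[of t s N0 N1 f] st by (simp add: spread_commute[of s] spread_le)
  qed
qed

lemma quasi_norm_0:
  assumes "quasi_norm N"
  shows "N 0 = 0" "0 \<in> qspace N"
proof -
  show "N 0 = 0" using assms unfolding quasi_norm_def by blast
  then show "0 \<in> qspace N" by (simp add: qspace_def)
qed

lemma quasi_norm_uminus:
  assumes "quasi_norm N"
  shows "N (- f) = N f"
proof -
  have "N ((- 1) *\<^sub>R f) = ennreal \<bar>- 1\<bar> * N f" using assms unfolding quasi_norm_def by blast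
  then show ?thesis by simp
qed

lemma quasi_norm_add:
  assumes "quasi_norm N"
  obtains C where "1 \<le> C" "\<And>f g. N (f + g) \<le> ennreal C * (N f + N g)"
  using assms unfolding quasi_norm_def by blast

lemma Kfun_le_left: "quasi_norm N1 \<Longrightarrow> f \<in> qspace N0 \<Longrightarrow> Kfun N0 N1 t f \<le> N0 f"
  using Kfun_le[of f N0 0 N1 f t] quasi_norm_0 by fastforce

lemma Kfun_le_right: "quasi_norm N0 \<Longrightarrow> f \<in> qspace N1 \<Longrightarrow> Kfun N0 N1 t f \<le> ennreal t * N1 f"
  using Kfun_le[of 0 N0 f N1 f t] quasi_norm_0 by fastforce

lemma Kfun_finite: "f \<in> sum_space N0 N1 \<Longrightarrow> Kfun N0 N1 t f < top"
proof -
  assume "f \<in> sum_space N0 N1"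
  then obtain f0 f1 where f: "f0 \<in> qspace N0" "f1 \<in> qspace N1" "f = f0 + f1" by (auto simp: sum_space_def)
  have "N0 f0 + ennreal t * N1 f1 < top" using f by (auto simp: qspace_def ennreal_mult_less_top)
  with Kfun_le[OF f] show ?thesis by (rule le_less_trans)
qed

lemma Kfun_outside: "f \<notin> sum_space N0 N1 \<Longrightarrow> Kfun N0 N1 t f = top"
proof -
  assume "f \<notin> sum_space N0 N1"
  then have e: "{N0 f0 + ennreal t * N1 f1 |f0 f1. f0 \<in> qspace N0 \<and> f1 \<in> qspace N1 \<and> f = f0 + f1} = {}"
    by (auto simp: sum_space_def)
  show ?thesis unfolding Kfun_def e by simp
qed

lemma Kfun_subadd:
  assumes "quasi_norm N0" "quasi_norm N1"
  obtains C where "1 \<le> C" "\<And>t f g. Kfun N0 N1 t (f + g) \<le> ennreal C * (Kfun N0 N1 t f + Kfun N0 N1 t g)"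
proof -
  obtain C0 where C0: "1 \<le> C0" "\<And>f g. N0 (f + g) \<le> ennreal C0 * (N0 f + N0 g)"
    using quasi_norm_add[OF assms(1)] by blast
  obtain C1 where C1: "1 \<le> C1" "\<And>f g. N1 (f + g) \<le> ennreal C1 * (N1 f + N1 g)"
    using quasi_norm_add[OF assms(2)] by blast
  define C where "C = max C0 C1"
  have C: "1 \<le> C" using C0 by (simp add: C_def)
  have N: "N0 (f + g) \<le> ennreal C * (N0 f + N0 g)" "N1 (f + g) \<le> ennreal C * (N1 f + N1 g)" for f g
    by (rule order_trans[OF C0(2) mult_right_mono], auto simp: C_def intro: ennreal_leI)
       (rule order_trans[OF C1(2) mult_right_mono], auto simp: C_def intro: ennreal_leI)
  have q: "f + g \<in> qspace N0" if "f \<in> qspace N0" "g \<in> qspace N0" for f g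
    using le_less_trans[OF N(1)[of f g]] that by (auto simp: qspace_def ennreal_mult_less_top)
  have q': "f + g \<in> qspace N1" if "f \<in> qspace N1" "g \<in> qspace N1" for f g
    using le_less_trans[OF N(2)[of f g]] that by (auto simp: qspace_def ennreal_mult_less_top)
  show ?thesis
  proof (rule that[OF C])
    fix t f g
    let ?A = "\<lambda>f. {N0 f0 + ennreal t * N1 f1 |f0 f1. f0 \<in> qspace N0 \<and> f1 \<in> qspace N1 \<and> f = f0 + f1}"
    have cc: "ennreal (1 / C) * ennreal C = 1" "ennreal C * ennreal (1 / C) = 1"
      using C by (auto simp flip: ennreal_mult'')
    have "ennreal (1 / C) * Kfun N0 N1 t (f + g) \<le> Inf (?A f) + Inf (?A g)"
    proof (rule le_Inf_add_Inf)
      fix x y assume "x \<in> ?A f" "y \<in> ?A g"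
      then obtain f0 f1 g0 g1 where f: "x = N0 f0 + ennreal t * N1 f1" "f0 \<in> qspace N0" "f1 \<in> qspace N1" "f = f0 + f1"
        and g: "y = N0 g0 + ennreal t * N1 g1" "g0 \<in> qspace N0" "g1 \<in> qspace N1" "g = g0 + g1" by blast
      have "Kfun N0 N1 t (f + g) \<le> N0 (f0 + g0) + ennreal t * N1 (f1 + g1)"
        using f g by (intro Kfun_le q q') auto
      also have "\<dots> \<le> ennreal C * (N0 f0 + N0 g0) + ennreal t * (ennreal C * (N1 f1 + N1 g1))"
        by (intro add_mono mult_left_mono N) auto
      also have "\<dots> = ennreal C * (x + y)" by (simp add: f(1) g(1) distrib_left ac_simps)
      finally have "ennreal (1 / C) * Kfun N0 N1 t (f + g) \<le> ennreal (1 / C) * (ennreal C * (x + y))"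
        by (intro mult_left_mono) auto
      then show "ennreal (1 / C) * Kfun N0 N1 t (f + g) \<le> x + y" by (simp add: mult.assoc[symmetric] cc)
    qed
    then have "ennreal (1 / C) * Kfun N0 N1 t (f + g) \<le> Kfun N0 N1 t f + Kfun N0 N1 t g"
      by (simp add: Kfun_def)
    then have "ennreal C * (ennreal (1 / C) * Kfun N0 N1 t (f + g)) \<le> ennreal C * (Kfun N0 N1 t f + Kfun N0 N1 t g)"
      by (intro mult_left_mono) auto
    then show "Kfun N0 N1 t (f + g) \<le> ennreal C * (Kfun N0 N1 t f + Kfun N0 N1 t g)"
      by (simp add: mult.assoc[symmetric] cc)
  qed
qed

text \<open>
  This is where the common Hausdorff topology enters: \<open>f\<close> is a sum of two vectors that are arbitrarily
  small in \<open>A0\<close> and \<open>A1\<close>, so it lies in every neighbourhood of 0. As a consequence, decompositions that are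
  optimal up to the factor 2 exist for every \<open>f \<noteq> 0\<close>.
\<close>

lemma Kfun_eq_0_imp:
  assumes "compatible_quasi_banach_couple A0 A1" "0 < t" "Kfun A0 A1 t f = 0"
  shows "f = 0"
proof (rule ccontr)
  assume f: "f \<noteq> 0"
  obtain T where T: "hausdorff_vector_topology T" "embeds_into_topology A0 T" "embeds_into_topology A1 T"
    using assms(1) unfolding compatible_quasi_banach_couple_def by blast
  then have top: "topspace T = UNIV" and H: "Hausdorff_space T"
    and cont: "continuous_map (prod_topology T T) T (\<lambda>(f, g). f + g)"
    unfolding hausdorff_vector_topology_def by auto
  obtain U V where UV: "openin T U" "openin T V" "f \<in> U" "0 \<in> V" "disjnt U V"
    using H[unfolded Hausdorff_space_def, rule_format, of f 0] f top by auto
  have "openin (prod_topology T T) {x \<in> topspace (prod_topology T T). (case x of (f, g) \<Rightarrow> f + g) \<in> V}"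
    by (rule openin_continuous_map_preimage[OF cont UV(2)])
  moreover have "(0, 0) \<in> {x \<in> topspace (prod_topology T T). (case x of (f, g) \<Rightarrow> f + g) \<in> V}"
    using UV(4) top by simp
  ultimately have "\<exists>W0 W1. openin T W0 \<and> openin T W1 \<and> 0 \<in> W0 \<and> 0 \<in> W1 \<and>
    W0 \<times> W1 \<subseteq> {x \<in> topspace (prod_topology T T). (case x of (f, g) \<Rightarrow> f + g) \<in> V}"
    by (rule openin_prod_topology_alt[THEN iffD1, rule_format])
  then obtain W0 W1 where W: "openin T W0" "openin T W1" "0 \<in> W0" "0 \<in> W1"
    "W0 \<times> W1 \<subseteq> {x \<in> topspace (prod_topology T T). (case x of (f, g) \<Rightarrow> f + g) \<in> V}"
    by (elim exE conjE) (rule that)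
  obtain e0 where e0: "0 < e0" "{f. A0 f < ennreal e0} \<subseteq> W0"
    using T(2) W(1,3) unfolding embeds_into_topology_def by blast
  obtain e1 where e1: "0 < e1" "{f. A1 f < ennreal e1} \<subseteq> W1"
    using T(3) W(2,4) unfolding embeds_into_topology_def by blast
  \<comment> \<open>Then \<open>A0 f0 + t A1 f1 < e\<close> gives \<open>A0 f0 < e0\<close> and \<open>A1 f1 < e1\<close>.\<close>
  define e where "e = min e0 (t * e1)"
  have "Kfun A0 A1 t f < ennreal e" using assms e0 e1 by (simp add: e_def)
  then obtain f0 f1 where f01: "A0 f0 + ennreal t * A1 f1 < ennreal e" "f = f0 + f1"
    unfolding Kfun_def Inf_less_iff by blast
  have "A0 f0 \<le> A0 f0 + ennreal t * A1 f1" "ennreal t * A1 f1 \<le> A0 f0 + ennreal t * A1 f1"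
    by (auto intro: add_increasing add_increasing2)
  then have l: "A0 f0 < ennreal e" "ennreal t * A1 f1 < ennreal e" using f01(1) le_less_trans by blast+
  have "ennreal e \<le> ennreal e0" "ennreal e \<le> ennreal (t * e1)" by (auto simp: e_def intro!: ennreal_leI)
  then have l2: "A0 f0 < ennreal e0" "ennreal t * A1 f1 < ennreal t * ennreal e1"
    using l assms(2) e1(1) by (auto intro: less_le_trans simp: ennreal_mult)
  have "A1 f1 < ennreal e1"
  proof (rule ccontr)
    assume "\<not> ?thesis"
    then have "ennreal t * ennreal e1 \<le> ennreal t * A1 f1" by (intro mult_left_mono) auto
    with l2(2) show False by simp
  qed
  then have "f0 \<in> W0" "f1 \<in> W1" using l2 e0 e1 by auto
  then have "f \<in> V" using W(5) f01(2) by auto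
  then show False using UV by (auto simp: disjnt_def)
qed

text \<open>
  Take \<open>f0\<close>, \<open>f1\<close> with \<open>A0 f0 + t A1 f1 < 2 K(t,f)\<close>. This bounds \<open>K(u,f0)\<close> by \<open>2 K(t,f)\<close> and \<open>K(u,f1)\<close> by
  \<open>2 (u/t) K(t,f)\<close> for all \<open>u\<close>. The bounds by \<open>K(u,f)\<close> follow from \<open>f0 = f - f1\<close> below \<open>t\<close> and
  \<open>f1 = f - f0\<close> above \<open>t\<close>, where the subtracted part is already under control.
\<close>

lemma near_optimal_decomposition:
  assumes "compatible_quasi_banach_couple A0 A1"
  obtains D where "1 \<le> D"
    "\<And>f t. f \<in> sum_space A0 A1 \<Longrightarrow> f \<noteq> 0 \<Longrightarrow> 0 < t \<Longrightarrow> \<exists>f0\<in>qspace A0. \<exists>f1\<in>qspace A1. f = f0 + f1 \<and>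
      (\<forall>u. 0 < u \<and> u \<le> t \<longrightarrow> Kfun A0 A1 u f0 \<le> ennreal D * Kfun A0 A1 u f) \<and>
      (\<forall>u. Kfun A0 A1 u f0 \<le> ennreal D * Kfun A0 A1 t f) \<and>
      (\<forall>u. Kfun A0 A1 u f1 \<le> ennreal D * (ennreal (u / t) * Kfun A0 A1 t f)) \<and>
      (\<forall>u\<ge>t. Kfun A0 A1 u f1 \<le> ennreal D * Kfun A0 A1 u f)"
proof -
  have q: "quasi_norm A0" "quasi_norm A1"
    using assms by (auto simp: compatible_quasi_banach_couple_def quasi_banach_def)
  obtain C where C: "1 \<le> C" "\<And>t f g. Kfun A0 A1 t (f + g) \<le> ennreal C * (Kfun A0 A1 t f + Kfun A0 A1 t g)"
    using Kfun_subadd[OF q] by blast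
  show ?thesis
  proof (rule that[of "C * 3"])
    fix f t assume f: "f \<in> sum_space A0 A1" "f \<noteq> 0" and t: "0 < (t::real)"
    let ?K = "Kfun A0 A1"
    have "?K t f \<noteq> 0" using Kfun_eq_0_imp[OF assms t] f by blast
    moreover have "?K t f < top" using Kfun_finite[OF f(1)] .
    ultimately have "?K t f < 2 * ?K t f"
      by (simp add: mult_2 ennreal_add_left_cancel_less[of _ 0, simplified] zero_less_iff_neq_zero)
    then obtain f0 f1 where f01: "f0 \<in> qspace A0" "f1 \<in> qspace A1" "f = f0 + f1"
      "A0 f0 + ennreal t * A1 f1 < 2 * ?K t f"
      unfolding Kfun_def[of _ _ t f] Inf_less_iff by blast
    have "A0 f0 \<le> A0 f0 + ennreal t * A1 f1" "ennreal t * A1 f1 \<le> A0 f0 + ennreal t * A1 f1"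
      by (auto intro: add_increasing add_increasing2)
    then have n: "A0 f0 \<le> ennreal 2 * ?K t f" "ennreal t * A1 f1 \<le> ennreal 2 * ?K t f"
      by (simp_all add: order_trans[OF _ less_imp_le[OF f01(4)]])
    have 2: "ennreal 2 \<le> ennreal (C * 3)" using C(1) by (intro ennreal_leI) simp
    have f0: "?K u f0 \<le> ennreal 2 * ?K t f" for u
      using Kfun_le_left[OF q(2) f01(1)] n(1) by (rule order_trans)
    have neg: "ennreal u * A1 f1 \<le> ennreal 2 * (ennreal (u / t) * ?K t f)" for u
    proof -
      have "ennreal u * A1 f1 = ennreal (u / t) * (ennreal t * A1 f1)"
        using t by (simp flip: mult.assoc ennreal_mult'')
      also have "\<dots> \<le> ennreal (u / t) * (ennreal 2 * ?K t f)" by (intro mult_left_mono n) auto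
      finally show ?thesis by (simp only: mult.left_commute)
    qed
    have f1: "?K u f1 \<le> ennreal 2 * (ennreal (u / t) * ?K t f)" for u
      using Kfun_le_right[OF q(1) f01(2)] neg by (rule order_trans)
    have three: "x \<le> ennreal (C * 3) * y" if "x \<le> ennreal C * (y + z)" "z \<le> ennreal 2 * y" for x y z
    proof -
      have "x \<le> ennreal C * (y + ennreal 2 * y)" using that(1) by (rule order_trans) (intro mult_left_mono add_mono that; simp)
      also have "y + ennreal 2 * y = ennreal 3 * y"
      proof -
        have "ennreal 3 = ennreal 1 + ennreal 2" by (subst ennreal_plus[symmetric]) auto
        then show ?thesis by (simp add: distrib_right del: ennreal_numeral)
      qed
      finally show ?thesis using C(1) by (subst ennreal_mult) (auto simp: mult.assoc)
    qed
    have 1: "?K u f0 \<le> ennreal (C * 3) * ?K u f" if u: "0 < u" "u \<le> t" for u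
    proof (rule three)
      have "?K u (f + - f1) \<le> ennreal C * (?K u f + ?K u (- f1))" by (rule C(2))
      then show "?K u f0 \<le> ennreal C * (?K u f + ?K u (- f1))" using f01(3) by simp
      have m: "- f1 \<in> qspace A1" using f01(2) by (simp add: qspace_def quasi_norm_uminus[OF q(2)])
      have "?K u (- f1) \<le> ennreal u * A1 f1"
        using Kfun_le_right[OF q(1) m, of u] by (simp add: quasi_norm_uminus[OF q(2)])
      also have "\<dots> \<le> ennreal 2 * (ennreal (u / t) * ?K t f)" by (rule neg)
      also have "\<dots> \<le> ennreal 2 * (ennreal (u / t) * (ennreal (t / u) * ?K u f))"
        by (intro mult_left_mono Kfun_scale u) auto
      also have "ennreal (u / t) * (ennreal (t / u) * ?K u f) = ?K u f"
        using u t by (simp flip: mult.assoc ennreal_mult'')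
      finally show "?K u (- f1) \<le> ennreal 2 * ?K u f" .
    qed
    have 4: "?K u f1 \<le> ennreal (C * 3) * ?K u f" if u: "t \<le> u" for u
    proof (rule three)
      have "?K u (f + - f0) \<le> ennreal C * (?K u f + ?K u (- f0))" by (rule C(2))
      then show "?K u f1 \<le> ennreal C * (?K u f + ?K u (- f0))" using f01(3) by simp
      have m: "- f0 \<in> qspace A0" using f01(1) by (simp add: qspace_def quasi_norm_uminus[OF q(1)])
      have "?K u (- f0) \<le> A0 f0"
        using Kfun_le_left[OF q(2) m, of u] by (simp add: quasi_norm_uminus[OF q(1)])
      also have "\<dots> \<le> ennreal 2 * ?K t f" by (rule n)
      also have "\<dots> \<le> ennreal 2 * ?K u f" by (intro mult_left_mono Kfun_mono u) auto
      finally show "?K u (- f0) \<le> ennreal 2 * ?K u f" .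
    qed
    show "\<exists>f0\<in>qspace A0. \<exists>f1\<in>qspace A1. f = f0 + f1 \<and>
      (\<forall>u. 0 < u \<and> u \<le> t \<longrightarrow> ?K u f0 \<le> ennreal (C * 3) * ?K u f) \<and>
      (\<forall>u. ?K u f0 \<le> ennreal (C * 3) * ?K t f) \<and>
      (\<forall>u. ?K u f1 \<le> ennreal (C * 3) * (ennreal (u / t) * ?K t f)) \<and>
      (\<forall>u\<ge>t. ?K u f1 \<le> ennreal (C * 3) * ?K u f)"
    proof (intro bexI conjI allI impI)
      show "?K u f0 \<le> ennreal (C * 3) * ?K t f" for u
        using f0[of u] mult_right_mono[OF 2] by (rule order_trans) simp
      show "?K u f1 \<le> ennreal (C * 3) * (ennreal (u / t) * ?K t f)" for u
        using f1[of u] mult_right_mono[OF 2] by (rule order_trans) simp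
    qed (use 1 4 f01 in auto)
  qed (use C in simp)
qed

section \<open>A Holmstedt formula\<close>

lemma le_cmult_div:
  assumes "0 < c" "x \<le> ennreal (1 / c) * y"
  shows "ennreal c * x \<le> y"
proof -
  have "ennreal c * x \<le> ennreal c * (ennreal (1 / c) * y)" using assms by (intro mult_left_mono) auto
  also have "\<dots> = y" using assms by (simp flip: mult.assoc ennreal_mult'')
  finally show ?thesis .
qed

lemma ennreal_pos_mult_top: "0 < c \<Longrightarrow> ennreal c * top = top"
  by (simp add: ennreal_mult_top)

lemma ennreal_triple: "x + x + x = ennreal 3 * x"
proof -
  have "(3::ennreal) = 1 + 1 + 1" by simp
  then have "3 * x = (1 + 1 + 1) * x" by simp
  then show ?thesis by (simp only: distrib_right mult_1_left ennreal_numeral)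
qed

definition quasiconcave :: "(real \<Rightarrow> ennreal) \<Rightarrow> bool" where
  "quasiconcave k \<longleftrightarrow> (\<forall>u v. 0 < u \<longrightarrow> u \<le> v \<longrightarrow> k u \<le> k v \<and> k v \<le> ennreal (v / u) * k u) \<and> (\<forall>u>0. k u < top)"

lemma quasiconcave_mono: "quasiconcave k \<Longrightarrow> 0 < u \<Longrightarrow> u \<le> v \<Longrightarrow> k u \<le> k v"
  and quasiconcave_scale: "quasiconcave k \<Longrightarrow> 0 < u \<Longrightarrow> u \<le> v \<Longrightarrow> k v \<le> ennreal (v / u) * k u"
  and quasiconcave_finite: "quasiconcave k \<Longrightarrow> 0 < u \<Longrightarrow> k u < top"
  unfolding quasiconcave_def by blast+

lemma quasiconcave_meas: "quasiconcave k \<Longrightarrow> meas k"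
  by (rule meas_mono) (rule quasiconcave_mono)

lemma quasiconcave_Kfun: "f \<in> sum_space N0 N1 \<Longrightarrow> quasiconcave (\<lambda>u. Kfun N0 N1 u f)"
  unfolding quasiconcave_def using Kfun_mono Kfun_scale Kfun_finite by blast

lemma wnorm_zero: "pos_set S \<Longrightarrow> 0 < q \<Longrightarrow> wnorm \<theta> q b S (\<lambda>_. 0) = 0"
  using wnorm_cmult_le[of S q 0 \<theta> b "\<lambda>_. 0"] by simp

text \<open>
  \<open>L0\<close> and \<open>L1\<close> are the functionals that define the spaces \<open>X0\<close> and \<open>X1\<close> of the couple to be interpolated.
\<close>

locale holmstedt = L0: nested 0 r0 b0 q0 a0 + L1: nested 1 r1 b1 q1 a1
  for r0 b0 q0 a0 r1 b1 q1 a1 +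
  fixes A0 A1 :: "'a::real_vector \<Rightarrow> ennreal"
  assumes couple: "compatible_quasi_banach_couple A0 A1"
    and fin1: "wnorm 0 r1 b1 {1<..} (\<lambda>s. 1) < \<infinity>"
    and fin1': "wnorm 0 r1 b1 {0<..<1} (\<lambda>s. wnorm 0 q1 a1 {0<..<s} (\<lambda>u. 1)) < \<infinity>"
    and fin0: "wnorm 0 r0 b0 {1<..} (\<lambda>s. wnorm 0 q0 a0 {1<..<s} (\<lambda>u. 1)) < \<infinity>"
begin

definition E0 :: "real \<Rightarrow> ennreal" where
  "E0 t = wnorm 0 r0 b0 {t<..} (\<lambda>s. wnorm 0 q0 a0 {t<..<s} (\<lambda>u. 1))"

definition E1 :: "real \<Rightarrow> ennreal" where
  "E1 t = wnorm 0 r1 b1 {0<..<t} (\<lambda>s. wnorm 0 q1 a1 {0<..<s} (\<lambda>u. 1))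
        + wnorm 0 r1 b1 {t<..} (\<lambda>s. 1) * wnorm 0 q1 a1 {0<..<t} (\<lambda>u. 1)"

definition chi0 :: "real \<Rightarrow> real" where "chi0 t = enn2real (E0 t)"
definition chi1 :: "real \<Rightarrow> real" where "chi1 t = enn2real (E1 t)"
definition rho :: "real \<Rightarrow> real" where "rho t = t * (chi0 t / chi1 t)"

lemma E0_high: "E0 t = L0.high t (\<lambda>_. 1)"
  by (simp add: E0_def L0.high_def)

text \<open>
  The function \<open>\<chi>\<^sub>1(t)\<close> arises when the constant function \<open>K(t)/t\<close> is inserted for \<open>K(u)/u\<close> below
  \<open>t\<close> in the norm of \<open>X1\<close>, just as \<open>\<chi>\<^sub>0(t)\<close> arises from \<open>K(u) = K(t)\<close> above \<open>t\<close> in that of \<open>X0\<close>.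
\<close>

lemma E1_low_mid: "E1 t = L1.low t (\<lambda>u. ennreal u) + L1.mid t (\<lambda>u. ennreal u)"
  unfolding E1_def L1.low_def L1.mid_def L1.tail_def using L1.q by (simp add: wnorm_Id)

lemma E0_tame: "0 < e \<Longrightarrow> \<exists>D. 1 \<le> D \<and> tame D e E0"
  unfolding E0_def[abs_def]
  by (rule nested_tame_aux[OF L0.r L0.b L0.q L0.a, of e "\<lambda>t. {t<..}" "\<lambda>t. t"]) auto

lemma E0_one: "E0 1 < top" "0 < E0 1"
proof -
  show "E0 1 < top" using fin0 by (simp add: E0_def)
  obtain C where C: "0 < C" "\<And>t. 0 < t \<Longrightarrow> ennreal (a0 t) * wnorm 0 r0 b0 {t<..} (\<lambda>_. 1) \<le>
     ennreal C * wnorm 0 r0 b0 {t<..} (\<lambda>s. wnorm 0 q0 a0 {t<..<s} (\<lambda>_. 1))"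
    using weight_tail_le_nested[OF L0.r L0.b L0.q weight_slow[OF L0.a]] by blast
  have "0 < wnorm 0 r0 b0 {1<..} (\<lambda>_. 1)"
    by (rule wnorm_one_pos[OF L0.r weight_slow[OF L0.b], of _ 1]) auto
  then have "0 < ennreal (a0 1) * wnorm 0 r0 b0 {1<..} (\<lambda>_. 1)"
    using slow_pos[OF weight_slow[OF L0.a], of 1] by (simp add: ennreal_zero_less_mult_iff)
  also have "\<dots> \<le> ennreal C * E0 1" unfolding E0_def by (rule C(2)) simp
  finally show "0 < E0 1" by (auto simp: zero_less_iff_neq_zero)
qed

lemma E0_props:
  "0 < t \<Longrightarrow> E0 t < top" "slow (\<lambda>t. enn2real (E0 t))"
  using slow_enn2real(1,3)[OF E0_tame E0_one] by blast+

lemma E1_tame: "0 < e \<Longrightarrow> \<exists>D. 1 \<le> D \<and> tame D e E1"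
proof -
  assume e: "0 < e"
  then have e2: "0 < e / 2" by simp
  obtain D1 where D1: "1 \<le> D1" "tame D1 e (\<lambda>t. wnorm 0 r1 b1 {0<..<t} (\<lambda>s. wnorm 0 q1 a1 {0<..<s} (\<lambda>_. 1)))"
    by (rule nested_tame_aux[OF L1.r L1.b L1.q L1.a e, of "\<lambda>t. {0<..<t}" "\<lambda>t. 0"])
      (auto simp: zero_less_mult_iff)
  obtain D2 where D2: "1 \<le> D2" "tame D2 (e / 2) (\<lambda>t. wnorm 0 r1 b1 {t<..} (\<lambda>_. 1))"
    using tail_tame[OF L1.r L1.b e2] by blast
  obtain D3 where D3: "1 \<le> D3" "tame D3 (e / 2) (\<lambda>t. wnorm 0 q1 a1 {0<..<t} (\<lambda>_. 1))"
    using head_tame[OF L1.q L1.a e2] by blast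
  have "tame (D2 * D3) (e / 2 + e / 2) (\<lambda>t. wnorm 0 r1 b1 {t<..} (\<lambda>_. 1) * wnorm 0 q1 a1 {0<..<t} (\<lambda>_. 1))"
    using D2 D3 by (intro tame_mult) auto
  then have "tame (D2 * D3) e (\<lambda>t. wnorm 0 r1 b1 {t<..} (\<lambda>_. 1) * wnorm 0 q1 a1 {0<..<t} (\<lambda>_. 1))"
    by simp
  with D1(2) have "tame (max D1 (D2 * D3)) e E1"
    unfolding E1_def[abs_def] using D1 D2 D3 by (intro tame_add) auto
  moreover have "1 \<le> max D1 (D2 * D3)" using D1 by simp
  ultimately show ?thesis by blast
qed

text \<open>
  Only nested norms are assumed to be finite. The inner norm over \<open>(0,1/2)\<close> is recovered from the outer one
  over \<open>(1/2,1)\<close>, on which the inner norm is at least this large.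
\<close>

lemma E1_one: "E1 1 < top" "0 < E1 1"
proof -
  obtain C where C: "0 < C" "\<And>S t c g. pos_set S \<Longrightarrow> 0 < t \<Longrightarrow> {t<..<2*t} \<subseteq> S \<Longrightarrow>
    (\<And>u. t < u \<Longrightarrow> u < 2 * t \<Longrightarrow> c \<le> g u) \<Longrightarrow> ennreal (t powr (- 0) * b1 t) * c \<le> ennreal C * wnorm 0 r1 b1 S g"
    using wnorm_lower[OF L1.r weight_slow[OF L1.b], of 0] by blast
  let ?h = "\<lambda>t. wnorm 0 q1 a1 {0<..<t} (\<lambda>u. 1)"
  have "ennreal ((1/2) powr (- 0) * b1 (1/2)) * ?h (1/2) \<le> ennreal C * wnorm 0 r1 b1 {0<..<1} (\<lambda>s. ?h s)"
    by (rule C(2)) (auto intro!: wnorm_mono_set L1.q)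
  also have "\<dots> < top" using fin1' by (simp add: ennreal_mult_less_top)
  finally have h2: "?h (1/2) < top"
    using slow_pos[OF weight_slow[OF L1.b], of "1/2"] by (auto simp: ennreal_mult_less_top)
  obtain D where D: "1 \<le> D" "tame D 1 ?h"
    using head_tame[OF L1.q L1.a, of 1] zero_less_one by blast
  have "?h 1 \<le> ennreal (D * spread 1 (1/2) powr 1) * ?h (1/2)"
    by (rule tameD[OF D(2)]) auto
  also have "\<dots> < top" using h2 by (simp add: ennreal_mult_less_top)
  finally have h1: "?h 1 < top" .
  then show "E1 1 < top" using fin1 fin1' by (simp add: E1_def ennreal_mult_less_top)
  have "0 < wnorm 0 r1 b1 {1<..} (\<lambda>_. 1)"
    by (rule wnorm_one_pos[OF L1.r weight_slow[OF L1.b], of _ 1]) auto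
  moreover have "0 < ?h 1"
    by (rule wnorm_one_pos[OF L1.q weight_slow[OF L1.a], of _ "1/2"]) auto
  ultimately have "0 < wnorm 0 r1 b1 {1<..} (\<lambda>s. 1) * ?h 1" by (simp add: ennreal_zero_less_mult_iff)
  then show "0 < E1 1" unfolding E1_def by (simp add: add_pos_nonneg zero_less_iff_neq_zero)
qed

lemma E1_props:
  "0 < t \<Longrightarrow> E1 t < top" "slow (\<lambda>t. enn2real (E1 t))"
  using slow_enn2real(1,3)[OF E1_tame E1_one] by blast+

lemma slow_chi: "slow chi0" "slow chi1"
  using E0_props(2) E1_props(2) by (simp_all add: chi0_def[abs_def] chi1_def[abs_def])

lemma chi_pos: "0 < t \<Longrightarrow> 0 < chi0 t" "0 < t \<Longrightarrow> 0 < chi1 t" "0 < t \<Longrightarrow> 0 < rho t"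
  using slow_chi slow_pos by (auto simp: rho_def)

lemma ennreal_chi0: "0 < t \<Longrightarrow> ennreal (chi0 t) = L0.high t (\<lambda>_. 1)"
  using E0_props(1)[of t] by (simp add: chi0_def E0_high)

lemma ennreal_chi1: "0 < t \<Longrightarrow> ennreal (chi1 t) = L1.low t (\<lambda>u. ennreal u) + L1.mid t (\<lambda>u. ennreal u)"
  using E1_props(1)[of t] by (simp add: chi1_def E1_low_mid)

lemma weight_tail_le_chi0:
  obtains C where "0 < C" "\<And>t. 0 < t \<Longrightarrow> ennreal (a0 t) * L0.tail t \<le> ennreal (C * chi0 t)"
proof -
  obtain C where C: "0 < C" "\<And>t. 0 < t \<Longrightarrow> ennreal (a0 t) * wnorm 0 r0 b0 {t<..} (\<lambda>_. 1) \<le>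
     ennreal C * wnorm 0 r0 b0 {t<..} (\<lambda>s. wnorm 0 q0 a0 {t<..<s} (\<lambda>_. 1))"
    using weight_tail_le_nested[OF L0.r L0.b L0.q weight_slow[OF L0.a]] by blast
  show ?thesis
    by (rule that[OF C(1)]) (use C in \<open>simp add: ennreal_chi0 L0.high_def L0.tail_def ennreal_mult'\<close>)
qed

lemma weight_tail_le_chi1:
  obtains C where "0 < C" "\<And>t. 0 < t \<Longrightarrow> ennreal (a1 t) * L1.tail t \<le> ennreal (C * chi1 t)"
proof -
  obtain C where C: "0 < C" "\<And>t. 0 < t \<Longrightarrow> ennreal (a1 t) \<le> ennreal C * wnorm 0 q1 a1 {0<..<t} (\<lambda>_. 1)"
    using weight_le_head[OF L1.q weight_slow[OF L1.a]] by blast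
  show ?thesis
  proof (rule that[OF C(1)])
    fix t :: real assume t: "0 < t"
    have "ennreal (a1 t) * L1.tail t \<le> (ennreal C * wnorm 0 q1 a1 {0<..<t} (\<lambda>_. 1)) * L1.tail t"
      by (intro mult_right_mono C t) auto
    also have "\<dots> = ennreal C * (wnorm 0 r1 b1 {t<..} (\<lambda>s. 1) * wnorm 0 q1 a1 {0<..<t} (\<lambda>u. 1))"
      by (simp add: L1.tail_def mult_ac)
    also have "\<dots> \<le> ennreal C * E1 t"
      unfolding E1_def by (intro mult_left_mono) (auto intro: add_increasing)
    also have "\<dots> = ennreal (C * chi1 t)"
      using C(1) E1_props(1)[OF t] by (simp add: chi1_def ennreal_mult')
    finally show "ennreal (a1 t) * L1.tail t \<le> ennreal (C * chi1 t)" .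
  qed
qed

lemma tail0_finite: "0 < t \<Longrightarrow> L0.tail t < top"
proof -
  assume t: "0 < t"
  obtain C where C: "0 < C" "\<And>t. 0 < t \<Longrightarrow> ennreal (a0 t) * L0.tail t \<le> ennreal (C * chi0 t)"
    using weight_tail_le_chi0 by blast
  have "ennreal (a0 t) * L0.tail t < top" using C(2)[OF t] by (rule le_less_trans) simp
  then show ?thesis using slow_pos[OF weight_slow[OF L0.a] t] by (auto simp: ennreal_mult_less_top)
qed

lemma meas_chi: "meas (\<lambda>t. ennreal (chi0 t))" "meas (\<lambda>t. ennreal (chi1 t))"
proof -
  show "meas (\<lambda>t. ennreal (chi0 t))"
    by (rule meas_antimono) (simp add: ennreal_chi0 L0.high_decreasing)
  have "meas (\<lambda>t. L1.low t (\<lambda>u. ennreal u) + L1.mid t (\<lambda>u. ennreal u))"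
    by (intro borel_measurable_add L1.meas_parts)
  moreover have "meas (\<lambda>t. L1.low t (\<lambda>u. ennreal u) + L1.mid t (\<lambda>u. ennreal u)) \<longleftrightarrow> meas (\<lambda>t. ennreal (chi1 t))"
    by (rule measurable_cong) (simp add: ennreal_chi1)
  ultimately show "meas (\<lambda>t. ennreal (chi1 t))" by blast
qed

text \<open>
  Above \<open>t\<close> the function \<open>k\<close> is at least \<open>k t\<close>.
\<close>

lemma chi0_le_full:
  assumes "quasiconcave k" "0 < t"
  shows "ennreal (chi0 t) * k t \<le> L0.full k"
proof -
  obtain c where c: "k t = ennreal c" "0 \<le> c" using quasiconcave_finite[OF assms] by (cases "k t") auto
  show ?thesis
  proof (cases "c = 0")
    case False
    then have c': "0 < c" using c by simp
    have "L0.high t (\<lambda>_. 1) \<le> L0.high t (\<lambda>u. ennreal (1 / c) * k u)"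
    proof (rule L0.high_mono[OF assms(2)])
      fix u assume "t < u"
      then have "ennreal c \<le> k u" using quasiconcave_mono[OF assms, of u] c by simp
      then have "ennreal (1 / c) * ennreal c \<le> ennreal (1 / c) * k u" by (intro mult_left_mono) auto
      then show "1 \<le> ennreal (1 / c) * k u" using c' by (simp flip: ennreal_mult'')
    qed
    also have "\<dots> \<le> ennreal (1 / c) * L0.high t k" using c' assms by (intro L0.high_cmult_le) auto
    also have "\<dots> \<le> ennreal (1 / c) * L0.full k" using assms by (intro mult_left_mono L0.high_le_full) auto
    finally have "ennreal c * L0.high t (\<lambda>_. 1) \<le> L0.full k" by (rule le_cmult_div[OF c'])
    then show ?thesis using assms by (simp add: ennreal_chi0 c mult.commute)
  qed (use c in simp)
qed

text \<open>
  Below \<open>t\<close> the function \<open>k u / u\<close> is at least \<open>k t / t\<close>; the factor 2 collects the two summands of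
  \<open>\<chi>\<^sub>1\<close>.
\<close>

lemma chi1_le_full:
  assumes "quasiconcave k" "0 < t"
  shows "ennreal (chi1 t / t) * k t \<le> ennreal 2 * L1.full k"
proof -
  obtain c where c: "k t = ennreal c" "0 \<le> c" using quasiconcave_finite[OF assms] by (cases "k t") auto
  show ?thesis
  proof (cases "c = 0")
    case False
    then have c': "0 < c / t" using c assms by simp
    have le: "ennreal u \<le> ennreal (1 / (c / t)) * k u" if u: "0 < u" "u < t" for u
    proof -
      have "ennreal u = ennreal (u / c) * ennreal c" using False c u by (simp flip: ennreal_mult'')
      also have "\<dots> \<le> ennreal (u / c) * (ennreal (t / u) * k u)"
        using quasiconcave_scale[OF assms(1) u(1), of t] u c by (intro mult_left_mono) auto
      also have "\<dots> = ennreal (u / c * (t / u)) * k u"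
        using u assms(2) by (simp only: mult.assoc ennreal_mult''[of "t / u" "u / c"] divide_nonneg_nonneg less_imp_le)
      also have "u / c * (t / u) = 1 / (c / t)" using u by simp
      finally show ?thesis .
    qed
    have "L1.low t (\<lambda>u. ennreal u) + L1.mid t (\<lambda>u. ennreal u) \<le>
        L1.low t (\<lambda>u. ennreal (1 / (c / t)) * k u) + L1.mid t (\<lambda>u. ennreal (1 / (c / t)) * k u)"
      by (intro add_mono L1.low_mono L1.mid_mono le)
    also have "\<dots> \<le> ennreal (1 / (c / t)) * L1.low t k + ennreal (1 / (c / t)) * L1.mid t k"
      by (intro add_mono L1.low_cmult_le L1.mid_cmult_le) (use c' in \<open>simp_all only: zero_le_divide_1_iff less_imp_le\<close>)
    also have "\<dots> \<le> ennreal (1 / (c / t)) * L1.full k + ennreal (1 / (c / t)) * L1.full k"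
      using assms by (intro add_mono mult_left_mono L1.low_le_full L1.mid_le_full) auto
    also have "\<dots> = ennreal (1 / (c / t)) * (ennreal 2 * L1.full k)"
      by (simp add: mult_2 distrib_left)
    finally have "ennreal (c / t) * ennreal (chi1 t) \<le> ennreal 2 * L1.full k"
      unfolding ennreal_chi1[OF assms(2), symmetric] by (rule le_cmult_div[OF c'])
    also have "ennreal (c / t) * ennreal (chi1 t) = ennreal (chi1 t / t) * k t"
      using chi_pos(2)[OF assms(2)] assms(2) c by (simp add: mult_ac flip: ennreal_mult' ennreal_mult'')
    finally show ?thesis .
  qed (use c in simp)
qed

text \<open>
  Used twice: with \<open>x = 1\<close>, \<open>l = 1/\<chi>\<^sub>1\<close> for elements of \<open>X1\<close>, and with a power below \<open>\<theta>\<close> in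
  the Hardy-type inequality.
\<close>

lemma low_mid_bound:
  assumes "slow l" "0 < x"
  obtains C where "0 < C" "\<And>t Z k. 0 < t \<Longrightarrow> (\<And>u. 0 < u \<Longrightarrow> u < t \<Longrightarrow> k u \<le> Z * ennreal (u powr x * l u)) \<Longrightarrow>
    L0.low t k + L0.mid t k \<le> ennreal C * (Z * ennreal (t powr x * l t * chi0 t))"
proof -
  obtain C1 where C1: "0 < C1" "\<And>t. 0 < t \<Longrightarrow>
    L0.low t (\<lambda>u. ennreal (u powr x * l u)) + L0.mid t (\<lambda>u. ennreal (u powr x * l u)) \<le>
      ennreal (C1 * (t powr (x - 0) * (a0 t * l t))) * L0.tail t"
    using L0.low_mid_power[OF assms] by blast
  obtain C2 where C2: "0 < C2" "\<And>t. 0 < t \<Longrightarrow> ennreal (a0 t) * L0.tail t \<le> ennreal (C2 * chi0 t)"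
    using weight_tail_le_chi0 by blast
  have C: "0 < C1 * C2" using C1 C2 by simp
  show ?thesis
  proof (rule that[OF C])
    fix t Z k assume t: "(0::real) < t" and k: "\<And>u. 0 < u \<Longrightarrow> u < t \<Longrightarrow> k u \<le> Z * ennreal (u powr x * l u)"
    have l: "0 < l t" "0 < a0 t" using slow_pos[OF assms(1) t] slow_pos[OF weight_slow[OF L0.a] t] by auto
    show "L0.low t k + L0.mid t k \<le> ennreal (C1 * C2) * (Z * ennreal (t powr x * l t * chi0 t))"
    proof (cases Z)
      case top
      have "Z * ennreal (t powr x * l t * chi0 t) = top"
        using top t l chi_pos[OF t] by (simp add: ennreal_top_mult)
      then show ?thesis by (simp only: ennreal_pos_mult_top[OF C] top_greatest)
    next
      case (real z)
      let ?g = "\<lambda>u. ennreal (u powr x * l u)"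
      have "L0.low t k + L0.mid t k \<le> L0.low t (\<lambda>u. ennreal z * ?g u) + L0.mid t (\<lambda>u. ennreal z * ?g u)"
        using k real by (intro add_mono L0.low_mono L0.mid_mono) auto
      also have "\<dots> \<le> ennreal z * L0.low t ?g + ennreal z * L0.mid t ?g"
        using real by (intro add_mono L0.low_cmult_le L0.mid_cmult_le) auto
      also have "\<dots> = ennreal z * (L0.low t ?g + L0.mid t ?g)" by (simp add: distrib_left)
      also have "\<dots> \<le> ennreal z * (ennreal (C1 * (t powr (x - 0) * (a0 t * l t))) * L0.tail t)"
        by (intro mult_left_mono C1 t) auto
      also have "ennreal (C1 * (t powr (x - 0) * (a0 t * l t))) = ennreal (C1 * (t powr x * l t)) * ennreal (a0 t)"
        using C1(1) l by (subst ennreal_mult'[symmetric]) (auto simp: mult_ac)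
      also have "ennreal (C1 * (t powr x * l t)) * ennreal (a0 t) * L0.tail t =
          ennreal (C1 * (t powr x * l t)) * (ennreal (a0 t) * L0.tail t)"
        by (rule mult.assoc)
      also have "ennreal z * \<dots> \<le> ennreal z * (ennreal (C1 * (t powr x * l t)) * ennreal (C2 * chi0 t))"
        by (intro mult_left_mono C2 t) auto
      also have "ennreal (C1 * (t powr x * l t)) * ennreal (C2 * chi0 t) = ennreal (C1 * C2) * ennreal (t powr x * l t * chi0 t)"
        using C1(1) C2(1) l chi_pos[OF t] by (simp add: mult_ac flip: ennreal_mult' ennreal_mult'')
      also have "ennreal z * \<dots> = ennreal (C1 * C2) * (Z * ennreal (t powr x * l t * chi0 t))"
        by (simp only: real mult_ac)
      finally show ?thesis .
    qed
  qed
qed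

text \<open>
  The counterpart of \<open>low_mid_bound\<close>: used with \<open>x = 0\<close>, \<open>l = 1/\<chi>\<^sub>0\<close> for elements of \<open>X0\<close>, and with
  a power above \<open>\<theta>\<close> in the Hardy-type inequality.
\<close>

lemma high_bound:
  assumes "slow l" "x < 1"
  obtains C where "0 < C" "\<And>t Z k. 0 < t \<Longrightarrow> (\<And>u. t < u \<Longrightarrow> k u \<le> Z * ennreal (u powr x * l u)) \<Longrightarrow>
    L1.high t k \<le> ennreal C * (Z * ennreal (t powr (x - 1) * l t * chi1 t))"
proof -
  obtain C1 where C1: "0 < C1" "\<And>t. 0 < t \<Longrightarrow>
    L1.high t (\<lambda>u. ennreal (u powr x * l u)) \<le> ennreal (C1 * (t powr (x - 1) * (a1 t * l t))) * L1.tail t"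
    using L1.high_power[OF assms] by blast
  obtain C2 where C2: "0 < C2" "\<And>t. 0 < t \<Longrightarrow> ennreal (a1 t) * L1.tail t \<le> ennreal (C2 * chi1 t)"
    using weight_tail_le_chi1 by blast
  have C: "0 < C1 * C2" using C1 C2 by simp
  show ?thesis
  proof (rule that[OF C])
    fix t Z k assume t: "(0::real) < t" and k: "\<And>u. t < u \<Longrightarrow> k u \<le> Z * ennreal (u powr x * l u)"
    have l: "0 < l t" "0 < a1 t" using slow_pos[OF assms(1) t] slow_pos[OF weight_slow[OF L1.a] t] by auto
    show "L1.high t k \<le> ennreal (C1 * C2) * (Z * ennreal (t powr (x - 1) * l t * chi1 t))"
    proof (cases Z)
      case top
      have "Z * ennreal (t powr (x - 1) * l t * chi1 t) = top"
        using top t l chi_pos[OF t] by (simp add: ennreal_top_mult)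
      then show ?thesis by (simp only: ennreal_pos_mult_top[OF C] top_greatest)
    next
      case (real z)
      let ?g = "\<lambda>u. ennreal (u powr x * l u)"
      have "L1.high t k \<le> L1.high t (\<lambda>u. ennreal z * ?g u)"
        using k real t by (intro L1.high_mono) auto
      also have "\<dots> \<le> ennreal z * L1.high t ?g"
        using real t by (intro L1.high_cmult_le) auto
      also have "\<dots> \<le> ennreal z * (ennreal (C1 * (t powr (x - 1) * (a1 t * l t))) * L1.tail t)"
        by (intro mult_left_mono C1 t) auto
      also have "ennreal (C1 * (t powr (x - 1) * (a1 t * l t))) = ennreal (C1 * (t powr (x - 1) * l t)) * ennreal (a1 t)"
        using C1(1) l by (subst ennreal_mult'[symmetric]) (auto simp: mult_ac)
      also have "ennreal (C1 * (t powr (x - 1) * l t)) * ennreal (a1 t) * L1.tail t =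
          ennreal (C1 * (t powr (x - 1) * l t)) * (ennreal (a1 t) * L1.tail t)"
        by (rule mult.assoc)
      also have "ennreal z * \<dots> \<le> ennreal z * (ennreal (C1 * (t powr (x - 1) * l t)) * ennreal (C2 * chi1 t))"
        by (intro mult_left_mono C2 t) auto
      also have "ennreal (C1 * (t powr (x - 1) * l t)) * ennreal (C2 * chi1 t) = ennreal (C1 * C2) * ennreal (t powr (x - 1) * l t * chi1 t)"
        using C1(1) C2(1) l chi_pos[OF t] by (simp add: mult_ac flip: ennreal_mult' ennreal_mult'')
      also have "ennreal z * \<dots> = ennreal (C1 * C2) * (Z * ennreal (t powr (x - 1) * l t * chi1 t))"
        by (simp only: real mult_ac)
      finally show ?thesis .
    qed
  qed
qed

text \<open>
  The bounds on \<open>k0\<close> are those of the first part of a near-optimal decomposition at \<open>t\<close>. The constant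
  bound above \<open>t\<close> contributes \<open>\<chi>\<^sub>0(t) k(t)\<close> to the piece \<open>high\<close>.
\<close>

lemma full0_upper:
  obtains C where "0 < C" "\<And>t k k0 D. 0 < t \<Longrightarrow> 0 \<le> D \<Longrightarrow> meas k0 \<Longrightarrow> k t < top \<Longrightarrow>
    (\<And>u. 0 < u \<Longrightarrow> u < t \<Longrightarrow> k0 u \<le> ennreal D * k u) \<Longrightarrow> (\<And>u. t < u \<Longrightarrow> k0 u \<le> ennreal D * k t) \<Longrightarrow>
    L0.full k0 \<le> ennreal (C * D) * (L0.low t k + L0.mid t k + ennreal (chi0 t) * k t)"
proof -
  obtain C where C: "0 < C" "\<And>t k. 0 < t \<Longrightarrow> meas k \<Longrightarrow> L0.full k \<le> ennreal C * (L0.low t k + L0.mid t k + L0.high t k)"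
    using L0.full_split by blast
  show ?thesis
  proof (rule that[OF C(1)])
    fix t k k0 D assume t: "(0::real) < t" and D: "0 \<le> D" and m: "meas k0" and fin: "k t < top"
      and k: "\<And>u. 0 < u \<Longrightarrow> u < t \<Longrightarrow> k0 u \<le> ennreal D * k u" "\<And>u. t < u \<Longrightarrow> k0 u \<le> ennreal D * k t"
    obtain c where c: "k t = ennreal c" "0 \<le> c" using fin by (cases "k t") auto
    have 1: "L0.low t k0 \<le> ennreal D * L0.low t k"
      by (rule order_trans[OF L0.low_mono L0.low_cmult_le[OF D]]) (rule k(1))
    have 2: "L0.mid t k0 \<le> ennreal D * L0.mid t k"
      by (rule order_trans[OF L0.mid_mono L0.mid_cmult_le[OF D]]) (rule k(1))
    have "L0.high t k0 \<le> L0.high t (\<lambda>_. ennreal (D * c) * 1)"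
      using k(2) D c by (intro L0.high_mono t) (simp add: ennreal_mult')
    also have "\<dots> \<le> ennreal (D * c) * L0.high t (\<lambda>_. 1)"
      using D c t by (intro L0.high_cmult_le) auto
    also have "\<dots> = ennreal D * (ennreal (chi0 t) * k t)"
      using D by (simp add: ennreal_chi0[OF t] c ennreal_mult' mult_ac)
    finally have 3: "L0.high t k0 \<le> ennreal D * (ennreal (chi0 t) * k t)" .
    have "L0.full k0 \<le> ennreal C * (ennreal D * L0.low t k + ennreal D * L0.mid t k + ennreal D * (ennreal (chi0 t) * k t))"
      by (rule order_trans[OF C(2)[OF t m]]) (intro mult_left_mono add_mono 1 2 3; simp)
    also have "\<dots> = ennreal (C * D) * (L0.low t k + L0.mid t k + ennreal (chi0 t) * k t)"
      using C(1) by (simp add: ennreal_mult' distrib_left mult.assoc)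
    finally show "L0.full k0 \<le> ennreal (C * D) * (L0.low t k + L0.mid t k + ennreal (chi0 t) * k t)" .
  qed
qed

text \<open>
  The bounds on \<open>k1\<close> are those of the second part of a near-optimal decomposition at \<open>t\<close>. The linear
  bound below \<open>t\<close> contributes \<open>\<chi>\<^sub>1(t) k(t)/t\<close> to \<open>low\<close> and \<open>mid\<close>.
\<close>

lemma full1_upper:
  obtains C where "0 < C" "\<And>t k k1 D. 0 < t \<Longrightarrow> 0 \<le> D \<Longrightarrow> meas k1 \<Longrightarrow> k t < top \<Longrightarrow>
    (\<And>u. 0 < u \<Longrightarrow> u < t \<Longrightarrow> k1 u \<le> ennreal D * (ennreal (u / t) * k t)) \<Longrightarrow> (\<And>u. t < u \<Longrightarrow> k1 u \<le> ennreal D * k u) \<Longrightarrow>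
    L1.full k1 \<le> ennreal (C * D) * (ennreal (chi1 t / t) * k t + L1.high t k)"
proof -
  obtain C where C: "0 < C" "\<And>t k. 0 < t \<Longrightarrow> meas k \<Longrightarrow> L1.full k \<le> ennreal C * (L1.low t k + L1.mid t k + L1.high t k)"
    using L1.full_split by blast
  show ?thesis
  proof (rule that[OF C(1)])
    fix t k k1 D assume t: "(0::real) < t" and D: "0 \<le> D" and m: "meas k1" and fin: "k t < top"
      and k: "\<And>u. 0 < u \<Longrightarrow> u < t \<Longrightarrow> k1 u \<le> ennreal D * (ennreal (u / t) * k t)" "\<And>u. t < u \<Longrightarrow> k1 u \<le> ennreal D * k u"
    obtain c where c: "k t = ennreal c" "0 \<le> c" using fin by (cases "k t") auto
    let ?d = "D * c / t"
    have d: "0 \<le> ?d" using D c t by simp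
    have le: "k1 u \<le> ennreal ?d * ennreal u" if u: "0 < u" "u < t" for u
    proof -
      have "ennreal D * (ennreal (u / t) * k t) = ennreal ?d * ennreal u"
        using u t D c by (simp add: mult_ac flip: ennreal_mult' ennreal_mult'')
      then show ?thesis using k(1)[OF u] by simp
    qed
    have 1: "L1.low t k1 \<le> ennreal ?d * L1.low t (\<lambda>u. ennreal u)"
      by (rule order_trans[OF L1.low_mono L1.low_cmult_le[OF d]]) (rule le)
    have 2: "L1.mid t k1 \<le> ennreal ?d * L1.mid t (\<lambda>u. ennreal u)"
      by (rule order_trans[OF L1.mid_mono L1.mid_cmult_le[OF d]]) (rule le)
    have 3: "L1.high t k1 \<le> ennreal D * L1.high t k"
      by (rule order_trans[OF L1.high_mono[OF t] L1.high_cmult_le[OF D t]]) (rule k(2))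
    have "L1.full k1 \<le> ennreal C * (ennreal ?d * L1.low t (\<lambda>u. ennreal u) + ennreal ?d * L1.mid t (\<lambda>u. ennreal u) + ennreal D * L1.high t k)"
      by (rule order_trans[OF C(2)[OF t m]]) (intro mult_left_mono add_mono 1 2 3; simp)
    also have "ennreal ?d * L1.low t (\<lambda>u. ennreal u) + ennreal ?d * L1.mid t (\<lambda>u. ennreal u) = ennreal ?d * ennreal (chi1 t)"
      by (simp add: ennreal_chi1[OF t] distrib_left)
    also have "\<dots> = ennreal D * (ennreal (chi1 t / t) * k t)"
      using D c t chi_pos[OF t] by (simp add: mult_ac flip: ennreal_mult' ennreal_mult'')
    also have "ennreal C * (ennreal D * (ennreal (chi1 t / t) * k t) + ennreal D * L1.high t k) = ennreal (C * D) * (ennreal (chi1 t / t) * k t + L1.high t k)"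
      using C(1) by (simp add: ennreal_mult' distrib_left mult.assoc)
    finally show "L1.full k1 \<le> ennreal (C * D) * (ennreal (chi1 t / t) * k t + L1.high t k)" .
  qed
qed

text \<open>
  The explicit expression equivalent to \<open>K(\<rho>(t), f; X0, X1)\<close>. The parts of the \<open>X0\<close>-norm and of the
  \<open>X1\<close>-norm coming from the replacement of \<open>k\<close> at the cut, \<open>\<chi>\<^sub>0(t) k(t)\<close> and
  \<open>\<rho>(t) \<chi>\<^sub>1(t) k(t)/t\<close>, coincide by the choice of \<open>\<rho>\<close>; hence the single middle term.
\<close>

definition holmstedt_sum :: "real \<Rightarrow> (real \<Rightarrow> ennreal) \<Rightarrow> ennreal" where
  "holmstedt_sum t k = L0.low t k + L0.mid t k + ennreal (chi0 t) * k t + ennreal (rho t) * L1.high t k"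

abbreviation K :: "'a \<Rightarrow> real \<Rightarrow> ennreal" where
  "K f \<equiv> (\<lambda>u. Kfun A0 A1 u f)"

definition X0 :: "'a \<Rightarrow> ennreal" where "X0 = interp_L A0 A1 0 r0 b0 q0 a0"
definition X1 :: "'a \<Rightarrow> ennreal" where "X1 = interp_L A0 A1 1 r1 b1 q1 a1"

lemma X0_eq: "X0 f = (if f \<in> sum_space A0 A1 then L0.full (K f) else \<infinity>)"
  by (simp add: X0_def interp_L_def restrict_norm_def L0.full_def)

lemma X1_eq: "X1 f = (if f \<in> sum_space A0 A1 then L1.full (K f) else \<infinity>)"
  by (simp add: X1_def interp_L_def restrict_norm_def L1.full_def)

lemma qnorm: "quasi_norm A0" "quasi_norm A1"
  using couple by (auto simp: compatible_quasi_banach_couple_def quasi_banach_def)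

lemma sum_spaceI: "f \<in> qspace A0 \<Longrightarrow> f \<in> sum_space A0 A1" "f \<in> qspace A1 \<Longrightarrow> f \<in> sum_space A0 A1"
proof -
  show "f \<in> sum_space A0 A1" if "f \<in> qspace A0"
    using that quasi_norm_0(2)[OF qnorm(2)] unfolding sum_space_def by force
  show "f \<in> sum_space A0 A1" if "f \<in> qspace A1"
    using that quasi_norm_0(2)[OF qnorm(1)] unfolding sum_space_def by force
qed

lemma X_zero: "X0 0 = 0" "X1 0 = 0"
proof -
  have 0: "0 \<in> qspace A0" using quasi_norm_0[OF qnorm(1)] by simp
  have K0: "K 0 = (\<lambda>u. 0)"
    using Kfun_le_left[OF qnorm(2) 0] quasi_norm_0(1)[OF qnorm(1)] by (auto simp: fun_eq_iff)
  show "X0 0 = 0" "X1 0 = 0"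
    using L0.r L0.q L1.r L1.q sum_spaceI(1)[OF 0]
    by (simp_all add: X0_eq X1_eq K0 L0.full_def L1.full_def wnorm_zero)
qed

text \<open>
  Insert a near-optimal decomposition for the parameter \<open>t\<close> into the K-functional for the parameter
  \<open>\<rho>(t)\<close>; the factor \<open>\<rho>(t)\<close> turns \<open>\<chi>\<^sub>1(t)/t\<close> into \<open>\<chi>\<^sub>0(t)\<close>.
\<close>

lemma holmstedt_upper:
  obtains C where "0 < C" "\<And>t f. 0 < t \<Longrightarrow> f \<in> sum_space A0 A1 \<Longrightarrow> Kfun X0 X1 (rho t) f \<le> ennreal C * holmstedt_sum t (K f)"
proof -
  obtain D where D: "1 \<le> D"
    "\<And>f t. f \<in> sum_space A0 A1 \<Longrightarrow> f \<noteq> 0 \<Longrightarrow> 0 < t \<Longrightarrow> \<exists>f0\<in>qspace A0. \<exists>f1\<in>qspace A1. f = f0 + f1 \<and>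
      (\<forall>u. 0 < u \<and> u \<le> t \<longrightarrow> K f0 u \<le> ennreal D * K f u) \<and>
      (\<forall>u. K f0 u \<le> ennreal D * K f t) \<and>
      (\<forall>u. K f1 u \<le> ennreal D * (ennreal (u / t) * K f t)) \<and>
      (\<forall>u\<ge>t. K f1 u \<le> ennreal D * K f u)"
    using near_optimal_decomposition[OF couple] by blast
  obtain C0 where C0: "0 < C0" "\<And>t k k0 D. 0 < t \<Longrightarrow> 0 \<le> D \<Longrightarrow> meas k0 \<Longrightarrow> k t < top \<Longrightarrow>
    (\<And>u. 0 < u \<Longrightarrow> u < t \<Longrightarrow> k0 u \<le> ennreal D * k u) \<Longrightarrow> (\<And>u. t < u \<Longrightarrow> k0 u \<le> ennreal D * k t) \<Longrightarrow>
    L0.full k0 \<le> ennreal (C0 * D) * (L0.low t k + L0.mid t k + ennreal (chi0 t) * k t)"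
    using full0_upper by blast
  obtain C1 where C1: "0 < C1" "\<And>t k k1 D. 0 < t \<Longrightarrow> 0 \<le> D \<Longrightarrow> meas k1 \<Longrightarrow> k t < top \<Longrightarrow>
    (\<And>u. 0 < u \<Longrightarrow> u < t \<Longrightarrow> k1 u \<le> ennreal D * (ennreal (u / t) * k t)) \<Longrightarrow> (\<And>u. t < u \<Longrightarrow> k1 u \<le> ennreal D * k u) \<Longrightarrow>
    L1.full k1 \<le> ennreal (C1 * D) * (ennreal (chi1 t / t) * k t + L1.high t k)"
    using full1_upper by blast
  have C: "0 < C0 * D + C1 * D" using C0(1) C1(1) D(1) by (simp add: add_pos_pos)
  show ?thesis
  proof (rule that[OF C])
    fix t f assume t: "(0::real) < t" and f: "f \<in> sum_space A0 A1"
    have rho: "0 < rho t" using chi_pos[OF t] by simp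
    show "Kfun X0 X1 (rho t) f \<le> ennreal (C0 * D + C1 * D) * holmstedt_sum t (K f)"
    proof (cases "f = 0")
      case True
      have "Kfun X0 X1 (rho t) 0 \<le> X0 0 + ennreal (rho t) * X1 0"
        by (rule Kfun_le) (auto simp: qspace_def X_zero)
      then show ?thesis using True by (simp add: X_zero)
    next
      case False
      show ?thesis
      proof (cases "holmstedt_sum t (K f) = top")
        case True
        then show ?thesis using C by (simp add: ennreal_mult_top)
      next
        case hfin: False
        from D(2)[OF f False t] obtain f0 f1 where f01: "f0 \<in> qspace A0" "f1 \<in> qspace A1" "f = f0 + f1"
          "\<And>u. 0 < u \<Longrightarrow> u \<le> t \<Longrightarrow> K f0 u \<le> ennreal D * K f u" "\<And>u. K f0 u \<le> ennreal D * K f t"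
          "\<And>u. K f1 u \<le> ennreal D * (ennreal (u / t) * K f t)" "\<And>u. t \<le> u \<Longrightarrow> K f1 u \<le> ennreal D * K f u"
          by blast
        let ?k = "K f"
        have s: "f0 \<in> sum_space A0 A1" "f1 \<in> sum_space A0 A1" using f01 sum_spaceI by auto
        have m: "meas (K f0)" "meas (K f1)" using s quasiconcave_Kfun quasiconcave_meas by auto
        have "X0 f0 = L0.full (K f0)" using s by (simp add: X0_eq)
        also have "\<dots> \<le> ennreal (C0 * D) * (L0.low t ?k + L0.mid t ?k + ennreal (chi0 t) * ?k t)"
          by (rule C0(2)[OF t]) (use D(1) m Kfun_finite[OF f] f01 in auto)
        also have "\<dots> \<le> ennreal (C0 * D) * holmstedt_sum t ?k"
          unfolding holmstedt_sum_def by (intro mult_left_mono) (auto intro: add_increasing2)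
        finally have x0: "X0 f0 \<le> ennreal (C0 * D) * holmstedt_sum t ?k" .
        have "X1 f1 = L1.full (K f1)" using s by (simp add: X1_eq)
        also have "\<dots> \<le> ennreal (C1 * D) * (ennreal (chi1 t / t) * ?k t + L1.high t ?k)"
          by (rule C1(2)[OF t]) (use D(1) m Kfun_finite[OF f] f01 in auto)
        finally have "ennreal (rho t) * X1 f1 \<le> ennreal (rho t) * (ennreal (C1 * D) * (ennreal (chi1 t / t) * ?k t + L1.high t ?k))"
          by (intro mult_left_mono) auto
        also have "\<dots> = ennreal (C1 * D) * ((ennreal (rho t) * ennreal (chi1 t / t)) * ?k t + ennreal (rho t) * L1.high t ?k)"
          by (simp only: distrib_left mult_ac)
        also have "ennreal (rho t) * ennreal (chi1 t / t) = ennreal (chi0 t)"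
          using chi_pos[OF t] t by (simp add: rho_def flip: ennreal_mult')
        also have "ennreal (C1 * D) * (ennreal (chi0 t) * ?k t + ennreal (rho t) * L1.high t ?k) \<le> ennreal (C1 * D) * holmstedt_sum t ?k"
          unfolding holmstedt_sum_def by (intro mult_left_mono add_right_mono) (auto intro: add_increasing)
        finally have x1: "ennreal (rho t) * X1 f1 \<le> ennreal (C1 * D) * holmstedt_sum t ?k" .
        have "ennreal (C0 * D) * holmstedt_sum t ?k < top" "ennreal (C1 * D) * holmstedt_sum t ?k < top"
          using hfin by (simp_all add: ennreal_mult_less_top less_top)
        then have fin: "X0 f0 < top" "ennreal (rho t) * X1 f1 < top"
          by (blast intro: le_less_trans[OF x0] le_less_trans[OF x1])+
        then have q: "f0 \<in> qspace X0" "f1 \<in> qspace X1"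
          using rho by (auto simp: qspace_def ennreal_mult_less_top)
        have "Kfun X0 X1 (rho t) f \<le> X0 f0 + ennreal (rho t) * X1 f1" by (rule Kfun_le[OF q f01(3)])
        also have "\<dots> \<le> ennreal (C0 * D) * holmstedt_sum t ?k + ennreal (C1 * D) * holmstedt_sum t ?k" by (intro add_mono x0 x1)
        also have "\<dots> = ennreal (C0 * D + C1 * D) * holmstedt_sum t ?k"
          using C0(1) C1(1) D(1) by (simp add: distrib_right)
        finally show ?thesis .
      qed
    qed
  qed
qed

lemma holmstedt_sum_subadd:
  assumes "0 \<le> D"
  obtains C where "0 < C" "\<And>t k k0 k1. 0 < t \<Longrightarrow> meas k0 \<Longrightarrow> meas k1 \<Longrightarrow>
    (\<And>u. 0 < u \<Longrightarrow> k u \<le> ennreal D * (k0 u + k1 u)) \<Longrightarrow> holmstedt_sum t k \<le> ennreal C * (holmstedt_sum t k0 + holmstedt_sum t k1)"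
proof -
  obtain C0 where C0: "0 < C0"
    "\<And>t k k'. 0 < t \<Longrightarrow> meas k \<Longrightarrow> meas k' \<Longrightarrow> L0.low t (\<lambda>u. k u + k' u) \<le> ennreal C0 * (L0.low t k + L0.low t k')"
    "\<And>t k k'. 0 < t \<Longrightarrow> meas k \<Longrightarrow> meas k' \<Longrightarrow> L0.mid t (\<lambda>u. k u + k' u) \<le> ennreal C0 * (L0.mid t k + L0.mid t k')"
    by (rule L0.parts_add) (rule that; assumption | blast)
  obtain C1 where C1: "0 < C1"
    "\<And>t k k'. 0 < t \<Longrightarrow> meas k \<Longrightarrow> meas k' \<Longrightarrow> L1.high t (\<lambda>u. k u + k' u) \<le> ennreal C1 * (L1.high t k + L1.high t k')"
    by (rule L1.parts_add) (rule that; assumption | blast)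
  define C where "C = max 1 (max C0 C1)"
  have C: "1 \<le> C" "C0 \<le> C" "C1 \<le> C" by (auto simp: C_def)
  define G where "G = (D + 1) * C"
  show ?thesis
  proof (rule that[of G])
    fix t k k0 k1 assume t: "(0::real) < t" and m: "meas k0" "meas k1" and k: "\<And>u. 0 < u \<Longrightarrow> k u \<le> ennreal D * (k0 u + k1 u)"
    have up: "x \<le> ennreal G * y" if "x \<le> ennreal D * (ennreal c * y)" "0 \<le> c" "c \<le> C" for x y c
    proof -
      have "ennreal D * (ennreal c * y) = ennreal (D * c) * y" using assms by (simp add: ennreal_mult' mult.assoc)
      also have "\<dots> \<le> ennreal G * y"
        unfolding G_def using that(2,3) assms by (intro mult_right_mono ennreal_leI mult_mono) auto
      finally show ?thesis by (rule order_trans[OF that(1)])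
    qed
    have "L0.low t k \<le> L0.low t (\<lambda>u. ennreal D * (k0 u + k1 u))"
      using k t by (intro L0.low_mono) auto
    also have "\<dots> \<le> ennreal D * L0.low t (\<lambda>u. k0 u + k1 u)"
      using assms t by (intro L0.low_cmult_le)
    also have "\<dots> \<le> ennreal D * (ennreal C0 * (L0.low t k0 + L0.low t k1))"
      by (intro mult_left_mono C0(2) t m) auto
    finally have 1: "L0.low t k \<le> ennreal G * (L0.low t k0 + L0.low t k1)"
      by (rule up) (use C0(1) C in auto)
    have "L0.mid t k \<le> L0.mid t (\<lambda>u. ennreal D * (k0 u + k1 u))"
      using k t by (intro L0.mid_mono) auto
    also have "\<dots> \<le> ennreal D * L0.mid t (\<lambda>u. k0 u + k1 u)"
      using assms t by (intro L0.mid_cmult_le)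
    also have "\<dots> \<le> ennreal D * (ennreal C0 * (L0.mid t k0 + L0.mid t k1))"
      by (intro mult_left_mono C0(3) t m) auto
    finally have 2: "L0.mid t k \<le> ennreal G * (L0.mid t k0 + L0.mid t k1)"
      by (rule up) (use C0(1) C in auto)
    have "L1.high t k \<le> L1.high t (\<lambda>u. ennreal D * (k0 u + k1 u))"
      using k t by (intro L1.high_mono) auto
    also have "\<dots> \<le> ennreal D * L1.high t (\<lambda>u. k0 u + k1 u)"
      using assms t by (intro L1.high_cmult_le)
    also have "\<dots> \<le> ennreal D * (ennreal C1 * (L1.high t k0 + L1.high t k1))"
      by (intro mult_left_mono C1(2) t m) auto
    finally have 3: "L1.high t k \<le> ennreal G * (L1.high t k0 + L1.high t k1)"
      by (rule up) (use C1(1) C in auto)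
    have 4: "k t \<le> ennreal G * (k0 t + k1 t)"
      by (rule up[of _ 1]) (use k[OF t] C in auto)
    have "holmstedt_sum t k \<le> ennreal G * (L0.low t k0 + L0.low t k1) + ennreal G * (L0.mid t k0 + L0.mid t k1)
       + ennreal (chi0 t) * (ennreal G * (k0 t + k1 t)) + ennreal (rho t) * (ennreal G * (L1.high t k0 + L1.high t k1))"
      unfolding holmstedt_sum_def by (intro add_mono mult_left_mono 1 2 3 4) auto
    also have "\<dots> = ennreal G * (holmstedt_sum t k0 + holmstedt_sum t k1)"
      by (simp only: holmstedt_sum_def distrib_left distrib_right ac_simps)
    finally show "holmstedt_sum t k \<le> ennreal G * (holmstedt_sum t k0 + holmstedt_sum t k1)" .
  qed (use C assms in \<open>simp add: G_def add_nonneg_pos\<close>)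
qed

text \<open>
  The first three summands are pieces of the \<open>X0\<close>-norm. For the last one, \<open>chi0_le_full\<close> gives
  \<open>k \<le> Z/\<chi>\<^sub>0\<close> with \<open>Z\<close> the \<open>X0\<close>-norm, and \<open>high_bound\<close> turns this into
  \<open>Z \<chi>\<^sub>1(t)/(t \<chi>\<^sub>0(t)) = Z/\<rho>(t)\<close>.
\<close>

lemma holmstedt_sum_le_full0:
  obtains C where "0 < C" "\<And>t k. 0 < t \<Longrightarrow> quasiconcave k \<Longrightarrow> holmstedt_sum t k \<le> ennreal C * L0.full k"
proof -
  obtain C where C: "0 < C" "\<And>t Z k. 0 < t \<Longrightarrow> (\<And>u. t < u \<Longrightarrow> k u \<le> Z * ennreal (u powr 0 * (1 / chi0 u))) \<Longrightarrow>
    L1.high t k \<le> ennreal C * (Z * ennreal (t powr (0 - 1) * (1 / chi0 t) * chi1 t))"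
    using high_bound[OF slow_inverse[OF slow_chi(1)], of 0] zero_less_one by blast
  show ?thesis
  proof (rule that[of "3 + C"])
    fix t k assume t: "(0::real) < t" and k: "quasiconcave k"
    let ?F = "L0.full k"
    have le: "k u \<le> ?F * ennreal (u powr 0 * (1 / chi0 u))" if "t < u" for u
    proof -
      have u: "0 < u" using that t by simp
      have "k u = ennreal (1 / chi0 u) * (ennreal (chi0 u) * k u)"
        using chi_pos[OF u] by (simp flip: mult.assoc ennreal_mult'')
      also have "\<dots> \<le> ennreal (1 / chi0 u) * ?F" by (intro mult_left_mono chi0_le_full k u) auto
      finally show ?thesis using u by (simp add: mult.commute)
    qed
    have "ennreal (rho t) * L1.high t k \<le> ennreal (rho t) * (ennreal C * (?F * ennreal (t powr (0 - 1) * (1 / chi0 t) * chi1 t)))"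
      by (intro mult_left_mono C(2)[OF t le]) auto
    also have "\<dots> = ennreal C * ((ennreal (rho t) * ennreal (t powr (0 - 1) * (1 / chi0 t) * chi1 t)) * ?F)"
      by (simp only: mult_ac)
    also have "ennreal (rho t) * ennreal (t powr (0 - 1) * (1 / chi0 t) * chi1 t) = 1"
      using t chi_pos[OF t] by (subst ennreal_mult'[symmetric]) (auto simp: rho_def powr_minus field_simps)
    finally have 4: "ennreal (rho t) * L1.high t k \<le> ennreal C * ?F" by simp
    have "holmstedt_sum t k \<le> ?F + ?F + ?F + ennreal C * ?F"
      unfolding holmstedt_sum_def by (intro add_mono L0.low_le_full L0.mid_le_full chi0_le_full 4 t k)
    also have "?F + ?F + ?F = ennreal 3 * ?F" by (rule ennreal_triple)
    also have "ennreal 3 * ?F + ennreal C * ?F = ennreal (3 + C) * ?F"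
      using C(1) by (simp add: distrib_right)
    finally show "holmstedt_sum t k \<le> ennreal (3 + C) * ?F" .
  qed (use C in simp)
qed

text \<open>
  Here the roles are exchanged: the last summand is a piece of the \<open>X1\<close>-norm \<open>Z\<close>, and the others are
  estimated by means of \<open>k(u) \<le> 2 Z u/\<chi>\<^sub>1(u)\<close>.
\<close>

lemma holmstedt_sum_le_full1:
  obtains C where "0 < C" "\<And>t k. 0 < t \<Longrightarrow> quasiconcave k \<Longrightarrow> holmstedt_sum t k \<le> ennreal C * (ennreal (rho t) * L1.full k)"
proof -
  obtain C where C: "0 < C" "\<And>t Z k. 0 < t \<Longrightarrow> (\<And>u. 0 < u \<Longrightarrow> u < t \<Longrightarrow> k u \<le> Z * ennreal (u powr 1 * (1 / chi1 u))) \<Longrightarrow>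
    L0.low t k + L0.mid t k \<le> ennreal C * (Z * ennreal (t powr 1 * (1 / chi1 t) * chi0 t))"
    using low_mid_bound[OF slow_inverse[OF slow_chi(2)], of 1] zero_less_one by blast
  show ?thesis
  proof (rule that[of "C * 2 + 3"])
    fix t k assume t: "(0::real) < t" and k: "quasiconcave k"
    let ?F = "L1.full k"
    have le: "k u \<le> (ennreal 2 * ?F) * ennreal (u powr 1 * (1 / chi1 u))" if u: "0 < u" for u
    proof -
      have "k u = ennreal (u / chi1 u) * (ennreal (chi1 u / u) * k u)"
        using chi_pos[OF u] u by (simp flip: mult.assoc ennreal_mult'')
      also have "\<dots> \<le> ennreal (u / chi1 u) * (ennreal 2 * ?F)" by (intro mult_left_mono chi1_le_full k u) auto
      finally show ?thesis using u by (simp add: mult.commute)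
    qed
    have rho: "t powr 1 * (1 / chi1 t) * chi0 t = rho t" using t by (simp add: rho_def)
    have 1: "L0.low t k + L0.mid t k \<le> ennreal C * (ennreal 2 * ?F * ennreal (rho t))"
      using C(2)[OF t le, unfolded rho] by simp
    have "ennreal (chi0 t) * k t \<le> ennreal (chi0 t) * (ennreal 2 * ?F * ennreal (t powr 1 * (1 / chi1 t)))"
      by (intro mult_left_mono le t) auto
    also have "\<dots> = ennreal 2 * ?F * (ennreal (t powr 1 * (1 / chi1 t)) * ennreal (chi0 t))" by (simp only: mult_ac)
    also have "ennreal (t powr 1 * (1 / chi1 t)) * ennreal (chi0 t) = ennreal (rho t)"
      unfolding rho[symmetric] using t chi_pos[OF t] by (intro ennreal_mult'[symmetric]) auto
    finally have 2: "ennreal (chi0 t) * k t \<le> ennreal 2 * ?F * ennreal (rho t)" .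
    have "holmstedt_sum t k \<le> ennreal C * (ennreal 2 * ?F * ennreal (rho t)) + ennreal 2 * ?F * ennreal (rho t) + ennreal (rho t) * ?F"
      unfolding holmstedt_sum_def by (intro add_mono 1 2 mult_left_mono L1.high_le_full t) auto
    also have "\<dots> = (ennreal C * ennreal 2 + ennreal 2 + 1) * (ennreal (rho t) * ?F)"
      by (simp add: algebra_simps)
    also have "ennreal C * ennreal 2 + ennreal 2 + 1 = ennreal (C * 2 + 3)"
    proof -
      have "ennreal (C * 2 + 3) = ennreal (C * 2) + ennreal 3"
        using C(1) by (intro ennreal_plus) auto
      moreover have "ennreal 3 = ennreal 2 + ennreal 1" by (subst ennreal_plus[symmetric]) auto
      moreover have "ennreal (C * 2) = ennreal C * ennreal 2" using C(1) by (intro ennreal_mult') auto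
      ultimately show ?thesis by (simp only: add.assoc ennreal_1)
    qed
    finally show "holmstedt_sum t k \<le> ennreal (C * 2 + 3) * (ennreal (rho t) * ?F)" .
  qed (use C in \<open>simp add: add_pos_pos\<close>)
qed

text \<open>
  For every admissible decomposition \<open>f = f0 + f1\<close>, quasi-subadditivity bounds the sum for \<open>f\<close> by those for \<open>f0\<close>
  and \<open>f1\<close>, which are at most multiples of \<open>X0 f0\<close> and \<open>\<rho>(t) X1 f1\<close>; take the infimum.
\<close>

lemma holmstedt_lower:
  obtains C where "0 < C" "\<And>t f. 0 < t \<Longrightarrow> holmstedt_sum t (K f) \<le> ennreal C * Kfun X0 X1 (rho t) f"
proof -
  obtain D where D: "1 \<le> D" "\<And>t f g. Kfun A0 A1 t (f + g) \<le> ennreal D * (Kfun A0 A1 t f + Kfun A0 A1 t g)"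
    using Kfun_subadd[OF qnorm] by blast
  then have D0: "0 \<le> D" by simp
  obtain C where C: "0 < C" "\<And>t k k0 k1. 0 < t \<Longrightarrow> meas k0 \<Longrightarrow> meas k1 \<Longrightarrow>
    (\<And>u. 0 < u \<Longrightarrow> k u \<le> ennreal D * (k0 u + k1 u)) \<Longrightarrow> holmstedt_sum t k \<le> ennreal C * (holmstedt_sum t k0 + holmstedt_sum t k1)"
    using holmstedt_sum_subadd[OF D0] by blast
  obtain C0 where C0: "0 < C0" "\<And>t k. 0 < t \<Longrightarrow> quasiconcave k \<Longrightarrow> holmstedt_sum t k \<le> ennreal C0 * L0.full k"
    using holmstedt_sum_le_full0 by blast
  obtain C1 where C1: "0 < C1" "\<And>t k. 0 < t \<Longrightarrow> quasiconcave k \<Longrightarrow> holmstedt_sum t k \<le> ennreal C1 * (ennreal (rho t) * L1.full k)"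
    using holmstedt_sum_le_full1 by blast
  define M where "M = max C0 C1"
  have M: "0 < M" "C0 \<le> M" "C1 \<le> M" using C0 by (auto simp: M_def)
  have CM: "0 < C * M" using C M by simp
  show ?thesis
  proof (rule that[OF CM])
    fix t f assume t: "(0::real) < t"
    show "holmstedt_sum t (K f) \<le> ennreal (C * M) * Kfun X0 X1 (rho t) f"
      unfolding Kfun_def[of X0 X1]
    proof (rule le_cmult_Inf[OF CM])
      fix x assume "x \<in> {X0 f0 + ennreal (rho t) * X1 f1 |f0 f1. f0 \<in> qspace X0 \<and> f1 \<in> qspace X1 \<and> f = f0 + f1}"
      then obtain f0 f1 where f: "x = X0 f0 + ennreal (rho t) * X1 f1" "f0 \<in> qspace X0" "f1 \<in> qspace X1" "f = f0 + f1" by blast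
      have s: "f0 \<in> sum_space A0 A1" "f1 \<in> sum_space A0 A1"
        using f by (auto simp: qspace_def X0_eq X1_eq split: if_splits)
      then have q: "quasiconcave (K f0)" "quasiconcave (K f1)" by (auto intro: quasiconcave_Kfun)
      have "holmstedt_sum t (K f0) \<le> ennreal M * X0 f0"
        using C0(2)[OF t q(1)] mult_right_mono[OF ennreal_leI[OF M(2)]] s by (auto simp: X0_eq intro: order_trans)
      moreover have "holmstedt_sum t (K f1) \<le> ennreal M * (ennreal (rho t) * X1 f1)"
        using C1(2)[OF t q(2)] mult_right_mono[OF ennreal_leI[OF M(3)]] s by (auto simp: X1_eq intro: order_trans)
      ultimately have "holmstedt_sum t (K f0) + holmstedt_sum t (K f1) \<le> ennreal M * x"
        unfolding f(1) distrib_left by (rule add_mono)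
      then have "ennreal C * (holmstedt_sum t (K f0) + holmstedt_sum t (K f1)) \<le> ennreal (C * M) * x"
        using C(1) by (simp add: ennreal_mult' mult.assoc mult_left_mono)
      moreover have "holmstedt_sum t (K f) \<le> ennreal C * (holmstedt_sum t (K f0) + holmstedt_sum t (K f1))"
        using D(2) q by (intro C(2) t quasiconcave_meas) (auto simp: f(4))
      ultimately show "holmstedt_sum t (K f) \<le> ennreal (C * M) * x" by (rule order_trans[rotated])
    qed
  qed
qed

end

section \<open>Discretization\<close>

text \<open>
  The first two conditions make the intervals \<open>[x n, 2 x n)\<close> disjoint, the last one makes the intervals
  \<open>[x n, M x n]\<close> a cover. Disjointness gives lower bounds for integrals and covering gives upper bounds, so no
  exact partition is needed. Below, the index \<open>n\<close> enumerates the integers.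
\<close>

definition lacunary :: "real \<Rightarrow> (nat \<Rightarrow> real) \<Rightarrow> bool" where
  "lacunary M x \<longleftrightarrow> (\<forall>n. 0 < x n) \<and> (\<forall>n m. n \<noteq> m \<longrightarrow> x n \<le> x m \<longrightarrow> 2 * x n \<le> x m) \<and>
     (\<forall>u>0. \<exists>n. x n \<le> u \<and> u \<le> M * x n)"

lemma lacunary_int:
  fixes y :: "int \<Rightarrow> real"
  assumes pos: "\<And>k. 0 < y k" and y: "\<And>k. 2 * y k \<le> y (k + 1)" "\<And>k. y (k + 1) \<le> M * y k"
  shows "lacunary M (\<lambda>n. y (int_decode n))"
proof -
  have pow: "2 ^ n * y k \<le> y (k + int n)" for n k
  proof (induction n)
    case (Suc n)
    then show ?case using y(1)[of "k + int n"] by (simp add: algebra_simps)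
  qed simp
  have mono: "y j \<le> y k" if "j \<le> k" for j k
  proof -
    obtain n where n: "k = j + int n" using \<open>j \<le> k\<close> zle_iff_zadd by blast
    have "1 * y j \<le> 2 ^ n * y j" using pos[of j] by (intro mult_right_mono) auto
    also have "\<dots> \<le> y k" using pow[of n j] n by simp
    finally show ?thesis by simp
  qed
  have gap: "2 * y j \<le> y k" if "j < k" for j k
    using y(1)[of j] mono[of "j + 1" k] that by simp
  have "2 * y (int_decode n) \<le> y (int_decode m)" if "n \<noteq> m" "y (int_decode n) \<le> y (int_decode m)" for n m
  proof -
    have "int_decode n \<noteq> int_decode m" using that(1) by (simp add: inj_int_decode[THEN inj_eq])
    then consider "int_decode n < int_decode m" | "int_decode m < int_decode n" by linarith
    then show ?thesis
    proof cases
      case 2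
      then show ?thesis using gap[OF 2] that(2) pos[of "int_decode m"] by simp
    qed (rule gap)
  qed
  moreover have "\<exists>n. y (int_decode n) \<le> u \<and> u \<le> M * y (int_decode n)" if u: "0 < u" for u
  proof -
    have "1 < (2::real)" by simp
    from real_arch_pow[OF this, of "max (u / y 0) (y 0 / u)"]
    obtain N :: nat where N: "max (u / y 0) (y 0 / u) < 2 ^ N" by blast
    have up: "u < y (int N)" using N pow[of N 0] pos[of 0] by (simp add: field_simps)
    have "2 ^ N * y (- int N) \<le> y 0" using pow[of N "- int N"] by simp
    also have "y 0 < 2 ^ N * u" using N u by (simp add: field_simps)
    finally have dn: "y (- int N) < u" by simp
    \<comment> \<open>The largest index with value at most \<open>u\<close> is found by ascending from \<open>- N\<close>.\<close>
    define P where "P n \<longleftrightarrow> u < y (- int N + int n)" for n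
    have P: "P (2 * N)" using up by (simp add: P_def)
    define n where "n = (LEAST n. P n)"
    have n: "P n" unfolding n_def by (rule LeastI[of P, OF P])
    have "n \<noteq> 0"
    proof
      assume "n = 0"
      then have "u < y (- int N)" using n by (simp add: P_def)
      with dn show False by simp
    qed
    then obtain m where m: "n = Suc m" using not0_implies_Suc by blast
    have "\<not> P m" using not_less_Least[of m P] m by (simp add: n_def)
    then have l: "y (- int N + int m) \<le> u" by (simp add: P_def)
    have "u \<le> M * y (- int N + int m)"
      using n y(2)[of "- int N + int m"] by (simp add: P_def m algebra_simps)
    with l show ?thesis by (intro exI[of _ "int_encode (- int N + int m)"]) simp
  qed
  ultimately show ?thesis unfolding lacunary_def using pos by blast
qed

definition seq_norm :: "ennreal \<Rightarrow> (nat \<Rightarrow> ennreal) \<Rightarrow> ennreal" where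
  "seq_norm q y = (if q = \<infinity> then (SUP n. y n) else ennpow (\<Sum>n. ennpow (y n) (enn2real q)) (1 / enn2real q))"

lemma tame_near:
  assumes "tame D A F" "0 \<le> D" "0 \<le> A" "0 < s" "s \<le> t" "t \<le> M * s"
  shows "F s \<le> ennreal (D * M powr A) * F t" "F t \<le> ennreal (D * M powr A) * F s"
proof -
  have t: "0 < t" using assms by simp
  have o: "spread s t \<le> M" "1 \<le> spread s t" using assms spread_ge_1[OF assms(4) t] by (auto simp: spread_le field_simps)
  then have "D * spread s t powr A \<le> D * M powr A" using assms by (intro mult_left_mono powr_mono2) auto
  then have e: "ennreal (D * spread s t powr A) \<le> ennreal (D * M powr A)" by (rule ennreal_leI)
  show "F s \<le> ennreal (D * M powr A) * F t"
    using tameD[OF assms(1,4) t] mult_right_mono[OF e] by (rule order_trans) simp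
  show "F t \<le> ennreal (D * M powr A) * F s"
    using tameD[OF assms(1) t assms(4)] mult_right_mono[OF e] unfolding spread_commute[of t] by (rule order_trans) simp
qed

lemma ennreal_le_suminf: "f n \<le> (\<Sum>n. f n)" for f :: "nat \<Rightarrow> ennreal"
  using sum_le_suminf[of f "{n}"] by simp

lemma suminf_single: "(\<And>m. m \<noteq> n \<Longrightarrow> f m = 0) \<Longrightarrow> (\<Sum>n. f n) = f n" for f :: "nat \<Rightarrow> ennreal"
  using suminf_finite[of "{n}" f] by simp

text \<open>
  On \<open>[x n, M x n]\<close> a tame \<open>F\<close> is at most a multiple of \<open>F (x n)\<close>, so \<open>F\<close> has a measurable
  step function as majorant. Only this majorant is integrated term by term.
\<close>

lemma discretize_upper:
  assumes q: "0 < q" and D: "0 \<le> D" "0 \<le> A" and M: "1 \<le> M"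
  obtains C where "0 < C" "\<And>F x. tame D A F \<Longrightarrow> lacunary M x \<Longrightarrow> mnorm q {0<..} F \<le> ennreal C * seq_norm q (\<lambda>n. F (x n))"
proof -
  define E where "E = D * M powr A"
  have E: "0 \<le> E" using D by (simp add: E_def)
  have near: "F u \<le> ennreal E * F (x n)" if "tame D A F" "lacunary M x" "x n \<le> u" "u \<le> M * x n" for F x u n
    using tame_near(2)[OF that(1) D, of "x n" u M] that by (simp add: E_def lacunary_def)
  show ?thesis
  proof (cases "q = \<infinity>")
    case True
    show ?thesis
    proof (rule that[of "E + 1"])
      fix F x assume F: "tame D A F" and x: "lacunary M x"
      have "F u \<le> ennreal (E + 1) * (SUP n. F (x n))" if u: "0 < u" for u
      proof -
        obtain n where n: "x n \<le> u" "u \<le> M * x n" using x u unfolding lacunary_def by blast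
        have "F u \<le> ennreal E * F (x n)" by (rule near[OF F x n])
        also have "\<dots> \<le> ennreal (E + 1) * (SUP n. F (x n))"
          by (intro mult_mono ennreal_leI SUP_upper) auto
        finally show ?thesis .
      qed
      then have "mnorm \<infinity> {0<..} F \<le> ennreal (E + 1) * (SUP n. F (x n))"
        by (subst mnorm_inf_le_iff) auto
      then show "mnorm q {0<..} F \<le> ennreal (E + 1) * seq_norm q (\<lambda>n. F (x n))"
        by (simp add: True seq_norm_def)
    qed (use E in simp)
  next
    case False
    let ?p = "enn2real q"
    have p: "0 < ?p" using False q enn2real_pos by auto
    show ?thesis
    proof (rule that[of "M powr (1 / ?p) * (E + 1)"])
      fix F x assume F: "tame D A F" and x: "lacunary M x"
      have xpos: "0 < x n" for n using x by (simp add: lacunary_def)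
      let ?c = "\<lambda>n. ennreal (1 / x n) * ennpow (ennreal (E + 1) * F (x n)) ?p"
      let ?S = "\<Sum>n. ennpow (F (x n)) ?p"
      have "mpow ?p {0<..} F \<le> (\<integral>\<^sup>+u. (\<Sum>n. ?c n * indicator {x n..M * x n} u) \<partial>lebesgue)"
        unfolding mpow_def
      proof (rule nn_integral_mono)
        fix u
        show "ennreal (1 / u) * ennpow (F u) ?p * indicator {0<..} u \<le> (\<Sum>n. ?c n * indicator {x n..M * x n} u)"
        proof (cases "0 < u")
          case True
          then obtain n where n: "x n \<le> u" "u \<le> M * x n" using x unfolding lacunary_def by blast
          have "F u \<le> ennreal E * F (x n)" by (rule near[OF F x n])
          also have "\<dots> \<le> ennreal (E + 1) * F (x n)" by (intro mult_right_mono ennreal_leI) auto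
          finally have "ennreal (1 / u) * ennpow (F u) ?p \<le> ?c n"
            using n xpos[of n] p True by (intro mult_mono ennreal_leI ennpow_mono) (auto simp: frac_le)
          also have "\<dots> = ?c n * indicator {x n..M * x n} u" using n by simp
          also have "\<dots> \<le> (\<Sum>n. ?c n * indicator {x n..M * x n} u)"
            by (rule ennreal_le_suminf)
          finally show ?thesis using True by simp
        qed simp
      qed
      also have "\<dots> = (\<Sum>n. \<integral>\<^sup>+u. ?c n * indicator {x n..M * x n} u \<partial>lebesgue)"
        by (rule nn_integral_suminf) (intro borel_measurable_times_ennreal borel_measurable_indicator; simp)
      also have "\<dots> \<le> (\<Sum>n. ennreal (M * (E + 1) powr ?p) * ennpow (F (x n)) ?p)"
      proof (rule suminf_le)
        fix n
        have "(\<integral>\<^sup>+u. ?c n * indicator {x n..M * x n} u \<partial>lebesgue) = ?c n * emeasure lebesgue {x n..M * x n}"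
          by (rule nn_integral_cmult_indicator) simp
        also have "emeasure lebesgue {x n..M * x n} = ennreal (M * x n - x n)"
          using xpos[of n] M by simp
        also have "?c n * ennreal (M * x n - x n) \<le> ?c n * ennreal (M * x n)"
          using xpos[of n] by (intro mult_left_mono ennreal_leI) auto
        also have "\<dots> = (ennreal (1 / x n) * ennreal (M * x n)) * (ennpow (ennreal (E + 1)) ?p * ennpow (F (x n)) ?p)"
          using p by (simp only: ennpow_mult mult_ac)
        also have "ennreal (1 / x n) * ennreal (M * x n) = ennreal M"
          using xpos[of n] by (subst ennreal_mult'[symmetric]) auto
        also have "ennpow (ennreal (E + 1)) ?p = ennreal ((E + 1) powr ?p)"
          using E by (intro ennpow_ennreal) simp
        also have "ennreal M * (ennreal ((E + 1) powr ?p) * ennpow (F (x n)) ?p) = ennreal (M * (E + 1) powr ?p) * ennpow (F (x n)) ?p"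
          using M by (simp add: ennreal_mult' mult.assoc)
        finally show "(\<integral>\<^sup>+u. ?c n * indicator {x n..M * x n} u \<partial>lebesgue) \<le> ennreal (M * (E + 1) powr ?p) * ennpow (F (x n)) ?p" .
      qed auto
      also have "\<dots> = ennreal (M * (E + 1) powr ?p) * ?S" by (rule ennreal_suminf_cmult)
      also have "\<dots> = ennpow (ennreal (M powr (1 / ?p) * (E + 1)) * ennpow ?S (1 / ?p)) ?p"
        using p M E by (simp add: ennpow_mult ennpow_inverse' powr_mult powr_powr)
      finally show "mnorm q {0<..} F \<le> ennreal (M powr (1 / ?p) * (E + 1)) * seq_norm q (\<lambda>n. F (x n))"
        using False by (simp add: mnorm_le_iff[OF pos_setI(1) q False] seq_norm_def)
    qed (use E M in simp)
  qed
qed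

text \<open>
  By disjointness, the step function with value a small multiple of \<open>F (x n)\<close> on \<open>(x n, 2 x n)\<close> is a measurable
  minorant of \<open>F\<close>, which can be integrated term by term.
\<close>

lemma discretize_lower:
  assumes q: "0 < q" and D: "1 \<le> D" "0 \<le> A"
  obtains C where "0 < C" "\<And>F x. tame D A F \<Longrightarrow> lacunary M x \<Longrightarrow> seq_norm q (\<lambda>n. F (x n)) \<le> ennreal C * mnorm q {0<..} F"
proof -
  define E where "E = D * 2 powr A"
  have E: "0 < E" using D by (simp add: E_def)
  have near: "F (x n) \<le> ennreal E * F u" if "tame D A F" "lacunary M x" "x n < u" "u < 2 * x n" for F x u n
    using tame_near(1)[OF that(1) _ D(2), of "x n" u 2] that D by (simp add: E_def lacunary_def)
  show ?thesis
  proof (cases "q = \<infinity>")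
    case True
    define C where "C = 2 powr recip q"
    have C: "0 < C" by (simp add: C_def)
    show ?thesis
    proof (rule that[of "C * E"])
      fix F x assume F: "tame D A F" and x: "lacunary M x"
      have "F (x n) \<le> ennreal (C * E) * mnorm q {0<..} F" for n
      proof -
        have xn: "0 < x n" using x by (simp add: lacunary_def)
        have "F (x n) \<le> ennreal C * mnorm q {0<..} (\<lambda>u. ennreal E * F u)"
          unfolding C_def by (rule mnorm_lower[OF q, of _ "x n"]) (use xn near[OF F x] in auto)
        also have "\<dots> \<le> ennreal C * (ennreal E * mnorm q {0<..} F)"
          using q E by (intro mult_left_mono mnorm_cmult_le) auto
        finally show ?thesis using C by (simp add: ennreal_mult' mult.assoc)
      qed
      then show "seq_norm q (\<lambda>n. F (x n)) \<le> ennreal (C * E) * mnorm q {0<..} F"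
        by (simp add: True seq_norm_def SUP_least)
    qed (use C E in simp)
  next
    case False
    let ?p = "enn2real q"
    have p: "0 < ?p" using False q enn2real_pos by auto
    show ?thesis
    proof (rule that[of "2 powr (1 / ?p) * E"])
      fix F x assume F: "tame D A F" and x: "lacunary M x"
      have xpos: "0 < x n" for n using x by (simp add: lacunary_def)
      let ?c = "\<lambda>n. ennreal (1 / (2 * x n)) * ennpow (F (x n)) ?p"
      let ?h = "\<lambda>n u. ?c n * indicator {x n<..<2 * x n} u"
      let ?S = "\<Sum>n. ennpow (F (x n)) ?p"
      have i: "(\<integral>\<^sup>+u. ?h n u \<partial>lebesgue) = ennreal (1 / 2) * ennpow (F (x n)) ?p" for n
      proof -
        have "(\<integral>\<^sup>+u. ?h n u \<partial>lebesgue) = ?c n * emeasure lebesgue {x n<..<2 * x n}"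
          by (rule nn_integral_cmult_indicator) simp
        also have "emeasure lebesgue {x n<..<2 * x n} = ennreal (x n)"
          using xpos[of n] by simp
        also have "?c n * ennreal (x n) = (ennreal (1 / (2 * x n)) * ennreal (x n)) * ennpow (F (x n)) ?p"
          by (simp only: mult_ac)
        also have "ennreal (1 / (2 * x n)) * ennreal (x n) = ennreal (1 / 2)"
          using xpos[of n] by (subst ennreal_mult'[symmetric]) auto
        finally show ?thesis .
      qed
      have "ennreal (1 / 2) * ?S = (\<Sum>n. ennreal (1 / 2) * ennpow (F (x n)) ?p)"
        by (rule ennreal_suminf_cmult[symmetric])
      also have "\<dots> = (\<Sum>n. \<integral>\<^sup>+u. ?h n u \<partial>lebesgue)" by (simp only: i)
      also have "\<dots> = (\<integral>\<^sup>+u. (\<Sum>n. ?h n u) \<partial>lebesgue)"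
        by (rule nn_integral_suminf[symmetric]) (intro borel_measurable_times_ennreal borel_measurable_indicator; simp)
      also have "\<dots> \<le> mpow ?p {0<..} (\<lambda>u. ennreal E * F u)"
        unfolding mpow_def
      proof (rule nn_integral_mono)
        fix u
        show "(\<Sum>n. ?h n u) \<le> ennreal (1 / u) * ennpow (ennreal E * F u) ?p * indicator {0<..} u"
        proof (cases "\<exists>n. u \<in> {x n<..<2 * x n}")
          case True
          then obtain n where n: "x n < u" "u < 2 * x n" by auto
          have "?h m u = 0" if "m \<noteq> n" for m
          proof -
            have "u \<notin> {x m<..<2 * x m}"
              using x n that unfolding lacunary_def by (metis greaterThanLessThan_iff le_cases less_le_not_le order_less_trans)
            then show ?thesis by simp
          qed
          then have "(\<Sum>n. ?h n u) = ?h n u" by (rule suminf_single)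
          also have "\<dots> = ?c n" using n by simp
          also have "\<dots> \<le> ennreal (1 / u) * ennpow (ennreal E * F u) ?p"
            using n xpos[of n] p near[OF F x n] by (intro mult_mono ennreal_leI ennpow_mono) (auto simp: frac_le)
          finally show ?thesis using n xpos[of n] by simp
        next
          case False
          then have "?h n u = 0" for n by simp
          then have "(\<Sum>n. ?h n u) = (\<Sum>n::nat. 0)" by (simp only:)
          then show ?thesis by simp
        qed
      qed
      also have "\<dots> = ennpow (mnorm q {0<..} (\<lambda>u. ennreal E * F u)) ?p" by (rule mpow_mnorm[OF pos_setI(1) q False])
      also have "\<dots> \<le> ennpow (ennreal E * mnorm q {0<..} F) ?p"
        using q E p by (intro ennpow_mono mnorm_cmult_le) auto
      finally have "ennreal 2 * (ennreal (1 / 2) * ?S) \<le> ennreal 2 * ennpow (ennreal E * mnorm q {0<..} F) ?p"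
        by (intro mult_left_mono) auto
      moreover have "ennreal 2 * (ennreal (1 / 2) * ?S) = ?S"
      proof -
        have "ennreal 2 * ennreal (1 / 2) = 1" by (subst ennreal_mult[symmetric]) auto
        then show ?thesis by (simp only: mult.assoc[symmetric] mult_1_left)
      qed
      moreover have "ennreal 2 * ennpow (ennreal E * mnorm q {0<..} F) ?p = ennpow (ennreal (2 powr (1 / ?p) * E) * mnorm q {0<..} F) ?p"
        using p E by (simp add: ennpow_mult powr_mult powr_powr ennreal_mult mult.assoc)
      ultimately have "?S \<le> ennpow (ennreal (2 powr (1 / ?p) * E) * mnorm q {0<..} F) ?p" by simp
      then show "seq_norm q (\<lambda>n. F (x n)) \<le> ennreal (2 powr (1 / ?p) * E) * mnorm q {0<..} F"
        using False p by (simp add: seq_norm_def ennpow_root_le_iff)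
    qed (use E in simp)
  qed
qed

section \<open>Change of variables\<close>

text \<open>
  The exponent \<open>3/2\<close> is \<open>1\<close> for the factor \<open>t\<close> plus \<open>1/2\<close> for the slowly varying factor. A value below
  \<open>1\<close> for the latter is what makes \<open>t l(t)\<close> grow; see \<open>change_of_variable\<close>.
\<close>

lemma spread_mult_slow:
  assumes l: "slow l"
  obtains E where "1 \<le> E" "\<And>s t. 0 < s \<Longrightarrow> 0 < t \<Longrightarrow> l s \<le> E * spread s t powr (1 / 2) * l t"
    "\<And>s t. 0 < s \<Longrightarrow> 0 < t \<Longrightarrow> spread (s * l s) (t * l t) \<le> E * spread s t powr (3 / 2)"
proof -
  have half: "0 < (1 / 2 :: real)" by simp
  obtain E where E: "1 \<le> E" "\<And>s t. 0 < s \<Longrightarrow> 0 < t \<Longrightarrow> l s \<le> E * spread s t powr (1 / 2) * l t"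
    using slowE[OF l half] by blast
  define \<sigma> where "\<sigma> t = t * l t" for t
  have pos: "0 < \<sigma> t" if "0 < t" for t using that slow_pos[OF l] by (simp add: \<sigma>_def)
  have grow: "\<sigma> s \<le> E * spread s t powr (3 / 2) * \<sigma> t" if st: "0 < s" "0 < t" for s t
  proof -
    have "\<sigma> s \<le> (spread s t * t) * (E * spread s t powr (1 / 2) * l t)"
      unfolding \<sigma>_def
    proof (rule mult_mono)
      have "s / t \<le> spread s t" by (simp add: spread_def)
      then show "s \<le> spread s t * t" using st by (simp add: field_simps)
    qed (use st E spread_ge_1[OF st] slow_pos[OF l, of s] in auto)
    also have "\<dots> = E * (spread s t powr 1 * spread s t powr (1 / 2)) * \<sigma> t"
      using spread_ge_1[OF st] by (simp add: \<sigma>_def)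
    also have "spread s t powr 1 * spread s t powr (1 / 2) = spread s t powr (3 / 2)"
      by (subst powr_add[symmetric]) simp
    finally show ?thesis .
  qed
  show ?thesis
  proof (rule that[OF E])
    fix s t :: real assume st: "0 < s" "0 < t"
    show "spread (s * l s) (t * l t) \<le> E * spread s t powr (3 / 2)"
      using grow[OF st] grow[OF st(2,1)] pos[OF st(1)] pos[OF st(2)]
      by (auto simp: spread_def[of "s * l s"] spread_commute[of t] pos_divide_le_eq \<sigma>_def)
  qed
qed

lemma slow_compose:
  assumes a: "slow a" and l: "slow l"
  shows "slow (\<lambda>t. a (t * l t))"
proof (rule slowI)
  obtain E where E: "1 \<le> E"
    "\<And>s t. 0 < s \<Longrightarrow> 0 < t \<Longrightarrow> spread (s * l s) (t * l t) \<le> E * spread s t powr (3 / 2)"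
    using spread_mult_slow[OF l] by metis
  have pos: "0 < t * l t" if "0 < t" for t using that slow_pos[OF l] by simp
  show "0 < a (t * l t)" if "0 < t" for t using slow_pos[OF a pos[OF that]] .
  fix e :: real assume e: "0 < e"
  then have e': "0 < 2 / 3 * e" by simp
  obtain D where D: "1 \<le> D" "\<And>s t. 0 < s \<Longrightarrow> 0 < t \<Longrightarrow> a s \<le> D * spread s t powr (2 / 3 * e) * a t"
    using slowE[OF a e'] by blast
  have "a (s * l s) \<le> (D * E powr (2 / 3 * e)) * spread s t powr e * a (t * l t)" if st: "0 < s" "0 < t" for s t
  proof -
    have "spread (s * l s) (t * l t) powr (2 / 3 * e) \<le> (E * spread s t powr (3 / 2)) powr (2 / 3 * e)"
      using E(2)[OF st] spread_ge_1[OF pos[OF st(1)] pos[OF st(2)]] e by (intro powr_mono2) auto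
    also have "\<dots> = E powr (2 / 3 * e) * spread s t powr e"
      using E(1) by (simp add: powr_mult powr_powr)
    finally have le: "spread (s * l s) (t * l t) powr (2 / 3 * e) \<le> E powr (2 / 3 * e) * spread s t powr e" .
    have "a (s * l s) \<le> D * spread (s * l s) (t * l t) powr (2 / 3 * e) * a (t * l t)"
      by (rule D(2)[OF pos[OF st(1)] pos[OF st(2)]])
    also have "\<dots> \<le> D * (E powr (2 / 3 * e) * spread s t powr e) * a (t * l t)"
      using D(1) slow_pos[OF a pos[OF st(2)]] by (intro mult_right_mono mult_left_mono le) auto
    finally show ?thesis by (simp only: mult.assoc)
  qed
  moreover have "1 \<le> D * E powr (2 / 3 * e)"
    using D(1) E(1) e by (intro mult_ge1_I ge_one_powr_ge_zero) auto
  ultimately show "\<exists>D. 1 \<le> D \<and> (\<forall>s t. 0 < s \<longrightarrow> 0 < t \<longrightarrow> a (s * l s) \<le> D * spread s t powr e * a (t * l t))"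
    by blast
qed

text \<open>
  The map \<open>\<sigma>(t) = t l(t)\<close> is neither monotone nor smooth in general. But for \<open>N\<close> large both
  \<open>N\<^sup>k\<close> and \<open>\<sigma>(N\<^sup>k)\<close>, with \<open>k\<close> running through the integers, are lacunary; so both norms are
  equivalent to the same sequence norm, that of \<open>F(\<sigma>(N\<^sup>k))\<close>.
\<close>

lemma change_of_variable:
  assumes q: "0 < q" and D: "1 \<le> D" "0 \<le> A" and l: "slow l"
  obtains C where "0 < C"
    "\<And>F. tame D A F \<Longrightarrow> mnorm q {0<..} F \<le> ennreal C * mnorm q {0<..} (\<lambda>t. F (t * l t))"
    "\<And>F. tame D A F \<Longrightarrow> mnorm q {0<..} (\<lambda>t. F (t * l t)) \<le> ennreal C * mnorm q {0<..} F"
proof -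
  obtain E where E: "1 \<le> E" "\<And>s t. 0 < s \<Longrightarrow> 0 < t \<Longrightarrow> l s \<le> E * spread s t powr (1 / 2) * l t"
    and spread_E: "\<And>s t. 0 < s \<Longrightarrow> 0 < t \<Longrightarrow> spread (s * l s) (t * l t) \<le> E * spread s t powr (3 / 2)"
    using spread_mult_slow[OF l] by metis
  define \<sigma> where "\<sigma> t = t * l t" for t
  have pos: "0 < \<sigma> t" if "0 < t" for t using that slow_pos[OF l] by (simp add: \<sigma>_def)
  have spread_\<sigma>: "spread (\<sigma> s) (\<sigma> t) \<le> E * spread s t powr (3 / 2)" if st: "0 < s" "0 < t" for s t
    using spread_E[OF st] by (simp add: \<sigma>_def)
  have grow: "\<sigma> s \<le> E * spread s t powr (3 / 2) * \<sigma> t" if st: "0 < s" "0 < t" for s t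
  proof -
    have "\<sigma> s / \<sigma> t \<le> spread (\<sigma> s) (\<sigma> t)" by (simp add: spread_def)
    then have "\<sigma> s / \<sigma> t \<le> E * spread s t powr (3 / 2)" using spread_\<sigma>[OF st] by simp
    then show ?thesis using pos[OF st(2)] by (simp add: pos_divide_le_eq)
  qed
  define D' A' where "D' = D * E powr A" and "A' = 3 / 2 * A"
  have D': "1 \<le> D'" "0 \<le> A'" using D E by (auto simp: D'_def A'_def intro!: mult_ge1_I ge_one_powr_ge_zero)
  have tame: "tame D' A' (\<lambda>t. F (\<sigma> t))" if F: "tame D A F" for F
    unfolding tame_def
  proof (intro allI impI)
    fix s t :: real assume st: "0 < s" "0 < t"
    have "F (\<sigma> s) \<le> ennreal (D * spread (\<sigma> s) (\<sigma> t) powr A) * F (\<sigma> t)"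
      using tameD[OF F pos[OF st(1)] pos[OF st(2)]] .
    also have "\<dots> \<le> ennreal (D' * spread s t powr A') * F (\<sigma> t)"
    proof (intro mult_right_mono ennreal_leI)
      have "spread (\<sigma> s) (\<sigma> t) powr A \<le> (E * spread s t powr (3 / 2)) powr A"
        using spread_\<sigma>[OF st] spread_ge_1[OF pos[OF st(1)] pos[OF st(2)]] D by (intro powr_mono2) auto
      also have "\<dots> = E powr A * spread s t powr A'"
        using E(1) by (simp add: powr_mult powr_powr A'_def)
      finally show "D * spread (\<sigma> s) (\<sigma> t) powr A \<le> D' * spread s t powr A'"
        using D by (simp add: D'_def mult.assoc)
    qed simp
    finally show "F (\<sigma> s) \<le> ennreal (D' * spread s t powr A') * F (\<sigma> t)" .
  qed
  \<comment> \<open>\<open>\<sigma>(N t) \<ge> N\<^sup>1\<^sup>/\<^sup>2 \<sigma>(t)/E\<close>, and \<open>N\<close> makes this factor equal to 2.\<close>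
  define N where "N = (2 * E)\<^sup>2"
  have N: "4 \<le> N" "N powr (1 / 2) = 2 * E"
  proof -
    have "2\<^sup>2 \<le> (2 * E)\<^sup>2" using E by (intro power_mono) auto
    then show "4 \<le> N" by (simp add: N_def)
    show "N powr (1 / 2) = 2 * E" using E powr_half_sqrt[of N] real_sqrt_abs[of "2 * E"] by (simp only: N_def) simp
  qed
  define M where "M = E * N powr (3 / 2)"
  have "N powr 1 \<le> N powr (3 / 2)" using N by (intro powr_mono) auto
  then have NM: "N \<le> M" using E N mult_mono[of 1 E N "N powr (3 / 2)"] by (simp add: M_def)
  define x where "x k = N powr real_of_int k" for k :: int
  have x: "0 < x k" "x (k + 1) = N * x k" for k using N by (auto simp: x_def powr_add)
  have lac1: "lacunary M (\<lambda>n. x (int_decode n))"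
  proof (rule lacunary_int)
    fix k
    show "2 * x k \<le> x (k + 1)" "x (k + 1) \<le> M * x k"
      using N NM x[of k] by (auto intro: mult_right_mono)
  qed (rule x)
  have lac2: "lacunary M (\<lambda>n. \<sigma> (x (int_decode n)))"
  proof (rule lacunary_int[of "\<lambda>k. \<sigma> (x k)"])
    fix k
    have oN: "spread (x k) (N * x k) = N" using x[of k] N by (subst spread_le) auto
    have Nx: "0 < N * x k" using x(1)[of k] N by simp
    show "0 < \<sigma> (x k)" using pos x by simp
    show "\<sigma> (x (k + 1)) \<le> M * \<sigma> (x k)"
      using grow[OF Nx x(1)[of k]] by (simp add: x(2) spread_commute[of "N * x k"] oN M_def)
    have "l (x k) \<le> E * N powr (1 / 2) * l (N * x k)" using E(2)[OF x(1)[of k] Nx] by (simp add: oN)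
    then have "2 * \<sigma> (x k) \<le> 2 * (x k * (E * N powr (1 / 2) * l (N * x k)))"
      using x(1)[of k] by (simp add: \<sigma>_def)
    also have "\<dots> = (2 * E)\<^sup>2 * x k * l (N * x k)" unfolding N(2) by (simp add: power2_eq_square)
    finally show "2 * \<sigma> (x k) \<le> \<sigma> (x (k + 1))" by (simp add: x(2) \<sigma>_def N_def)
  qed
  have M1: "1 \<le> M" using N NM by simp
  have DD: "0 \<le> D" "0 \<le> D'" using D D' by auto
  obtain C1 where C1: "0 < C1" "\<And>F x. tame D A F \<Longrightarrow> lacunary M x \<Longrightarrow> mnorm q {0<..} F \<le> ennreal C1 * seq_norm q (\<lambda>n. F (x n))"
    using discretize_upper[OF q DD(1) D(2) M1] by blast
  obtain C2 where C2: "0 < C2" "\<And>F x. tame D' A' F \<Longrightarrow> lacunary M x \<Longrightarrow> seq_norm q (\<lambda>n. F (x n)) \<le> ennreal C2 * mnorm q {0<..} F"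
    using discretize_lower[OF q D'] by blast
  obtain C3 where C3: "0 < C3" "\<And>F x. tame D' A' F \<Longrightarrow> lacunary M x \<Longrightarrow> mnorm q {0<..} F \<le> ennreal C3 * seq_norm q (\<lambda>n. F (x n))"
    using discretize_upper[OF q DD(2) D'(2) M1] by blast
  obtain C4 where C4: "0 < C4" "\<And>F x. tame D A F \<Longrightarrow> lacunary M x \<Longrightarrow> seq_norm q (\<lambda>n. F (x n)) \<le> ennreal C4 * mnorm q {0<..} F"
    using discretize_lower[OF q D] by blast
  define C where "C = max (C1 * C2) (C3 * C4)"
  show ?thesis
  proof (rule that[of C])
    fix F assume F: "tame D A F"
    let ?G = "\<lambda>t. F (\<sigma> t)"
    have "mnorm q {0<..} F \<le> ennreal C1 * seq_norm q (\<lambda>n. ?G (x (int_decode n)))"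
      by (rule C1(2)[OF F lac2])
    also have "\<dots> \<le> ennreal C1 * (ennreal C2 * mnorm q {0<..} ?G)"
      by (intro mult_left_mono C2(2)[OF tame[OF F] lac1]) auto
    also have "\<dots> = ennreal (C1 * C2) * mnorm q {0<..} ?G" using C1 by (simp add: ennreal_mult' mult.assoc)
    also have "\<dots> \<le> ennreal C * mnorm q {0<..} ?G" by (intro mult_right_mono ennreal_leI) (auto simp: C_def)
    finally show "mnorm q {0<..} F \<le> ennreal C * mnorm q {0<..} (\<lambda>t. F (t * l t))" by (simp add: \<sigma>_def)
    have "mnorm q {0<..} ?G \<le> ennreal C3 * seq_norm q (\<lambda>n. ?G (x (int_decode n)))"
      by (rule C3(2)[OF tame[OF F] lac1])
    also have "\<dots> \<le> ennreal C3 * (ennreal C4 * mnorm q {0<..} F)"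
      by (intro mult_left_mono C4(2)[OF F lac2]) auto
    also have "\<dots> = ennreal (C3 * C4) * mnorm q {0<..} F" using C3 by (simp add: ennreal_mult' mult.assoc)
    also have "\<dots> \<le> ennreal C * mnorm q {0<..} F" by (intro mult_right_mono ennreal_leI) (auto simp: C_def)
    finally show "mnorm q {0<..} (\<lambda>t. F (t * l t)) \<le> ennreal C * mnorm q {0<..} F" by (simp add: \<sigma>_def)
  qed (use C1 C2 in \<open>simp add: C_def less_max_iff_disj\<close>)
qed

section \<open>A Hardy inequality for suprema\<close>

text \<open>
  A measurable function comparable to a given tame one: it is constant on \<open>[2\<^sup>k, 2\<^sup>k\<^sup>+\<^sup>1)\<close>. It serves as
  a substitute wherever measurability is required of a weight composed with \<open>\<rho>\<close>.
\<close>

definition step :: "(real \<Rightarrow> ennreal) \<Rightarrow> real \<Rightarrow> ennreal" where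
  "step F t = F (2 powr real_of_int \<lfloor>log 2 t\<rfloor>)"

lemma step_meas: "meas (step F)"
proof (rule meas_borel)
  have "(\<lambda>t::real. \<lfloor>log 2 t\<rfloor>) \<in> borel \<rightarrow>\<^sub>M count_space UNIV" by measurable
  moreover have "(\<lambda>k::int. F (2 powr real_of_int k)) \<in> count_space UNIV \<rightarrow>\<^sub>M borel" by simp
  ultimately show "step F \<in> borel_measurable borel"
    unfolding step_def[abs_def] by (rule measurable_compose)
qed

lemma step_near:
  assumes "tame D A F" "0 \<le> D" "0 \<le> A" "0 < t"
  shows "F t \<le> ennreal (D * 2 powr A) * step F t" "step F t \<le> ennreal (D * 2 powr A) * F t"
proof -
  let ?s = "2 powr real_of_int \<lfloor>log 2 t\<rfloor>"
  have t: "t = 2 powr log 2 t" using assms by simp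
  have 1: "?s \<le> t" by (subst (2) t, intro powr_mono) auto
  have "t \<le> 2 powr (real_of_int \<lfloor>log 2 t\<rfloor> + 1)" by (subst (1) t, intro powr_mono) auto
  then have 2: "t \<le> 2 * ?s" by (simp add: powr_add)
  have s: "0 < ?s" by simp
  show "F t \<le> ennreal (D * 2 powr A) * step F t" "step F t \<le> ennreal (D * 2 powr A) * F t"
    using tame_near[OF assms(1-3) s 1 2] by (auto simp: step_def)
qed

lemma mnorm_step:
  assumes "0 < q" "tame D A F" "1 \<le> D" "0 \<le> A"
  shows "mnorm q {0<..} (step F) \<le> ennreal (D * 2 powr A) * mnorm q {0<..} F"
proof -
  have "mnorm q {0<..} (step F) \<le> mnorm q {0<..} (\<lambda>u. ennreal (D * 2 powr A) * F u)"
    using assms by (intro mnorm_mono step_near(2)) auto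
  also have "\<dots> \<le> ennreal (D * 2 powr A) * mnorm q {0<..} F" using assms by (intro mnorm_cmult_le) auto
  finally show ?thesis .
qed

text \<open>
  The dilates \<open>F(2\<^sup>j t)\<close> and \<open>F(2\<^sup>-\<^sup>j t)\<close> have the same norm as \<open>F\<close> up to constants, and the
  supremum is dominated by these dilates with geometrically decaying factors.
\<close>

lemma hardy_sup:
  assumes q: "0 < q" and d: "0 < d" and D: "1 \<le> D" "0 \<le> A"
  obtains C where "0 < C" "\<And>F. tame D A F \<Longrightarrow>
     mnorm q {0<..} (\<lambda>t. SUP u\<in>{0<..}. ennreal (spread u t powr (- d)) * F u) \<le> ennreal C * mnorm q {0<..} F"
proof -
  obtain C1 where C1: "0 < C1" "\<And>S (g :: nat \<Rightarrow> real \<Rightarrow> ennreal). pos_set S \<Longrightarrow> (\<And>j. meas (g j)) \<Longrightarrow>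
    mnorm q S (\<lambda>u. SUP j. ennreal (2 powr (- d * real j)) * g j u) \<le> ennreal C1 * (SUP j. mnorm q S (g j))"
    using mnorm_SUP[OF q d] by blast
  define E where "E = D * 2 powr A"
  have E: "0 < E" and D0: "0 \<le> D" using D by (simp_all add: E_def)
  let ?T = "triangle_const q"
  have T: "0 < ?T" using triangle_const_ge_1[of q] by simp
  show ?thesis
  proof (rule that[of "E * E * C1 * ?T * 2 * E"])
    fix F assume F: "tame D A F"
    let ?S = "\<lambda>t. SUP u\<in>{0<..}. ennreal (spread u t powr (- d)) * F u"
    define g where "g j t = step F (2 powr (- real j) * t) + step F (2 powr real j * t)" for j :: nat and t
    have meas: "meas (\<lambda>t. step F (c * t))" if "0 < c" for c by (rule meas_scale[OF step_meas that])
    have meas_g: "meas (g j)" for j unfolding g_def by (intro borel_measurable_add meas) auto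
    have near: "F u \<le> ennreal (E * E) * g j t"
      if j: "u \<in> {2 powr (- real j) * t / 2..2 powr (- real j) * t} \<union> {2 powr real j * t..2 * (2 powr real j * t)}"
        and u: "0 < u" and t: "0 < t" for u t and j :: nat
    proof -
      have *: "F u \<le> ennreal (E * E) * step F w" if "F u \<le> ennreal E * F w" "0 < w" for w
      proof -
        have "ennreal E * F w \<le> ennreal E * (ennreal E * step F w)"
          using step_near(1)[OF F D0 D(2) that(2)] by (intro mult_left_mono) (auto simp: E_def)
        then show ?thesis using that(1) E by (simp add: ennreal_mult' mult.assoc order_trans)
      qed
      show ?thesis
      proof (cases "u \<in> {2 powr (- real j) * t / 2..2 powr (- real j) * t}")
        case True
        have "F u \<le> ennreal E * F (2 powr (- real j) * t)"
          unfolding E_def by (rule tame_near(1)[OF F D0 D(2) u]) (use True in auto)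
        then have "F u \<le> ennreal (E * E) * step F (2 powr (- real j) * t)" using t by (intro *) auto
        also have "\<dots> \<le> ennreal (E * E) * g j t" unfolding g_def by (intro mult_left_mono) (auto intro: add_increasing2)
        finally show ?thesis .
      next
        case False
        have "F u \<le> ennreal E * F (2 powr real j * t)"
          unfolding E_def by (rule tame_near(2)[OF F D0 D(2)]) (use False j t in auto)
        then have "F u \<le> ennreal (E * E) * step F (2 powr real j * t)" using t by (intro *) auto
        also have "\<dots> \<le> ennreal (E * E) * g j t" unfolding g_def by (intro mult_left_mono) (auto intro: add_increasing)
        finally show ?thesis .
      qed
    qed
    have "mnorm q {0<..} ?S \<le> mnorm q {0<..} (\<lambda>t. ennreal (E * E) * (SUP j. ennreal (2 powr (- d * real j)) * g j t))"
    proof (intro mnorm_mono SUP_least)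
      fix t u :: real assume "t \<in> {0<..}" "u \<in> {0<..}"
      then have tu: "0 < t" "0 < u" by auto
      obtain j :: nat where j: "2 powr real j \<le> spread u t"
        "u \<in> {2 powr (- real j) * t / 2..2 powr (- real j) * t} \<union> {2 powr real j * t..2 * (2 powr real j * t)}"
        by (rule spread_dyadic[OF tu(2,1)])
      have "spread u t powr (- d) \<le> (2 powr real j) powr (- d)"
        using j(1) d by (intro powr_mono2') auto
      then have "ennreal (spread u t powr (- d)) * F u \<le> ennreal (2 powr (- d * real j)) * (ennreal (E * E) * g j t)"
        by (intro mult_mono near[OF j(2) tu(2,1)] ennreal_leI) (auto simp: powr_powr mult.commute)
      also have "\<dots> = ennreal (E * E) * (ennreal (2 powr (- d * real j)) * g j t)" by (rule mult.left_commute)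
      also have "\<dots> \<le> ennreal (E * E) * (SUP j. ennreal (2 powr (- d * real j)) * g j t)"
        by (intro mult_left_mono SUP_upper) auto
      finally show "ennreal (spread u t powr (- d)) * F u \<le> ennreal (E * E) * (SUP j. ennreal (2 powr (- d * real j)) * g j t)" .
    qed (use q in auto)
    also have "\<dots> \<le> ennreal (E * E) * mnorm q {0<..} (\<lambda>t. SUP j. ennreal (2 powr (- d * real j)) * g j t)"
      using q by (intro mnorm_cmult_le) auto
    also have "\<dots> \<le> ennreal (E * E) * (ennreal C1 * (SUP j. mnorm q {0<..} (g j)))"
      by (intro mult_left_mono C1(2) meas_g) auto
    also have "\<dots> \<le> ennreal (E * E) * (ennreal C1 * (ennreal ?T * (ennreal 2 * (ennreal E * mnorm q {0<..} F))))"
    proof (intro mult_left_mono SUP_least)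
      fix j
      have dil: "mnorm q {0<..} (\<lambda>t. step F (c * t)) \<le> ennreal E * mnorm q {0<..} F" if "0 < c" for c
        unfolding E_def
        using mnorm_scale[of "{0<..}" "{0<..}" q c "step F"] mnorm_step[OF q F D] that q step_meas
        by (simp add: zero_less_mult_iff)
      have "mnorm q {0<..} (g j) \<le> ennreal ?T *
          (mnorm q {0<..} (\<lambda>t. step F (2 powr (- real j) * t)) + mnorm q {0<..} (\<lambda>t. step F (2 powr real j * t)))"
        unfolding g_def by (intro mnorm_add q meas) auto
      also have "\<dots> \<le> ennreal ?T * (ennreal E * mnorm q {0<..} F + ennreal E * mnorm q {0<..} F)"
        by (intro mult_left_mono add_mono dil) auto
      finally show "mnorm q {0<..} (g j) \<le> ennreal ?T * (ennreal 2 * (ennreal E * mnorm q {0<..} F))"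
        by (simp add: mult_2)
    qed auto
    also have "\<dots> = ennreal (E * E * C1 * ?T * 2 * E) * mnorm q {0<..} F"
      using E C1(1) T by (simp add: ennreal_mult' mult.assoc)
    finally show "mnorm q {0<..} ?S \<le> ennreal (E * E * C1 * ?T * 2 * E) * mnorm q {0<..} F" .
  qed (use E C1 T in simp)
qed

text \<open>
  The products with \<open>v\<close> may fail to be measurable; those with the comparable function \<open>step v\<close> do not.
\<close>

lemma mnorm_add_tame:
  assumes q: "0 < q" and D: "1 \<le> D" "0 \<le> A" and v: "tame D A v"
  obtains C where "0 < C" "\<And>f g. meas f \<Longrightarrow> meas g \<Longrightarrow>
    mnorm q {0<..} (\<lambda>t. v t * (f t + g t)) \<le> ennreal C * (mnorm q {0<..} (\<lambda>t. v t * f t) + mnorm q {0<..} (\<lambda>t. v t * g t))"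
proof -
  define C where "C = triangle_const q"
  have C: "0 < C" using triangle_const_ge_1[of q] by (simp add: C_def)
  define E where "E = D * 2 powr A"
  have E: "0 < E" using D by (simp add: E_def)
  have D0: "0 \<le> D" using D by simp
  have near: "v t \<le> ennreal E * step v t" "step v t \<le> ennreal E * v t" if "0 < t" for t
    using step_near[OF v D0 D(2) that] by (auto simp: E_def)
  have st: "mnorm q {0<..} (\<lambda>t. step v t * f t) \<le> ennreal E * mnorm q {0<..} (\<lambda>t. v t * f t)" for f
  proof -
    have "mnorm q {0<..} (\<lambda>t. step v t * f t) \<le> mnorm q {0<..} (\<lambda>t. ennreal E * (v t * f t))"
      unfolding mult.assoc[symmetric] using q near by (intro mnorm_mono mult_right_mono) auto
    also have "\<dots> \<le> ennreal E * mnorm q {0<..} (\<lambda>t. v t * f t)" using q E by (intro mnorm_cmult_le) auto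
    finally show ?thesis .
  qed
  show ?thesis
  proof (rule that[of "E * C * E"])
    fix f g assume m: "meas f" "meas g"
    have "mnorm q {0<..} (\<lambda>t. v t * (f t + g t)) \<le> mnorm q {0<..} (\<lambda>t. ennreal E * (step v t * f t + step v t * g t))"
      unfolding distrib_left[symmetric] mult.assoc[symmetric]
      using q near by (intro mnorm_mono mult_right_mono) auto
    also have "\<dots> \<le> ennreal E * mnorm q {0<..} (\<lambda>t. step v t * f t + step v t * g t)"
      using q E by (intro mnorm_cmult_le) auto
    also have "\<dots> \<le> ennreal E * (ennreal C * (mnorm q {0<..} (\<lambda>t. step v t * f t) + mnorm q {0<..} (\<lambda>t. step v t * g t)))"
      unfolding C_def using m q by (intro mult_left_mono mnorm_add borel_measurable_times_ennreal step_meas) auto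
    also have "\<dots> \<le> ennreal E * (ennreal C * (ennreal E * mnorm q {0<..} (\<lambda>t. v t * f t) + ennreal E * mnorm q {0<..} (\<lambda>t. v t * g t)))"
      by (intro mult_left_mono add_mono st) auto
    also have "\<dots> = ennreal (E * C * E) * (mnorm q {0<..} (\<lambda>t. v t * f t) + mnorm q {0<..} (\<lambda>t. v t * g t))"
      using E C by (simp add: ennreal_mult' mult.assoc distrib_left)
    finally show "mnorm q {0<..} (\<lambda>t. v t * (f t + g t)) \<le> ennreal (E * C * E) * (mnorm q {0<..} (\<lambda>t. v t * f t) + mnorm q {0<..} (\<lambda>t. v t * g t))" .
  qed (use E C in simp)
qed

section \<open>Identification of the interpolation spaces\<close>

lemma quasiconcave_tame: "quasiconcave k \<Longrightarrow> tame 1 1 k"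
  unfolding tame_def
proof (intro allI impI)
  fix s t :: real assume k: "quasiconcave k" and st: "0 < s" "0 < t"
  show "k s \<le> ennreal (1 * spread s t powr 1) * k t"
  proof (cases "s \<le> t")
    case True
    have "k s \<le> 1 * k t" using quasiconcave_mono[OF k st(1) True] by simp
    also have "\<dots> \<le> ennreal (1 * spread s t powr 1) * k t"
      using spread_ge_1[OF st] by (intro mult_right_mono) (auto simp flip: ennreal_1 intro!: ennreal_leI simp del: ennreal_1)
    finally show ?thesis .
  next
    case False
    then show ?thesis using quasiconcave_scale[OF k st(2), of s] st by (simp add: spread_commute[of s] spread_le)
  qed
qed

text \<open>
  Outside the sum space the K-functional is infinite, and so is its norm; the restriction in the definition
  is therefore automatic.
\<close>

lemma interp_eq_wnorm:
  assumes "0 < r" "slow a"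
  shows "interp N0 N1 \<theta> r a f = wnorm \<theta> r a {0<..} (\<lambda>u. Kfun N0 N1 u f)"
proof (cases "f \<in> sum_space N0 N1")
  case False
  have sub: "{1<..<2 * 1} \<subseteq> {(0::real)<..}" by auto
  have "wnorm \<theta> r a {0<..} (\<lambda>_. top) = top * wnorm \<theta> r a {0<..} (\<lambda>_. 1)"
    by (rule wnorm_const[of _ _ _ 1]) (use assms in auto)
  also have "\<dots> = top"
    using wnorm_one_pos[OF assms pos_setI(1) zero_less_one sub, of \<theta>] by (simp add: ennreal_top_mult)
  finally have "wnorm \<theta> r a {0<..} (\<lambda>_. top) = top" .
  then show ?thesis using False by (simp add: interp_def restrict_norm_def Kfun_outside)
qed (simp add: interp_def restrict_norm_def)

text \<open>
  An inequality for all \<open>f\<close>, read in \<open>[0,\<infinity>]\<close>, contains the inclusion of the spaces.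
\<close>

lemma cont_embeddedI:
  assumes "0 < C" "\<And>f. M f \<le> ennreal C * N f"
  shows "cont_embedded N M"
  unfolding cont_embedded_def qspace_def using assms
  by (auto intro!: exI[of _ C] le_less_trans[OF assms(2)] simp: ennreal_mult_less_top)

locale holmstedt_outer = holmstedt +
  fixes r :: ennreal and a :: "real \<Rightarrow> real"
  assumes r: "0 < r" and a: "slow a"
begin

definition asharp :: "real \<Rightarrow> real \<Rightarrow> real" where
  "asharp \<theta> t = chi0 t powr (1 - \<theta>) * chi1 t powr \<theta> * a (rho t)"

text \<open>
  The weight \<open>u\<^sup>-\<^sup>\<theta> a(u)\<close> of the outer interpolation method after the substitution \<open>u = \<rho>(t)\<close>.
\<close>

definition outer :: "real \<Rightarrow> real \<Rightarrow> real" where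
  "outer \<theta> t = rho t powr (- \<theta>) * a (rho t)"

lemma slow_ratio: "slow (\<lambda>t. chi0 t / chi1 t)"
  using slow_mult[OF slow_chi(1) slow_inverse[OF slow_chi(2)]] by simp

lemma slow_a_rho: "slow (\<lambda>t. a (rho t))"
  unfolding rho_def by (rule slow_compose[OF a slow_ratio])

lemma slow_asharp: "slow (asharp \<theta>)"
  unfolding asharp_def[abs_def] by (intro slow_mult slow_powr slow_chi slow_a_rho)

lemma outer_pos: "0 < t \<Longrightarrow> 0 < outer \<theta> t"
  using chi_pos(3)[of t] slow_pos[OF a, of "rho t"] by (simp add: outer_def)

lemma outer_chi0: "0 < t \<Longrightarrow> outer \<theta> t * chi0 t = t powr (- \<theta>) * asharp \<theta> t"
proof -
  assume t: "0 < t"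
  note p = chi_pos[OF t]
  have "rho t powr (- \<theta>) * chi0 t = t powr (- \<theta>) * ((chi0 t powr (- \<theta>) * chi0 t powr 1) * chi1 t powr \<theta>)"
    using t p by (simp add: rho_def powr_mult powr_divide powr_minus field_simps)
  also have "chi0 t powr (- \<theta>) * chi0 t powr 1 = chi0 t powr (1 - \<theta>)"
    by (subst powr_add[symmetric]) simp
  finally have "rho t powr (- \<theta>) * chi0 t = t powr (- \<theta>) * (chi0 t powr (1 - \<theta>) * chi1 t powr \<theta>)" .
  then show ?thesis by (simp add: outer_def asharp_def algebra_simps)
qed

lemma outer_tame:
  obtains D A where "1 \<le> D" "0 \<le> A" "tame D A (\<lambda>t. ennreal (outer \<theta> t))"
proof -
  have "slow (\<lambda>t. (chi0 t / chi1 t) powr (- \<theta>) * a (rho t))"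
    by (intro slow_mult slow_powr slow_ratio slow_a_rho)
  then obtain D where D: "1 \<le> D" "tame D 1 (\<lambda>t. ennreal ((chi0 t / chi1 t) powr (- \<theta>) * a (rho t)))"
    using slow_tame zero_less_one by blast
  have t: "tame (1 * D) (\<bar>- \<theta>\<bar> + 1) (\<lambda>t. ennreal (t powr (- \<theta>)) * ennreal ((chi0 t / chi1 t) powr (- \<theta>) * a (rho t)))"
    by (rule tame_mult[OF tame_powr D(2)]) (use D in auto)
  have e: "ennreal (t powr (- \<theta>)) * ennreal ((chi0 t / chi1 t) powr (- \<theta>) * a (rho t)) = ennreal (outer \<theta> t)" if "0 < t" for t
    using that chi_pos[OF that] slow_pos[OF a chi_pos(3)[OF that]]
    by (subst ennreal_mult'[symmetric]) (auto simp: outer_def rho_def powr_mult powr_divide mult.assoc)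
  show ?thesis
    by (rule that[of D "\<bar>- \<theta>\<bar> + 1"]) (use t D e in \<open>auto simp: tame_def\<close>)
qed

text \<open>
  The outer norms of the four summands of \<open>holmstedt_sum\<close>. \<open>Ndiag\<close> is the norm of
  \<open>interp A0 A1 \<theta> r (asharp \<theta>)\<close>, see \<open>Ndiag_interp\<close>.
\<close>

definition Nlow :: "real \<Rightarrow> (real \<Rightarrow> ennreal) \<Rightarrow> ennreal" where
  "Nlow \<theta> k = mnorm r {0<..} (\<lambda>t. ennreal (outer \<theta> t) * L0.low t k)"
definition Nmid :: "real \<Rightarrow> (real \<Rightarrow> ennreal) \<Rightarrow> ennreal" where
  "Nmid \<theta> k = mnorm r {0<..} (\<lambda>t. ennreal (outer \<theta> t) * L0.mid t k)"
definition Ndiag :: "real \<Rightarrow> (real \<Rightarrow> ennreal) \<Rightarrow> ennreal" where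
  "Ndiag \<theta> k = mnorm r {0<..} (\<lambda>t. ennreal (outer \<theta> t) * (ennreal (chi0 t) * k t))"
definition Nhigh :: "real \<Rightarrow> (real \<Rightarrow> ennreal) \<Rightarrow> ennreal" where
  "Nhigh \<theta> k = mnorm r {0<..} (\<lambda>t. ennreal (outer \<theta> t) * (ennreal (rho t) * L1.high t k))"
definition Nsum :: "real \<Rightarrow> (real \<Rightarrow> ennreal) \<Rightarrow> ennreal" where
  "Nsum \<theta> k = mnorm r {0<..} (\<lambda>t. ennreal (outer \<theta> t) * holmstedt_sum t k)"

lemma parts_le_Nsum: "Nlow \<theta> k \<le> Nsum \<theta> k" "Nmid \<theta> k \<le> Nsum \<theta> k" "Ndiag \<theta> k \<le> Nsum \<theta> k" "Nhigh \<theta> k \<le> Nsum \<theta> k"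
  unfolding Nlow_def Nmid_def Ndiag_def Nhigh_def Nsum_def holmstedt_sum_def
  by (rule mnorm_mono[OF pos_setI(1) r], rule mult_left_mono, auto intro: add_increasing add_increasing2)+

lemma Nsum_le:
  obtains C where "0 < C" "\<And>k. quasiconcave k \<Longrightarrow> Nsum \<theta> k \<le> ennreal C * (Nlow \<theta> k + Nmid \<theta> k + Ndiag \<theta> k + Nhigh \<theta> k)"
proof -
  obtain D A where D: "1 \<le> D" "0 \<le> A" "tame D A (\<lambda>t. ennreal (outer \<theta> t))" using outer_tame by blast
  let ?v = "\<lambda>t. ennreal (outer \<theta> t)"
  obtain C where C: "0 < C" "\<And>f g. meas f \<Longrightarrow> meas g \<Longrightarrow>
    mnorm r {0<..} (\<lambda>t. ?v t * (f t + g t)) \<le> ennreal C * (mnorm r {0<..} (\<lambda>t. ?v t * f t) + mnorm r {0<..} (\<lambda>t. ?v t * g t))"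
    using mnorm_add_tame[OF r D] by blast
  \<comment> \<open>With \<open>E \<ge> 1\<close> the same power of the constant can be put in front of all four terms.\<close>
  define E where "E = max 1 C"
  have E: "1 \<le> E" "C \<le> E" by (auto simp: E_def)
  have C': "mnorm r {0<..} (\<lambda>t. ?v t * (f t + g t)) \<le> ennreal E * (mnorm r {0<..} (\<lambda>t. ?v t * f t) + mnorm r {0<..} (\<lambda>t. ?v t * g t))"
    if "meas f" "meas g" for f g
    using C(2)[OF that] mult_right_mono[OF ennreal_leI[OF E(2)]] by (rule order_trans) simp
  have E1: "x \<le> ennreal E * x" for x
    using mult_right_mono[OF ennreal_leI[OF E(1)], of x] by simp
  show ?thesis
  proof (rule that[of "E * (E * E)"])
    fix k assume k: "quasiconcave k"
    have rho: "meas (\<lambda>t. ennreal (rho t))"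
    proof -
      have m: "meas (\<lambda>t. ennreal t * ennreal (chi0 t) / ennreal (chi1 t))"
        by (intro borel_measurable_divide_ennreal borel_measurable_times_ennreal meas_chi meas_borel) simp
      have "ennreal t * ennreal (chi0 t) / ennreal (chi1 t) = ennreal (rho t)" if "0 < t" for t
        using that chi_pos[OF that] by (simp add: rho_def divide_ennreal flip: ennreal_mult')
      then have "meas (\<lambda>t. ennreal t * ennreal (chi0 t) / ennreal (chi1 t)) \<longleftrightarrow> meas (\<lambda>t. ennreal (rho t))"
        by (intro measurable_cong) simp
      with m show ?thesis by blast
    qed
    have m: "meas (\<lambda>t. L0.low t k)" "meas (\<lambda>t. L0.mid t k)" "meas (\<lambda>t. ennreal (chi0 t) * k t)" "meas (\<lambda>t. ennreal (rho t) * L1.high t k)"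
      using L0.meas_parts L1.meas_parts meas_chi(1) rho quasiconcave_meas[OF k] by (auto intro: borel_measurable_times_ennreal)
    have m2: "meas (\<lambda>t. L0.low t k + L0.mid t k)" "meas (\<lambda>t. L0.low t k + L0.mid t k + ennreal (chi0 t) * k t)"
      using m by (auto intro: borel_measurable_add)
    have "Nsum \<theta> k \<le> ennreal E * (mnorm r {0<..} (\<lambda>t. ?v t * (L0.low t k + L0.mid t k + ennreal (chi0 t) * k t)) + Nhigh \<theta> k)"
      unfolding Nsum_def Nhigh_def holmstedt_sum_def by (rule C'[OF m2(2) m(4)])
    also have "\<dots> \<le> ennreal E * (ennreal E * (mnorm r {0<..} (\<lambda>t. ?v t * (L0.low t k + L0.mid t k)) + Ndiag \<theta> k) + Nhigh \<theta> k)"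
      unfolding Ndiag_def by (intro mult_left_mono add_right_mono C'[OF m2(1) m(3)]) simp
    also have "\<dots> \<le> ennreal E * (ennreal E * (ennreal E * (Nlow \<theta> k + Nmid \<theta> k) + Ndiag \<theta> k) + Nhigh \<theta> k)"
      unfolding Nlow_def Nmid_def by (intro mult_left_mono add_right_mono C'[OF m(1) m(2)]) simp_all
    also have "\<dots> \<le> ennreal E * (ennreal E * (ennreal E * (Nlow \<theta> k + Nmid \<theta> k) + ennreal E * Ndiag \<theta> k) + ennreal E * (ennreal E * Nhigh \<theta> k))"
      by (intro mult_left_mono add_mono order_refl E1 order_trans[OF E1 mult_left_mono[OF E1]]) simp_all
    also have "\<dots> = ennreal (E * (E * E)) * (Nlow \<theta> k + Nmid \<theta> k + Ndiag \<theta> k + Nhigh \<theta> k)"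
      using E(1) by (simp add: ennreal_mult' distrib_left mult.assoc)
    finally show "Nsum \<theta> k \<le> ennreal (E * (E * E)) * (Nlow \<theta> k + Nmid \<theta> k + Ndiag \<theta> k + Nhigh \<theta> k)" .
  qed (use E in simp)
qed

lemma diag_tame:
  obtains D A where "1 \<le> D" "0 \<le> A" "\<And>k. quasiconcave k \<Longrightarrow> tame D A (\<lambda>t. ennreal (t powr (- \<theta>) * asharp \<theta> t) * k t)"
proof -
  obtain D where D: "1 \<le> D" "tame D 1 (\<lambda>t. ennreal (asharp \<theta> t))"
    using slow_tame[OF slow_asharp zero_less_one] by blast
  have "tame (1 * D) (\<bar>- \<theta>\<bar> + 1) (\<lambda>t. ennreal (t powr (- \<theta>)) * ennreal (asharp \<theta> t))"
    by (rule tame_mult[OF tame_powr D(2)]) (use D in auto)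
  then have 1: "tame D (\<bar>- \<theta>\<bar> + 1) (\<lambda>t. ennreal (t powr (- \<theta>) * asharp \<theta> t))"
    by (simp add: ennreal_mult')
  have D0: "0 \<le> D" "0 \<le> (1::real)" using D by auto
  show ?thesis
  proof (rule that[OF D(1)])
    fix k assume "quasiconcave k"
    show "tame D (\<bar>- \<theta>\<bar> + 1 + 1) (\<lambda>t. ennreal (t powr (- \<theta>) * asharp \<theta> t) * k t)"
      using tame_mult[OF 1 quasiconcave_tame[OF \<open>quasiconcave k\<close>] D0] by simp
  qed simp
qed

lemma Ndiag_eq: "Ndiag \<theta> k = mnorm r {0<..} (\<lambda>t. ennreal (t powr (- \<theta>) * asharp \<theta> t) * k t)"
  unfolding Ndiag_def
proof (rule mnorm_cong[OF pos_setI(1) r])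
  fix t :: real assume "t \<in> {0<..}"
  then have t: "0 < t" by simp
  show "ennreal (outer \<theta> t) * (ennreal (chi0 t) * k t) = ennreal (t powr (- \<theta>) * asharp \<theta> t) * k t"
    unfolding outer_chi0[OF t, symmetric] using outer_pos[OF t, of \<theta>] by (simp add: ennreal_mult' mult.assoc)
qed

lemma le_of_weighted_le:
  fixes x y :: ennreal
  assumes "0 < p" "ennreal p * x \<le> y"
  shows "x \<le> y * ennreal (1 / p)"
proof -
  have "x = ennreal (1 / p) * (ennreal p * x)" using assms by (simp flip: mult.assoc ennreal_mult'')
  also have "\<dots> \<le> ennreal (1 / p) * y" by (intro mult_left_mono assms) simp
  finally show ?thesis by (simp only: mult.commute)
qed

text \<open>
  With \<open>G(u) = u\<^sup>-\<^sup>\<theta> a\<^sup>#(u) k(u)\<close>, the function \<open>S(t)\<close> is the supremum of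
  \<open>spread(u,t)\<^sup>-\<^sup>d G(u)\<close> over \<open>u\<close>. It bounds \<open>k\<close> by a power times a slowly varying function on either side
  of \<open>t\<close>, while its norm is at most a multiple of that of \<open>G\<close>.
\<close>

lemma hardy_majorant:
  assumes d: "0 < d"
  obtains C where "0 < C" "\<And>k. quasiconcave k \<Longrightarrow> \<exists>S. mnorm r {0<..} S \<le> ennreal C * Ndiag \<theta> k \<and>
    (\<forall>t>0. \<forall>u>0. k u \<le> S t * ennreal (spread u t powr d * u powr \<theta> / asharp \<theta> u))"
proof -
  obtain D A where D: "1 \<le> D" "0 \<le> A" "\<And>k. quasiconcave k \<Longrightarrow> tame D A (\<lambda>t. ennreal (t powr (- \<theta>) * asharp \<theta> t) * k t)"
    using diag_tame by blast
  obtain C where C: "0 < C" "\<And>F. tame D A F \<Longrightarrow>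
     mnorm r {0<..} (\<lambda>t. SUP u\<in>{0<..}. ennreal (spread u t powr (- d)) * F u) \<le> ennreal C * mnorm r {0<..} F"
    using hardy_sup[OF r d D(1,2)] by blast
  show ?thesis
  proof (rule that[OF C(1)])
    fix k assume k: "quasiconcave k"
    let ?F = "\<lambda>t. ennreal (t powr (- \<theta>) * asharp \<theta> t) * k t"
    define S where "S t = (SUP u\<in>{0<..}. ennreal (spread u t powr (- d)) * ?F u)" for t
    have "k u \<le> S t * ennreal (spread u t powr d * u powr \<theta> / asharp \<theta> u)" if tu: "0 < t" "0 < u" for t u
    proof -
      have p: "0 < spread u t" "0 < asharp \<theta> u" using spread_ge_1[OF tu(2,1)] slow_pos[OF slow_asharp tu(2)] by auto
      have "ennreal (spread u t powr (- d)) * ?F u \<le> S t" unfolding S_def using tu by (intro SUP_upper) auto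
      then have "ennreal (spread u t powr (- d) * (u powr (- \<theta>) * asharp \<theta> u)) * k u \<le> S t"
        by (simp add: ennreal_mult' mult.assoc)
      then have "k u \<le> S t * ennreal (1 / (spread u t powr (- d) * (u powr (- \<theta>) * asharp \<theta> u)))"
        using tu p by (intro le_of_weighted_le) auto
      also have "1 / (spread u t powr (- d) * (u powr (- \<theta>) * asharp \<theta> u)) = spread u t powr d * u powr \<theta> / asharp \<theta> u"
        using tu p by (simp add: powr_minus field_simps)
      finally show ?thesis .
    qed
    moreover have "mnorm r {0<..} S \<le> ennreal C * Ndiag \<theta> k"
      unfolding S_def[abs_def] Ndiag_eq by (rule C(2)[OF D(3)[OF k]])
    ultimately show "\<exists>S. mnorm r {0<..} S \<le> ennreal C * Ndiag \<theta> k \<and>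
      (\<forall>t>0. \<forall>u>0. k u \<le> S t * ennreal (spread u t powr d * u powr \<theta> / asharp \<theta> u))" by blast
  qed
qed

lemma outer_asharp: "0 < t \<Longrightarrow> outer \<theta> t * (t powr \<theta> * (1 / asharp \<theta> t) * chi0 t) = 1"
proof -
  assume t: "0 < t"
  have "outer \<theta> t * (t powr \<theta> * (1 / asharp \<theta> t) * chi0 t) = (outer \<theta> t * chi0 t) * t powr \<theta> / asharp \<theta> t"
    by simp
  also have "\<dots> = 1"
    unfolding outer_chi0[OF t] using t slow_pos[OF slow_asharp t, of \<theta>] by (simp add: powr_minus)
  finally show ?thesis .
qed

text \<open>
  Below \<open>t\<close> the majorant reads \<open>k(u) \<le> S(t) t\<^sup>d u\<^sup>\<theta>\<^sup>-\<^sup>d/a\<^sup>#(u)\<close>. The power \<open>\<theta> - d\<close> is positive for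
  small \<open>d\<close> exactly because \<open>\<theta> > 0\<close>, and then \<open>low_mid_bound\<close> applies.
\<close>

lemma low_mid_hardy:
  assumes "0 < \<theta>"
  obtains C where "0 < C" "\<And>k. quasiconcave k \<Longrightarrow> Nlow \<theta> k \<le> ennreal C * Ndiag \<theta> k" "\<And>k. quasiconcave k \<Longrightarrow> Nmid \<theta> k \<le> ennreal C * Ndiag \<theta> k"
proof -
  \<comment> \<open>Any \<open>d\<close> strictly between \<open>0\<close> and \<open>\<theta>\<close> will do.\<close>
  define d where "d = \<theta> / 2"
  have d: "0 < d" "0 < \<theta> - d" using assms by (auto simp: d_def)
  obtain C1 where C1: "0 < C1" "\<And>k. quasiconcave k \<Longrightarrow> \<exists>S. mnorm r {0<..} S \<le> ennreal C1 * Ndiag \<theta> k \<and>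
    (\<forall>t>0. \<forall>u>0. k u \<le> S t * ennreal (spread u t powr d * u powr \<theta> / asharp \<theta> u))"
    using hardy_majorant[OF d(1)] by blast
  obtain C2 where C2: "0 < C2" "\<And>t Z k. 0 < t \<Longrightarrow> (\<And>u. 0 < u \<Longrightarrow> u < t \<Longrightarrow> k u \<le> Z * ennreal (u powr (\<theta> - d) * (1 / asharp \<theta> u))) \<Longrightarrow>
    L0.low t k + L0.mid t k \<le> ennreal C2 * (Z * ennreal (t powr (\<theta> - d) * (1 / asharp \<theta> t) * chi0 t))"
    using low_mid_bound[OF slow_inverse[OF slow_asharp] d(2)] by blast
  have main: "mnorm r {0<..} (\<lambda>t. ennreal (outer \<theta> t) * (L0.low t k + L0.mid t k)) \<le> ennreal (C2 * C1) * Ndiag \<theta> k"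
    if k: "quasiconcave k" for k
  proof -
    obtain S where S: "mnorm r {0<..} S \<le> ennreal C1 * Ndiag \<theta> k"
      "\<And>t u. 0 < t \<Longrightarrow> 0 < u \<Longrightarrow> k u \<le> S t * ennreal (spread u t powr d * u powr \<theta> / asharp \<theta> u)"
      using C1(2)[OF k] by blast
    have "mnorm r {0<..} (\<lambda>t. ennreal (outer \<theta> t) * (L0.low t k + L0.mid t k)) \<le> mnorm r {0<..} (\<lambda>t. ennreal C2 * S t)"
    proof (rule mnorm_mono[OF pos_setI(1) r])
      fix t :: real assume "t \<in> {0<..}"
      then have t: "0 < t" by simp
      have "k u \<le> (S t * ennreal (t powr d)) * ennreal (u powr (\<theta> - d) * (1 / asharp \<theta> u))" if u: "0 < u" "u < t" for u
      proof -
        have "spread u t powr d * u powr \<theta> / asharp \<theta> u = t powr d * (u powr (\<theta> - d) * (1 / asharp \<theta> u))"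
          using u by (simp add: spread_le powr_divide powr_diff)
        then show ?thesis using S(2)[OF t u(1)] by (simp only: mult.assoc ennreal_mult'[OF powr_ge_zero])
      qed
      then have "L0.low t k + L0.mid t k \<le> ennreal C2 * ((S t * ennreal (t powr d)) * ennreal (t powr (\<theta> - d) * (1 / asharp \<theta> t) * chi0 t))"
        by (rule C2(2)[OF t])
      also have "\<dots> = ennreal (t powr \<theta> * (1 / asharp \<theta> t) * chi0 t) * (ennreal C2 * S t)"
      proof -
        have "t powr \<theta> * (1 / asharp \<theta> t) * chi0 t = t powr d * (t powr (\<theta> - d) * (1 / asharp \<theta> t) * chi0 t)"
          using t by (simp add: powr_diff)
        then show ?thesis by (simp only: ennreal_mult'[OF powr_ge_zero, of t d] mult_ac)
      qed
      finally have "ennreal (outer \<theta> t) * (L0.low t k + L0.mid t k) \<le>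
          ennreal (outer \<theta> t) * (ennreal (t powr \<theta> * (1 / asharp \<theta> t) * chi0 t) * (ennreal C2 * S t))"
        by (intro mult_left_mono) auto
      also have "\<dots> = ennreal C2 * S t"
        unfolding mult.assoc[symmetric, of "ennreal (outer \<theta> t)"]
          ennreal_mult'[OF less_imp_le[OF outer_pos[OF t]], symmetric] outer_asharp[OF t] by simp
      finally show "ennreal (outer \<theta> t) * (L0.low t k + L0.mid t k) \<le> ennreal C2 * S t" .
    qed
    also have "\<dots> \<le> ennreal C2 * (ennreal C1 * Ndiag \<theta> k)"
      using C2(1) r by (intro order_trans[OF mnorm_cmult_le] mult_left_mono S(1)) auto
    finally show ?thesis using C2(1) by (simp add: ennreal_mult' mult.assoc)
  qed
  show ?thesis
  proof (rule that[of "C2 * C1"])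
    fix k assume k: "quasiconcave k"
    show "Nlow \<theta> k \<le> ennreal (C2 * C1) * Ndiag \<theta> k"
      unfolding Nlow_def by (rule order_trans[OF mnorm_mono[OF pos_setI(1) r mult_left_mono] main[OF k]]) (auto intro: add_increasing2)
    show "Nmid \<theta> k \<le> ennreal (C2 * C1) * Ndiag \<theta> k"
      unfolding Nmid_def by (rule order_trans[OF mnorm_mono[OF pos_setI(1) r mult_left_mono] main[OF k]]) (auto intro: add_increasing)
  qed (use C1 C2 in simp)
qed

text \<open>
  Above \<open>t\<close> the majorant reads \<open>k(u) \<le> S(t) t\<^sup>-\<^sup>d u\<^sup>\<theta>\<^sup>+\<^sup>d/a\<^sup>#(u)\<close>, and \<open>\<theta> + d < 1\<close> is possible exactly
  because \<open>\<theta> < 1\<close>.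
\<close>

lemma high_hardy:
  assumes "\<theta> < 1"
  obtains C where "0 < C" "\<And>k. quasiconcave k \<Longrightarrow> Nhigh \<theta> k \<le> ennreal C * Ndiag \<theta> k"
proof -
  \<comment> \<open>Any \<open>d\<close> strictly between \<open>0\<close> and \<open>1 - \<theta>\<close> will do.\<close>
  define d where "d = (1 - \<theta>) / 2"
  have d: "0 < d" "\<theta> + d < 1" using assms by (auto simp: d_def field_simps)
  obtain C1 where C1: "0 < C1" "\<And>k. quasiconcave k \<Longrightarrow> \<exists>S. mnorm r {0<..} S \<le> ennreal C1 * Ndiag \<theta> k \<and>
    (\<forall>t>0. \<forall>u>0. k u \<le> S t * ennreal (spread u t powr d * u powr \<theta> / asharp \<theta> u))"
    using hardy_majorant[OF d(1)] by blast
  obtain C2 where C2: "0 < C2" "\<And>t Z k. 0 < t \<Longrightarrow> (\<And>u. t < u \<Longrightarrow> k u \<le> Z * ennreal (u powr (\<theta> + d) * (1 / asharp \<theta> u))) \<Longrightarrow>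
    L1.high t k \<le> ennreal C2 * (Z * ennreal (t powr (\<theta> + d - 1) * (1 / asharp \<theta> t) * chi1 t))"
    using high_bound[OF slow_inverse[OF slow_asharp] d(2)] by blast
  show ?thesis
  proof (rule that[of "C2 * C1"])
    fix k assume k: "quasiconcave k"
    obtain S where S: "mnorm r {0<..} S \<le> ennreal C1 * Ndiag \<theta> k"
      "\<And>t u. 0 < t \<Longrightarrow> 0 < u \<Longrightarrow> k u \<le> S t * ennreal (spread u t powr d * u powr \<theta> / asharp \<theta> u)"
      using C1(2)[OF k] by blast
    have "Nhigh \<theta> k \<le> mnorm r {0<..} (\<lambda>t. ennreal C2 * S t)"
      unfolding Nhigh_def
    proof (rule mnorm_mono[OF pos_setI(1) r])
      fix t :: real assume "t \<in> {0<..}"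
      then have t: "0 < t" by simp
      note p = chi_pos[OF t]
      have "k u \<le> (S t * ennreal (t powr (- d))) * ennreal (u powr (\<theta> + d) * (1 / asharp \<theta> u))" if u: "t < u" for u
      proof -
        have "spread u t powr d * u powr \<theta> / asharp \<theta> u = t powr (- d) * (u powr (\<theta> + d) * (1 / asharp \<theta> u))"
          using u t by (simp add: spread_commute[of u] spread_le powr_divide powr_minus powr_add field_simps)
        then show ?thesis using S(2)[OF t, of u] u t by (simp only: mult.assoc ennreal_mult'[OF powr_ge_zero])
      qed
      then have "L1.high t k \<le> ennreal C2 * ((S t * ennreal (t powr (- d))) * ennreal (t powr (\<theta> + d - 1) * (1 / asharp \<theta> t) * chi1 t))"
        by (rule C2(2)[OF t])
      then have "ennreal (rho t) * L1.high t k \<le> ennreal (rho t) * \<dots>" by (intro mult_left_mono) auto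
      also have "\<dots> = ennreal (t powr \<theta> * (1 / asharp \<theta> t) * chi0 t) * (ennreal C2 * S t)"
      proof -
        have "t powr \<theta> * (1 / asharp \<theta> t) * chi0 t = rho t * (t powr (- d) * (t powr (\<theta> + d - 1) * (1 / asharp \<theta> t) * chi1 t))"
          using t p by (simp add: rho_def powr_diff powr_add powr_minus)
        then show ?thesis
          unfolding ennreal_mult'[OF powr_ge_zero, of t "- d", symmetric] ennreal_mult'[OF less_imp_le[OF p(3)], symmetric]
          by (simp only: ennreal_mult'[OF less_imp_le[OF p(3)]] ennreal_mult'[OF powr_ge_zero, of t "- d"]) (simp only: mult_ac)
      qed
      finally have "ennreal (outer \<theta> t) * (ennreal (rho t) * L1.high t k) \<le>
          ennreal (outer \<theta> t) * (ennreal (t powr \<theta> * (1 / asharp \<theta> t) * chi0 t) * (ennreal C2 * S t))"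
        by (intro mult_left_mono) auto
      also have "\<dots> = ennreal C2 * S t"
        unfolding mult.assoc[symmetric, of "ennreal (outer \<theta> t)"]
          ennreal_mult'[OF less_imp_le[OF outer_pos[OF t]], symmetric] outer_asharp[OF t] by simp
      finally show "ennreal (outer \<theta> t) * (ennreal (rho t) * L1.high t k) \<le> ennreal C2 * S t" .
    qed
    also have "\<dots> \<le> ennreal C2 * (ennreal C1 * Ndiag \<theta> k)"
      using C2(1) r by (intro order_trans[OF mnorm_cmult_le] mult_left_mono S(1)) auto
    finally show "Nhigh \<theta> k \<le> ennreal (C2 * C1) * Ndiag \<theta> k" using C2(1) by (simp add: ennreal_mult' mult.assoc)
  qed (use C1 C2 in simp)
qed

text \<open>
  Substitute \<open>u = \<rho>(t)\<close> in the outer norm and insert the two-sided estimate of the K-functional at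
  \<open>\<rho>(t)\<close>.
\<close>

lemma interp_Nsum:
  obtains C where "0 < C" "\<And>f. f \<in> sum_space A0 A1 \<Longrightarrow> interp X0 X1 \<theta> r a f \<le> ennreal C * Nsum \<theta> (K f)"
    "\<And>f. f \<in> sum_space A0 A1 \<Longrightarrow> Nsum \<theta> (K f) \<le> ennreal C * interp X0 X1 \<theta> r a f"
proof -
  obtain D where D: "1 \<le> D" "tame D 1 (\<lambda>t. ennreal (a t))"
    using slow_tame[OF a zero_less_one] by blast
  define A where "A = \<bar>- \<theta>\<bar> + 1 + 1"
  have A: "0 \<le> A" by (simp add: A_def)
  let ?F = "\<lambda>f u. ennreal (u powr (- \<theta>) * a u) * Kfun X0 X1 u f"
  have F: "tame D A (?F f)" for f
  proof -
    have "tame (1 * D) (\<bar>- \<theta>\<bar> + 1) (\<lambda>t. ennreal (t powr (- \<theta>)) * ennreal (a t))"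
      by (rule tame_mult[OF tame_powr D(2)]) (use D in auto)
    then have 1: "tame D (\<bar>- \<theta>\<bar> + 1) (\<lambda>t. ennreal (t powr (- \<theta>) * a t))" by (simp add: ennreal_mult')
    show ?thesis using tame_mult[OF 1 Kfun_tame[of X0 X1 f]] D by (simp add: A_def)
  qed
  obtain C where C: "0 < C"
    "\<And>F. tame D A F \<Longrightarrow> mnorm r {0<..} F \<le> ennreal C * mnorm r {0<..} (\<lambda>t. F (t * (chi0 t / chi1 t)))"
    "\<And>F. tame D A F \<Longrightarrow> mnorm r {0<..} (\<lambda>t. F (t * (chi0 t / chi1 t))) \<le> ennreal C * mnorm r {0<..} F"
    using change_of_variable[OF r D(1) A slow_ratio] by blast
  obtain C1 where C1: "0 < C1" "\<And>t f. 0 < t \<Longrightarrow> f \<in> sum_space A0 A1 \<Longrightarrow> Kfun X0 X1 (rho t) f \<le> ennreal C1 * holmstedt_sum t (K f)"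
    using holmstedt_upper by blast
  obtain C2 where C2: "0 < C2" "\<And>t f. 0 < t \<Longrightarrow> holmstedt_sum t (K f) \<le> ennreal C2 * Kfun X0 X1 (rho t) f"
    using holmstedt_lower by blast
  have i: "interp X0 X1 \<theta> r a f = mnorm r {0<..} (?F f)" for f
    by (simp add: interp_eq_wnorm[OF r a] wnorm_eq)
  have G: "mnorm r {0<..} (\<lambda>t. ?F f (t * (chi0 t / chi1 t))) = mnorm r {0<..} (\<lambda>t. ennreal (outer \<theta> t) * Kfun X0 X1 (rho t) f)" for f
    by (simp add: outer_def rho_def)
  define M where "M = max (C * C1) (C2 * C)"
  show ?thesis
  proof (rule that[of M])
    fix f assume f: "f \<in> sum_space A0 A1"
    have "interp X0 X1 \<theta> r a f \<le> ennreal C * mnorm r {0<..} (\<lambda>t. ennreal (outer \<theta> t) * Kfun X0 X1 (rho t) f)"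
      unfolding i G[symmetric] by (rule C(2)[OF F])
    also have "\<dots> \<le> ennreal C * mnorm r {0<..} (\<lambda>t. ennreal C1 * (ennreal (outer \<theta> t) * holmstedt_sum t (K f)))"
      unfolding mult.left_commute[of "ennreal C1"] using r f by (intro mult_left_mono mnorm_mono C1(2)) auto
    also have "\<dots> \<le> ennreal C * (ennreal C1 * Nsum \<theta> (K f))"
      unfolding Nsum_def using C1 r by (intro mult_left_mono mnorm_cmult_le) auto
    also have "\<dots> = ennreal (C * C1) * Nsum \<theta> (K f)" using C(1) by (simp add: ennreal_mult' mult.assoc)
    also have "\<dots> \<le> ennreal M * Nsum \<theta> (K f)" by (intro mult_right_mono ennreal_leI) (auto simp: M_def)
    finally show "interp X0 X1 \<theta> r a f \<le> ennreal M * Nsum \<theta> (K f)" .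
    have "Nsum \<theta> (K f) \<le> mnorm r {0<..} (\<lambda>t. ennreal C2 * (ennreal (outer \<theta> t) * Kfun X0 X1 (rho t) f))"
      unfolding Nsum_def mult.left_commute[of "ennreal C2"] using r by (intro mult_left_mono mnorm_mono C2(2)) auto
    also have "\<dots> \<le> ennreal C2 * mnorm r {0<..} (\<lambda>t. ennreal (outer \<theta> t) * Kfun X0 X1 (rho t) f)"
      using C2 r by (intro mnorm_cmult_le) auto
    also have "\<dots> \<le> ennreal C2 * (ennreal C * interp X0 X1 \<theta> r a f)"
      unfolding i G[symmetric] by (intro mult_left_mono C(3)[OF F]) simp
    also have "\<dots> = ennreal (C2 * C) * interp X0 X1 \<theta> r a f" using C2(1) by (simp add: ennreal_mult' mult.assoc)
    also have "\<dots> \<le> ennreal M * interp X0 X1 \<theta> r a f" by (intro mult_right_mono ennreal_leI) (auto simp: M_def)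
    finally show "Nsum \<theta> (K f) \<le> ennreal M * interp X0 X1 \<theta> r a f" .
  qed (use C C1 in \<open>simp add: M_def less_max_iff_disj\<close>)
qed

lemma interp_outside: "f \<notin> sum_space A0 A1 \<Longrightarrow> interp X0 X1 \<theta> r a f = top"
proof -
  assume f: "f \<notin> sum_space A0 A1"
  obtain C where C: "1 \<le> C" "\<And>f g. A0 (f + g) \<le> ennreal C * (A0 f + A0 g)"
    using quasi_norm_add[OF qnorm(1)] by blast
  obtain C' where C': "1 \<le> C'" "\<And>f g. A1 (f + g) \<le> ennreal C' * (A1 f + A1 g)"
    using quasi_norm_add[OF qnorm(2)] by blast
  have add: "g + h \<in> sum_space A0 A1" if gs: "g \<in> sum_space A0 A1" and hs: "h \<in> sum_space A0 A1" for g h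
  proof -
    obtain g0 g1 where g: "g = g0 + g1" "A0 g0 < top" "A1 g1 < top"
      using gs by (auto simp: sum_space_def qspace_def)
    obtain h0 h1 where h: "h = h0 + h1" "A0 h0 < top" "A1 h1 < top"
      using hs by (auto simp: sum_space_def qspace_def)
    note gh = g h
    have "A0 (g0 + h0) < top" by (rule le_less_trans[OF C(2)]) (use gh in \<open>simp add: ennreal_mult_less_top\<close>)
    moreover have "A1 (g1 + h1) < top" by (rule le_less_trans[OF C'(2)]) (use gh in \<open>simp add: ennreal_mult_less_top\<close>)
    moreover have "g + h = (g0 + h0) + (g1 + h1)" by (simp add: gh)
    ultimately show ?thesis unfolding sum_space_def qspace_def by auto
  qed
  have "f \<notin> sum_space X0 X1"
  proof
    assume "f \<in> sum_space X0 X1"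
    then obtain f0 f1 where "f0 \<in> qspace X0" "f1 \<in> qspace X1" "f = f0 + f1" by (auto simp: sum_space_def)
    then show False using f add by (auto simp: qspace_def X0_eq X1_eq split: if_splits)
  qed
  then show ?thesis by (simp add: interp_def restrict_norm_def)
qed

lemma Ndiag_interp: "f \<in> sum_space A0 A1 \<Longrightarrow> interp A0 A1 \<theta> r (asharp \<theta>) f = Ndiag \<theta> (K f)"
  by (simp add: interp_def restrict_norm_def wnorm_eq Ndiag_eq)

lemma same_spaceI:
  assumes C: "0 < C" "\<And>f. f \<in> sum_space A0 A1 \<Longrightarrow> Nsum \<theta> (K f) \<le> ennreal C * N f"
    "\<And>f. f \<in> sum_space A0 A1 \<Longrightarrow> N f \<le> ennreal C * Nsum \<theta> (K f)"
    and out: "\<And>f. f \<notin> sum_space A0 A1 \<Longrightarrow> N f = top"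
  shows "same_space (interp X0 X1 \<theta> r a) N"
proof -
  obtain E where E: "0 < E" "\<And>f. f \<in> sum_space A0 A1 \<Longrightarrow> interp X0 X1 \<theta> r a f \<le> ennreal E * Nsum \<theta> (K f)"
    "\<And>f. f \<in> sum_space A0 A1 \<Longrightarrow> Nsum \<theta> (K f) \<le> ennreal E * interp X0 X1 \<theta> r a f"
    using interp_Nsum by blast
  have EC: "0 < E * C" using E C by simp
  have "interp X0 X1 \<theta> r a f \<le> ennreal (E * C) * N f" for f
  proof (cases "f \<in> sum_space A0 A1")
    case True
    have "interp X0 X1 \<theta> r a f \<le> ennreal E * (ennreal C * N f)"
      by (rule order_trans[OF E(2)[OF True]]) (intro mult_left_mono C(2) True; simp)
    then show ?thesis using E(1) by (simp add: ennreal_mult' mult.assoc)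
  next
    case False
    show ?thesis unfolding out[OF False] ennreal_pos_mult_top[OF EC] by (rule top_greatest)
  qed
  moreover have "N f \<le> ennreal (E * C) * interp X0 X1 \<theta> r a f" for f
  proof (cases "f \<in> sum_space A0 A1")
    case True
    have "N f \<le> ennreal C * (ennreal E * interp X0 X1 \<theta> r a f)"
      by (rule order_trans[OF C(3)[OF True]]) (intro mult_left_mono E(3) True; simp)
    then show ?thesis using C(1) by (simp add: ennreal_mult' mult_ac)
  next
    case False
    show ?thesis unfolding interp_outside[OF False] ennreal_pos_mult_top[OF EC] by (rule top_greatest)
  qed
  ultimately show ?thesis
    unfolding same_space_def using EC cont_embeddedI by blast
qed

theorem interp_interior:
  assumes \<theta>: "0 < \<theta>" "\<theta> < 1"
  shows "same_space (interp X0 X1 \<theta> r a) (interp A0 A1 \<theta> r (asharp \<theta>))"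
proof -
  obtain C where C: "0 < C" "\<And>k. quasiconcave k \<Longrightarrow> Nsum \<theta> k \<le> ennreal C * (Nlow \<theta> k + Nmid \<theta> k + Ndiag \<theta> k + Nhigh \<theta> k)"
    using Nsum_le by blast
  obtain C1 where C1: "0 < C1" "\<And>k. quasiconcave k \<Longrightarrow> Nlow \<theta> k \<le> ennreal C1 * Ndiag \<theta> k" "\<And>k. quasiconcave k \<Longrightarrow> Nmid \<theta> k \<le> ennreal C1 * Ndiag \<theta> k"
    using low_mid_hardy[OF \<theta>(1)] by blast
  obtain C2 where C2: "0 < C2" "\<And>k. quasiconcave k \<Longrightarrow> Nhigh \<theta> k \<le> ennreal C2 * Ndiag \<theta> k"
    using high_hardy[OF \<theta>(2)] by blast
  define M where "M = max 1 (C * (C1 + C1 + 1 + C2))"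
  show ?thesis
  proof (rule same_spaceI)
    fix f assume f: "f \<in> sum_space A0 A1"
    let ?N = "Ndiag \<theta> (K f)"
    have k: "quasiconcave (K f)" by (rule quasiconcave_Kfun[OF f])
    have "Nsum \<theta> (K f) \<le> ennreal C * (ennreal C1 * ?N + ennreal C1 * ?N + ?N + ennreal C2 * ?N)"
      by (rule order_trans[OF C(2)[OF k]]) (intro mult_left_mono add_mono C1 C2 k order_refl; simp)
    also have "ennreal C1 * ?N + ennreal C1 * ?N + ?N + ennreal C2 * ?N = ennreal (C1 + C1 + 1 + C2) * ?N"
      using C1(1) C2(1) by (simp only: ennreal_plus add_nonneg_nonneg less_imp_le zero_le_one distrib_right ennreal_1 mult_1_left)
    also have "ennreal C * (ennreal (C1 + C1 + 1 + C2) * ?N) = ennreal (C * (C1 + C1 + 1 + C2)) * ?N"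
      using C(1) by (simp only: ennreal_mult' less_imp_le mult.assoc)
    also have "\<dots> \<le> ennreal M * ?N" by (intro mult_right_mono ennreal_leI) (auto simp: M_def)
    finally show "Nsum \<theta> (K f) \<le> ennreal M * interp A0 A1 \<theta> r (asharp \<theta>) f"
      by (simp add: Ndiag_interp[OF f])
    have "?N \<le> 1 * Nsum \<theta> (K f)" using parts_le_Nsum(3) by simp
    also have "\<dots> \<le> ennreal M * Nsum \<theta> (K f)"
      by (intro mult_right_mono) (auto simp: M_def simp flip: ennreal_1 intro!: ennreal_leI simp del: ennreal_1)
    finally show "interp A0 A1 \<theta> r (asharp \<theta>) f \<le> ennreal M * Nsum \<theta> (K f)"
      by (simp add: Ndiag_interp[OF f])
  qed (auto simp: M_def interp_def restrict_norm_def)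
qed

text \<open>
  For \<open>\<theta> = 0\<close> only the term \<open>high\<close> is absorbed; \<open>low\<close> and \<open>mid\<close> are the norms of the two additional
  spaces, because the outer weight is just \<open>a \<circ> \<rho>\<close>.
\<close>

theorem interp_left:
  assumes B: "\<And>t. 0 < t \<Longrightarrow> B t = enn2real (L0.tail t) * a (rho t)"
  shows "same_space (interp X0 X1 0 r a) (inter_norm (interp A0 A1 0 r (asharp 0))
    (inter_norm (interp_L A0 A1 0 r B q0 a0) (interp_LL A0 A1 0 r (a \<circ> rho) r0 b0 q0 a0)))"
    (is "same_space _ ?N")
proof -
  obtain C where C: "0 < C" "\<And>k. quasiconcave k \<Longrightarrow> Nsum 0 k \<le> ennreal C * (Nlow 0 k + Nmid 0 k + Ndiag 0 k + Nhigh 0 k)"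
    using Nsum_le by blast
  obtain C2 where C2: "0 < C2" "\<And>k. quasiconcave k \<Longrightarrow> Nhigh 0 k \<le> ennreal C2 * Ndiag 0 k"
    using high_hardy[OF zero_less_one] by blast
  define M where "M = max 1 (C * (3 + C2))"
  have LL: "interp_LL A0 A1 0 r (a \<circ> rho) r0 b0 q0 a0 f = Nlow 0 (K f)" if f: "f \<in> sum_space A0 A1" for f
  proof -
    have "wnorm 0 r (a \<circ> rho) {0<..} (\<lambda>t. L0.low t (K f)) = Nlow 0 (K f)"
      unfolding wnorm_eq[of 0 r] Nlow_def
    proof (rule mnorm_cong[OF pos_setI(1) r])
      fix t :: real assume "t \<in> {0<..}"
      then have t: "0 < t" by simp
      then show "ennreal (t powr - 0 * (a \<circ> rho) t) * L0.low t (K f) = ennreal (outer 0 t) * L0.low t (K f)"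
        using chi_pos(3)[OF t] by (simp add: outer_def)
    qed
    then show ?thesis using f by (simp add: interp_LL_def restrict_norm_def L0.low_def)
  qed
  have L: "interp_L A0 A1 0 r B q0 a0 f = Nmid 0 (K f)" if f: "f \<in> sum_space A0 A1" for f
  proof -
    have "wnorm 0 r B {0<..} (\<lambda>t. wnorm 0 q0 a0 {0<..<t} (K f)) = Nmid 0 (K f)"
      unfolding wnorm_eq[of 0 r] Nmid_def L0.mid_def
    proof (rule mnorm_cong[OF pos_setI(1) r])
      fix t :: real assume "t \<in> {0<..}"
      then have t: "0 < t" by simp
      have "ennreal (t powr - 0 * B t) = ennreal (outer 0 t) * L0.tail t"
        using t chi_pos(3)[OF t] tail0_finite[OF t] slow_pos[OF a chi_pos(3)[OF t]]
        by (simp add: B outer_def ennreal_mult' mult.commute)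
      then show "ennreal (t powr - 0 * B t) * wnorm 0 q0 a0 {0<..<t} (K f) = ennreal (outer 0 t) * (L0.tail t * wnorm 0 q0 a0 {0<..<t} (K f))"
        by (simp only: mult.assoc)
    qed
    then show ?thesis using f by (simp add: interp_L_def restrict_norm_def)
  qed
  have N: "?N f = max (Ndiag 0 (K f)) (max (Nmid 0 (K f)) (Nlow 0 (K f)))" if f: "f \<in> sum_space A0 A1" for f
    by (simp add: inter_norm_def LL[OF f] L[OF f] Ndiag_interp[OF f])
  show ?thesis
  proof (rule same_spaceI)
    fix f assume f: "f \<in> sum_space A0 A1"
    let ?n = "max (Ndiag 0 (K f)) (max (Nmid 0 (K f)) (Nlow 0 (K f)))"
    have k: "quasiconcave (K f)" by (rule quasiconcave_Kfun[OF f])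
    have le: "Nlow 0 (K f) \<le> ?n" "Nmid 0 (K f) \<le> ?n" "Ndiag 0 (K f) \<le> ?n" by (auto simp: le_max_iff_disj)
    have "Nsum 0 (K f) \<le> ennreal C * (?n + ?n + ?n + ennreal C2 * ?n)"
      by (rule order_trans[OF C(2)[OF k]])
        (intro mult_left_mono add_mono le order_trans[OF C2(2)[OF k] mult_left_mono[OF le(3)]]; simp)
    also have "?n + ?n + ?n = ennreal 3 * ?n" by (rule ennreal_triple)
    also have "ennreal 3 * ?n + ennreal C2 * ?n = ennreal (3 + C2) * ?n"
      using C2(1) by (simp add: distrib_right)
    also have "ennreal C * (ennreal (3 + C2) * ?n) = ennreal (C * (3 + C2)) * ?n"
      using C(1) by (simp only: ennreal_mult' less_imp_le mult.assoc)
    also have "\<dots> \<le> ennreal M * ?n" by (intro mult_right_mono ennreal_leI) (auto simp: M_def)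
    finally show "Nsum 0 (K f) \<le> ennreal M * ?N f" unfolding N[OF f] .
    have "?n \<le> 1 * Nsum 0 (K f)" using parts_le_Nsum[of 0 "K f"] by simp
    also have "\<dots> \<le> ennreal M * Nsum 0 (K f)"
      by (intro mult_right_mono) (auto simp: M_def simp flip: ennreal_1 intro!: ennreal_leI simp del: ennreal_1)
    finally show "?N f \<le> ennreal M * Nsum 0 (K f)" unfolding N[OF f] .
  qed (auto simp: M_def interp_def restrict_norm_def inter_norm_def)
qed

text \<open>
  For \<open>\<theta> = 1\<close> the terms \<open>low\<close> and \<open>mid\<close> are absorbed, and the factor \<open>\<rho>(t)\<close> in front of \<open>high\<close>
  cancels against \<open>\<rho>(t)\<^sup>-\<^sup>1\<close> in the outer weight.
\<close>

theorem interp_right: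
  "same_space (interp X0 X1 1 r a) (inter_norm (interp A0 A1 1 r (asharp 1))
    (interp_LR A0 A1 1 r (a \<circ> rho) r1 b1 q1 a1))" (is "same_space _ ?N")
proof -
  obtain C where C: "0 < C" "\<And>k. quasiconcave k \<Longrightarrow> Nsum 1 k \<le> ennreal C * (Nlow 1 k + Nmid 1 k + Ndiag 1 k + Nhigh 1 k)"
    using Nsum_le by blast
  obtain C1 where C1: "0 < C1" "\<And>k. quasiconcave k \<Longrightarrow> Nlow 1 k \<le> ennreal C1 * Ndiag 1 k" "\<And>k. quasiconcave k \<Longrightarrow> Nmid 1 k \<le> ennreal C1 * Ndiag 1 k"
    using low_mid_hardy[OF zero_less_one] by blast
  define M where "M = max 1 (C * (C1 + C1 + 1 + 1))"
  have LR: "interp_LR A0 A1 1 r (a \<circ> rho) r1 b1 q1 a1 f = Nhigh 1 (K f)" if f: "f \<in> sum_space A0 A1" for f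
  proof -
    have "wnorm 0 r (a \<circ> rho) {0<..} (\<lambda>t. L1.high t (K f)) = Nhigh 1 (K f)"
      unfolding wnorm_eq[of 0 r] Nhigh_def
    proof (rule mnorm_cong[OF pos_setI(1) r])
      fix t :: real assume "t \<in> {0<..}"
      then have t: "0 < t" by simp
      have "t powr - 0 * (a \<circ> rho) t = outer 1 t * rho t"
        using t chi_pos(3)[OF t] by (simp add: outer_def powr_minus field_simps)
      then have "ennreal (t powr - 0 * (a \<circ> rho) t) = ennreal (outer 1 t) * ennreal (rho t)"
        by (simp only: ennreal_mult'[OF less_imp_le[OF outer_pos[OF t, of 1]]])
      then show "ennreal (t powr - 0 * (a \<circ> rho) t) * L1.high t (K f) = ennreal (outer 1 t) * (ennreal (rho t) * L1.high t (K f))"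
        by (simp only: mult.assoc)
    qed
    then show ?thesis using f by (simp add: interp_LR_def restrict_norm_def L1.high_def)
  qed
  have N: "?N f = max (Ndiag 1 (K f)) (Nhigh 1 (K f))" if f: "f \<in> sum_space A0 A1" for f
    by (simp add: inter_norm_def LR[OF f] Ndiag_interp[OF f])
  show ?thesis
  proof (rule same_spaceI)
    fix f assume f: "f \<in> sum_space A0 A1"
    let ?n = "max (Ndiag 1 (K f)) (Nhigh 1 (K f))"
    have k: "quasiconcave (K f)" by (rule quasiconcave_Kfun[OF f])
    have le: "Nhigh 1 (K f) \<le> ?n" "Ndiag 1 (K f) \<le> ?n" by (auto simp: le_max_iff_disj)
    have "Nsum 1 (K f) \<le> ennreal C * (ennreal C1 * ?n + ennreal C1 * ?n + ?n + ?n)"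
      by (rule order_trans[OF C(2)[OF k]])
        (intro mult_left_mono add_mono le order_trans[OF C1(2)[OF k] mult_left_mono[OF le(2)]]
          order_trans[OF C1(3)[OF k] mult_left_mono[OF le(2)]]; simp)
    also have "ennreal C1 * ?n + ennreal C1 * ?n + ?n + ?n = ennreal (C1 + C1 + 1 + 1) * ?n"
      using C1(1) by (simp only: ennreal_plus add_nonneg_nonneg less_imp_le zero_le_one distrib_right ennreal_1 mult_1_left)
    also have "ennreal C * (ennreal (C1 + C1 + 1 + 1) * ?n) = ennreal (C * (C1 + C1 + 1 + 1)) * ?n"
      using C(1) by (simp only: ennreal_mult' less_imp_le mult.assoc)
    also have "\<dots> \<le> ennreal M * ?n" by (intro mult_right_mono ennreal_leI) (auto simp: M_def)
    finally show "Nsum 1 (K f) \<le> ennreal M * ?N f" unfolding N[OF f] .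
    have "?n \<le> 1 * Nsum 1 (K f)" using parts_le_Nsum[of 1 "K f"] by simp
    also have "\<dots> \<le> ennreal M * Nsum 1 (K f)"
      by (intro mult_right_mono) (auto simp: M_def simp flip: ennreal_1 intro!: ennreal_leI simp del: ennreal_1)
    finally show "?N f \<le> ennreal M * Nsum 1 (K f)" unfolding N[OF f] .
  qed (auto simp: M_def interp_def restrict_norm_def inter_norm_def)
qed

end

theorem theorem31:
  fixes A0 A1 :: "'a::real_vector \<Rightarrow> ennreal"
    and q0 q1 r0 r1 r :: ennreal
    and a a0 a1 b0 b1 \<chi>0 \<chi>1 \<rho> B0 :: "real \<Rightarrow> real"
    and asharp :: "real \<Rightarrow> real \<Rightarrow> real"
    and X0 X1 :: "'a \<Rightarrow> ennreal"
  assumes couple: "compatible_quasi_banach_couple A0 A1"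
    and inter: "qspace A0 \<inter> qspace A1 \<noteq> {0}"
    and exps: "0 < q0" "0 < q1" "0 < r0" "0 < r1" "0 < r"
    and sv: "a \<in> SV" "a0 \<in> SV" "a1 \<in> SV" "b0 \<in> SV" "b1 \<in> SV"
    and fin1: "wnorm 0 r1 b1 {1<..} (\<lambda>s. 1) < \<infinity>"
    and fin1': "wnorm 0 r1 b1 {0<..<1} (\<lambda>s. wnorm 0 q1 a1 {0<..<s} (\<lambda>u. 1)) < \<infinity>"
    and fin0: "wnorm 0 r0 b0 {1<..} (\<lambda>s. wnorm 0 q0 a0 {1<..<s} (\<lambda>u. 1)) < \<infinity>"
    and \<chi>1: "\<chi>1 = (\<lambda>t. enn2real (
               wnorm 0 r1 b1 {0<..<t} (\<lambda>s. wnorm 0 q1 a1 {0<..<s} (\<lambda>u. 1))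
             + wnorm 0 r1 b1 {t<..} (\<lambda>s. 1) * wnorm 0 q1 a1 {0<..<t} (\<lambda>u. 1)))"
    and \<chi>0: "\<chi>0 = (\<lambda>t. enn2real (
               wnorm 0 r0 b0 {t<..} (\<lambda>s. wnorm 0 q0 a0 {t<..<s} (\<lambda>u. 1))))"
    and \<rho>: "\<rho> = (\<lambda>t. t * (\<chi>0 t / \<chi>1 t))"
    and asharp: "asharp = (\<lambda>\<theta> t. \<chi>0 t powr (1 - \<theta>) * \<chi>1 t powr \<theta> * (a \<circ> \<rho>) t)"
    and B0: "B0 = (\<lambda>t. enn2real (wnorm 0 r0 b0 {t<..} (\<lambda>s. 1)) * a (\<rho> t))"
    and X0: "X0 = interp_L A0 A1 0 r0 b0 q0 a0"
    and X1: "X1 = interp_L A0 A1 1 r1 b1 q1 a1"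
    and nontriv: "nontrivial X0" "nontrivial X1"
  shows
    "(\<forall>\<theta>. 0 < \<theta> \<and> \<theta> < 1 \<and>
        nontrivial (interp X0 X1 \<theta> r a) \<and>
        nontrivial (interp A0 A1 \<theta> r (asharp \<theta>)) \<longrightarrow>
        same_space (interp X0 X1 \<theta> r a) (interp A0 A1 \<theta> r (asharp \<theta>)))
   \<and> (wnorm 0 r a {1<..} (\<lambda>s. 1) < \<infinity> \<and>
        nontrivial (interp X0 X1 0 r a) \<and>
        nontrivial (interp A0 A1 0 r (asharp 0)) \<and>
        nontrivial (interp_L A0 A1 0 r B0 q0 a0) \<and>
        nontrivial (interp_LL A0 A1 0 r (a \<circ> \<rho>) r0 b0 q0 a0) \<longrightarrow>
        same_space (interp X0 X1 0 r a)
          (inter_norm (interp A0 A1 0 r (asharp 0))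
            (inter_norm (interp_L A0 A1 0 r B0 q0 a0)
              (interp_LL A0 A1 0 r (a \<circ> \<rho>) r0 b0 q0 a0))))
   \<and> (wnorm 0 r a {0<..<1} (\<lambda>s. 1) < \<infinity> \<and>
        nontrivial (interp X0 X1 1 r a) \<and>
        nontrivial (interp A0 A1 1 r (asharp 1)) \<and>
        nontrivial (interp_LR A0 A1 1 r (a \<circ> \<rho>) r1 b1 q1 a1) \<longrightarrow>
        same_space (interp X0 X1 1 r a)
          (inter_norm (interp A0 A1 1 r (asharp 1))
            (interp_LR A0 A1 1 r (a \<circ> \<rho>) r1 b1 q1 a1)))"
proof -
  interpret H: holmstedt_outer r0 b0 q0 a0 r1 b1 q1 a1 A0 A1 r a
    by unfold_locales (use exps sv couple fin1 fin1' fin0 in \<open>simp_all add: SV_weight SV_slow\<close>)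
  have chi: "\<chi>0 = H.chi0" "\<chi>1 = H.chi1"
    by (simp_all add: \<chi>0 \<chi>1 fun_eq_iff H.chi0_def H.chi1_def H.E0_def H.E1_def)
  have rho: "\<rho> = H.rho" by (simp add: \<rho> chi H.rho_def fun_eq_iff)
  have ash: "asharp = H.asharp" by (simp add: asharp chi rho H.asharp_def fun_eq_iff)
  have B: "B0 t = enn2real (H.L0.tail t) * a (H.rho t)" for t
    by (simp add: B0 rho H.L0.tail_def)
  have X: "X0 = H.X0" "X1 = H.X1" by (simp_all add: X0 X1 H.X0_def H.X1_def)
  show ?thesis
    unfolding ash rho X using H.interp_interior H.interp_left[OF B] H.interp_right by blast
qed

end
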